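(* Let $d\ge1$ and $T>0$. For $\beta\in(0,1)$ and $p\in\mathbb R^d$ define $H_\beta(p):=|p|^\beta$. Let $\alpha,\beta\in(0,1)$. Then $H_\beta\in\mathscr H_{\alpha,1}$ if and only if $\alpha+\beta>1$. Moreover, let $u_0(x)=|x|$ for $x\in\mathbb R^d$ and, for $W\in W^{1,1}_0([0,T],\mathbb R)$, let $S(H_\beta,W)$ be the viscosity solution of $u_t=|Du|^\beta\dot W(t)$ in $\mathbb R^d\times(0,T]$, $u(\cdot,0)=u_0$. Then: (a) If $\alpha+\beta<1$, there exists a sequence $(W_n)_{n\in\mathbb N}\subset W^{1,1}_0([0,T],\mathbb R)$ such that $W_n\to0$ uniformly, $\sup_n\|W_n\|_{\mathscr P_{\alpha,\infty}}<\infty$, and $\lim_{n\to\infty}S(H_\beta,W_n)(x,t)=+\infty$ for all $(x,t)\in\mathbb R^d\times(0,T]$. (b) For any $c_0>0$, there exists a sequence $(W_n)_{n\in\mathbb N}\subset W^{1,1}_0([0,T],\mathbb R)$ such that $W_n\to0$ uniformly, $\sup_n\|W_n\|_{\mathscr P_{\alpha,\infty}}<\infty$, and $$\lim_{n\to\infty}\ \sup_{(x,t)\in\mathbb R^d\times[0,T]}\big|S(H_{1-\alpha},W_n)(x,t)-(|x|\vee c_0t^\alpha)\big|=0.$$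
   Context: $B_L$ is the open ball of radius $L$ centered at $0$ in $\mathbb R^d$; $a\vee b=\max(a,b)$. Real interpolation: for compatible normed spaces $X_0,X_1$ and $x\in X_0+X_1$, $K(t,x,X_0,X_1)=\inf\{\|x_0\|_{X_0}+t\|x_1\|_{X_1}:x=x_0+x_1\}$; $(X_0,X_1)_{\alpha,q}$ is the set of $x$ with finite norm $\big[\int_0^\infty(t^{-\alpha}K(t,x,X_0,X_1))^q\frac{dt}t\big]^{1/q}$ (resp. $\sup_{t>0}t^{-\alpha}K$ if $q=\infty$). $DC(B_L)$ is the space of $f=f_1-f_2$ with $f_1,f_2$ convex on $B_L$, with norm $\inf\{\|f_1\|_{\infty,B_L}+\|f_2\|_{\infty,B_L}\}$ over such decompositions; $C(B_L)$ carries the sup norm. $\mathscr H_{\alpha,1}$ is the set of $H\in C(\mathbb R^d)$ with $H|_{B_L}\in(DC(B_L),C(B_L))_{\alpha,1}$ for every $L>0$. $\mathscr P_{\alpha,\infty}:=(C_0([0,T]),W^{1,1}_0([0,T]))_{\alpha,\infty}$, where the subscript $0$ means $W(0)=0$; $C_0$ has the sup norm and $W^{1,1}_0$ the norm $\|\dot W\|_{L^1}$. For $W\in W_0^{1,1}$ the equation is understood in the classical viscosity sense (for $\dot W\in L^1$, in the sense of Ishii and Lions–Perthame), with a unique solution that is uniformly continuous on $\mathbb R^d\times[0,T]$. *)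

theory Defs
  imports "HOL-Analysis.Analysis" "HOL-Library.Function_Algebras"
begin

section \<open>Real interpolation\<close>

text \<open>
  A normed space inside an ambient additive type is given as a pair of its carrier and its norm;
  only the values of the norm on the carrier matter. Two such pairs over the same type are
  compatible. Functions on a set \<open>A\<close> are represented by functions on the whole type that vanish
  outside \<open>A\<close>, with the pointwise addition of \<open>Function_Algebras\<close>.
\<close>

type_synonym 'v nspace = "'v set \<times> ('v \<Rightarrow> real)"

definition sum_space :: "'v::plus nspace \<Rightarrow> 'v nspace \<Rightarrow> 'v set" where
  "sum_space X0 X1 = {x0 + x1 | x0 x1. x0 \<in> fst X0 \<and> x1 \<in> fst X1}"

definition K_functional :: "real \<Rightarrow> 'v::plus \<Rightarrow> 'v nspace \<Rightarrow> 'v nspace \<Rightarrow> real" where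
  "K_functional t x X0 X1 =
     Inf {snd X0 x0 + t * snd X1 x1 | x0 x1. x0 \<in> fst X0 \<and> x1 \<in> fst X1 \<and> x = x0 + x1}"

definition interp_norm :: "'v::plus nspace \<Rightarrow> 'v nspace \<Rightarrow> real \<Rightarrow> ereal \<Rightarrow> 'v \<Rightarrow> ennreal" where
  "interp_norm X0 X1 \<alpha> q x =
     (if q = \<infinity> then (SUP t\<in>{0<..}. ennreal (t powr (-\<alpha>) * K_functional t x X0 X1))
      else (let r = real_of_ereal q;
                I = (\<integral>\<^sup>+ t\<in>{0<..}. ennreal ((t powr (-\<alpha>) * K_functional t x X0 X1) powr r / t) \<partial>lborel)
            in if I = \<infinity> then \<infinity> else ennreal (enn2real I powr (1 / r))))"

definition interp_space :: "'v::plus nspace \<Rightarrow> 'v nspace \<Rightarrow> real \<Rightarrow> ereal \<Rightarrow> 'v set" where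
  "interp_space X0 X1 \<alpha> q = {x \<in> sum_space X0 X1. interp_norm X0 X1 \<alpha> q x < \<infinity>}"

section \<open>Hamiltonians\<close>

definition sup_norm :: "'a set \<Rightarrow> ('a \<Rightarrow> real) \<Rightarrow> real" where
  "sup_norm A f = (SUP x\<in>A. \<bar>f x\<bar>)"

text \<open>
  A convex function on an open ball may be unbounded. Only bounded pairs give a finite value of
  the expression defining the norm of \<open>DC(B\<^sub>L)\<close>, so decompositions are required to be bounded.
\<close>

definition DC_decomp ::
  "real \<Rightarrow> ('a::euclidean_space \<Rightarrow> real) \<Rightarrow> ('a \<Rightarrow> real) \<Rightarrow> ('a \<Rightarrow> real) \<Rightarrow> bool" where
  "DC_decomp L f f1 f2 \<longleftrightarrow>
     convex_on (ball 0 L) f1 \<and> convex_on (ball 0 L) f2 \<and>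
     bounded (f1 ` ball 0 L) \<and> bounded (f2 ` ball 0 L) \<and>
     (\<forall>x\<in>ball 0 L. f x = f1 x - f2 x)"

definition DC_space :: "real \<Rightarrow> ('a::euclidean_space \<Rightarrow> real) nspace" where
  "DC_space L =
     ({f. (\<forall>x. x \<notin> ball 0 L \<longrightarrow> f x = 0) \<and> (\<exists>f1 f2. DC_decomp L f f1 f2)},
      \<lambda>f. Inf {sup_norm (ball 0 L) f1 + sup_norm (ball 0 L) f2 | f1 f2. DC_decomp L f f1 f2})"

definition C_space :: "real \<Rightarrow> ('a::euclidean_space \<Rightarrow> real) nspace" where
  "C_space L =
     ({f. (\<forall>x. x \<notin> ball 0 L \<longrightarrow> f x = 0) \<and> continuous_on (ball 0 L) f \<and> bounded (f ` ball 0 L)},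
      sup_norm (ball 0 L))"

definition restrict_ball :: "real \<Rightarrow> ('a::euclidean_space \<Rightarrow> real) \<Rightarrow> 'a \<Rightarrow> real" where
  "restrict_ball L H = (\<lambda>x. if x \<in> ball 0 L then H x else 0)"

definition Ham_space :: "real \<Rightarrow> ('a::euclidean_space \<Rightarrow> real) set" where
  "Ham_space \<alpha> = {H. continuous_on UNIV H \<and>
     (\<forall>L>0. restrict_ball L H \<in> interp_space (DC_space L) (C_space L) \<alpha> 1)}"

definition H_power :: "real \<Rightarrow> 'a::euclidean_space \<Rightarrow> real" where
  "H_power \<beta> p = norm p powr \<beta>"

section \<open>Paths\<close>

definition C0_space :: "real \<Rightarrow> (real \<Rightarrow> real) nspace" where
  "C0_space T =
     ({W. (\<forall>t. t \<notin> {0..T} \<longrightarrow> W t = 0) \<and> continuous_on {0..T} W \<and> W 0 = 0}, sup_norm {0..T})"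

text \<open>
  \<open>W\<^sup>1\<^sup>,\<^sup>1\<close> in one dimension: primitives of Lebesgue integrable functions. The derivative is
  determined up to null sets, and nothing below depends on the chosen representative.
\<close>

definition has_weak_deriv :: "real \<Rightarrow> (real \<Rightarrow> real) \<Rightarrow> (real \<Rightarrow> real) \<Rightarrow> bool" where
  "has_weak_deriv T W w \<longleftrightarrow>
     set_integrable lborel {0..T} w \<and> (\<forall>t\<in>{0..T}. W t = W 0 + (LBINT s:{0..t}. w s))"

definition weak_deriv :: "real \<Rightarrow> (real \<Rightarrow> real) \<Rightarrow> real \<Rightarrow> real" where
  "weak_deriv T W = (SOME w. has_weak_deriv T W w)"

definition W11_space :: "real \<Rightarrow> (real \<Rightarrow> real) nspace" where
  "W11_space T =
     ({W. (\<forall>t. t \<notin> {0..T} \<longrightarrow> W t = 0) \<and> W 0 = 0 \<and> (\<exists>w. has_weak_deriv T W w)},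
      \<lambda>W. LBINT t:{0..T}. \<bar>weak_deriv T W t\<bar>)"

definition path_norm :: "real \<Rightarrow> real \<Rightarrow> (real \<Rightarrow> real) \<Rightarrow> ennreal" where
  "path_norm T \<alpha> = interp_norm (C0_space T) (W11_space T) \<alpha> \<infinity>"

section \<open>Viscosity solutions with integrable time dependence\<close>

text \<open>
  Ishii's definition for \<open>u\<^sub>t = F(t, Du)\<close> in \<open>\<real>\<^sup>d \<times> (0,T]\<close> with \<open>F\<close> merely integrable in time.
  Test functions are \<open>\<phi>(x,t) + \<integral>\<^sub>0\<^sup>t b\<close> with \<open>\<phi>\<close> continuously differentiable and \<open>b\<close> integrable, and
  \<open>F - b\<close> is compared, near the contact point and for almost every time, with a continuous \<open>G\<close>.
  As \<open>F\<close> does not depend on \<open>(x,u)\<close>, the function \<open>G\<close> may be taken independent of \<open>(x,u)\<close> too.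
  One \<open>\<delta>\<close> serves as radius of all the neighbourhoods involved.
\<close>

definition C1_test ::
  "('a::euclidean_space \<times> real \<Rightarrow> real) \<Rightarrow> ('a \<times> real \<Rightarrow> 'a) \<Rightarrow> ('a \<times> real \<Rightarrow> real) \<Rightarrow> bool" where
  "C1_test \<phi> D\<phi> \<phi>t \<longleftrightarrow>
     continuous_on UNIV D\<phi> \<and> continuous_on UNIV \<phi>t \<and>
     (\<forall>z. (\<phi> has_derivative (\<lambda>(h, s). D\<phi> z \<bullet> h + \<phi>t z * s)) (at z))"

definition visc_sub ::
  "real \<Rightarrow> (real \<Rightarrow> 'a::euclidean_space \<Rightarrow> real) \<Rightarrow> ('a \<times> real \<Rightarrow> real) \<Rightarrow> bool" where
  "visc_sub T F u \<longleftrightarrow>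
     (\<forall>\<phi> D\<phi> \<phi>t b G x0 t0 \<delta>.
        C1_test \<phi> D\<phi> \<phi>t \<and> set_integrable lborel {0..T} b \<and> t0 \<in> {0<..T} \<and> \<delta> > 0 \<and>
        (\<forall>x\<in>ball x0 \<delta>. \<forall>t\<in>{0<..T} \<inter> ball t0 \<delta>.
           u (x, t) - \<phi> (x, t) - (LBINT s:{0..t}. b s)
             \<le> u (x0, t0) - \<phi> (x0, t0) - (LBINT s:{0..t0}. b s)) \<and>
        continuous_on (({0<..T} \<inter> ball t0 \<delta>) \<times> ball (D\<phi> (x0, t0)) \<delta>) G \<and>
        (AE t in lborel. t \<in> {0<..T} \<inter> ball t0 \<delta> \<longrightarrow>
           (\<forall>p\<in>ball (D\<phi> (x0, t0)) \<delta>. F t p - b t \<le> G (t, p)))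
        \<longrightarrow> \<phi>t (x0, t0) \<le> G (t0, D\<phi> (x0, t0)))"

definition visc_super ::
  "real \<Rightarrow> (real \<Rightarrow> 'a::euclidean_space \<Rightarrow> real) \<Rightarrow> ('a \<times> real \<Rightarrow> real) \<Rightarrow> bool" where
  "visc_super T F u \<longleftrightarrow>
     (\<forall>\<phi> D\<phi> \<phi>t b G x0 t0 \<delta>.
        C1_test \<phi> D\<phi> \<phi>t \<and> set_integrable lborel {0..T} b \<and> t0 \<in> {0<..T} \<and> \<delta> > 0 \<and>
        (\<forall>x\<in>ball x0 \<delta>. \<forall>t\<in>{0<..T} \<inter> ball t0 \<delta>.
           u (x, t) - \<phi> (x, t) - (LBINT s:{0..t}. b s)
             \<ge> u (x0, t0) - \<phi> (x0, t0) - (LBINT s:{0..t0}. b s)) \<and>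
        continuous_on (({0<..T} \<inter> ball t0 \<delta>) \<times> ball (D\<phi> (x0, t0)) \<delta>) G \<and>
        (AE t in lborel. t \<in> {0<..T} \<inter> ball t0 \<delta> \<longrightarrow>
           (\<forall>p\<in>ball (D\<phi> (x0, t0)) \<delta>. F t p - b t \<ge> G (t, p)))
        \<longrightarrow> \<phi>t (x0, t0) \<ge> G (t0, D\<phi> (x0, t0)))"

definition visc_sol ::
  "real \<Rightarrow> (real \<Rightarrow> 'a::euclidean_space \<Rightarrow> real) \<Rightarrow> ('a \<Rightarrow> real) \<Rightarrow> ('a \<times> real \<Rightarrow> real) \<Rightarrow> bool" where
  "visc_sol T F u0 u \<longleftrightarrow>
     uniformly_continuous_on (UNIV \<times> {0..T}) u \<and> (\<forall>x. u (x, 0) = u0 x) \<and>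
     visc_sub T F u \<and> visc_super T F u"

text \<open>
  The solution is unique on \<open>\<real>\<^sup>d \<times> [0,T]\<close>; the choice below only concerns the irrelevant values
  at times outside \<open>[0,T]\<close>.
\<close>

definition HJ_sol ::
  "real \<Rightarrow> ('a::euclidean_space \<Rightarrow> real) \<Rightarrow> ('a \<Rightarrow> real) \<Rightarrow> (real \<Rightarrow> real) \<Rightarrow> 'a \<times> real \<Rightarrow> real" where
  "HJ_sol T u0 H W = (SOME u. visc_sol T (\<lambda>t p. H p * weak_deriv T W t) u0 u)"

end

theory Submission
  imports Defs "HOL-Real_Asymp.Real_Asymp"
begin

text \<open>
  For the membership statement, cutting \<open>r\<^sup>\<beta>\<close> by its tangent at \<open>1 / t\<close> gives
  \<open>K(t) \<le> C t\<^sup>1\<^sup>-\<^sup>\<beta>\<close>; conversely, a difference of bounded convex functions is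
  Lipschitz near the origin, where \<open>|p|\<^sup>\<beta>\<close> is not, and this gives \<open>K(t) \<ge> c t\<^sup>1\<^sup>-\<^sup>\<beta>\<close>.

  For (a) and (b) the paths are zigzags with \<open>N\<close> teeth of heights \<open>b\<^sub>k\<close>. As \<open>|x|\<close> is convex, the
  Hopf formula solves the equation on each monotone piece of the path, and uniqueness holds piece by
  piece. Going up by \<open>b\<close> and back down by \<open>b\<close> turns \<open>max |x| h\<close> into exactly \<open>max |x| h'\<close> with
  \<open>h' = h + sup\<^sub>r (b r\<^sup>\<beta> - h r)\<close>, \<open>0 \<le> r \<le> 1\<close>. Choosing the \<open>b\<^sub>k\<close> so that \<open>h\<^sub>k = M t\<^sub>k\<^sup>1\<^sup>-\<^sup>\<beta>\<close> at the
  end \<open>t\<^sub>k\<close> of the \<open>k\<close>-th tooth keeps them below \<open>C M N\<^sup>\<beta>\<^sup>-\<^sup>1\<close>, while the norm of the path in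
  the interpolation space is at most \<open>(2 N)\<^sup>\<alpha> max b\<^sub>k\<close>. Take \<open>M = N\<^sup>1\<^sup>-\<^sup>\<beta>\<^sup>-\<^sup>\<alpha>\<close> in (a), and \<open>M = c\<^sub>0\<close>,
  \<open>\<beta> = 1 - \<alpha>\<close> in (b).
\<close>

section \<open>Interpolation between DC and continuous functions\<close>

text \<open>The Hopf formula sends an affine minorant \<open>p \<bullet> x + K\<close> to
  \<open>p \<bullet> x + K + y * H p\<close>. It asks for convex data, not for a convex
  \<open>H\<close>, and allows either sign of \<open>y\<close>. A tooth is nevertheless not the
  identity: on the way up the centre of the profile rises through minorants of an intermediate
  slope, and on the way down the constant minorant so obtained is not lowered, because
  \<open>H 0 = 0\<close>. For teeth of equal height \<open>b\<close> the recursion is approximately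
  \<open>h^(\<beta>/(1-\<beta>)) dh = const b^(1/(1-\<beta>)) dk\<close>, whose solution is
  \<open>h = \<beta>^\<beta> b k^(1-\<beta>)\<close>. This is the origin of the exponent
  \<open>1 - \<beta>\<close> and of the factor \<open>\<beta>^(-\<beta>)\<close> in the heights. The
  heights vary with \<open>k\<close> so that \<open>h\<close> meets the target curve exactly after
  every tooth; no error accumulates, and inside a tooth it is at most one height.
  \<open>HJ_sol\<close> is a choice among solutions, so an explicit formula says something about it
  only after uniqueness. Since a zigzag has constant slope on each phase, comparison is needed only
  for the autonomous equation \<open>u_t = c H(Du)\<close>.\<close>

lemma powr_le_tangent:
  fixes r s \<beta> :: real
  assumes "0 < \<beta>" "\<beta> < 1" "0 \<le> r" "0 < s"
  shows "r powr \<beta> \<le> \<beta> * s powr (\<beta> - 1) * r + (1 - \<beta>) * s powr \<beta>"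
proof (cases "r = 0")
  case False
  \<comment> \<open>Weighted arithmetic-geometric mean; multiplied by
    \<open>s powr (\<beta> - 1)\<close> it becomes the tangent inequality at
    \<open>s\<close>.\<close>
  have "r powr \<beta> * s powr (1 - \<beta>) \<le> \<beta> * r + (1 - \<beta>) * s"
    using assms False by (intro Youngs_inequality_0) auto
  then have "r powr \<beta> * s powr (1 - \<beta>) * s powr (\<beta> - 1) \<le> (\<beta> * r + (1 - \<beta>) * s) * s powr (\<beta> - 1)"
    by (intro mult_right_mono) auto
  moreover have "s powr (1 - \<beta>) * s powr (\<beta> - 1) = 1" "s * s powr (\<beta> - 1) = s powr \<beta>"
    using assms by (simp_all add: powr_add[symmetric] powr_mult_base)
  ultimately show ?thesis by (simp add: algebra_simps)
qed (use assms in auto)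

section \<open>Sup norms, DC norms and elementary bounds for the K-functional\<close>

lemma sup_norm_le: "A \<noteq> {} \<Longrightarrow> (\<And>x. x \<in> A \<Longrightarrow> \<bar>f x\<bar> \<le> c) \<Longrightarrow> sup_norm A f \<le> c"
  unfolding sup_norm_def by (rule cSUP_least)

lemma sup_norm_upper:
  assumes "bounded (f ` A)" "x \<in> A"
  shows "\<bar>f x\<bar> \<le> sup_norm A f"
  unfolding sup_norm_def
proof (rule cSUP_upper)
  obtain B where "\<And>x. x \<in> A \<Longrightarrow> \<bar>f x\<bar> \<le> B"
    using assms(1) unfolding bounded_iff by auto
  then show "bdd_above ((\<lambda>x. \<bar>f x\<bar>) ` A)" by (auto intro!: bdd_aboveI)
qed fact

lemma sup_norm_nonneg: "bounded (f ` A) \<Longrightarrow> A \<noteq> {} \<Longrightarrow> 0 \<le> sup_norm A f"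
  using sup_norm_upper[of f A] abs_ge_zero order_trans by (metis ex_in_conv)

lemma DC_norm_le:
  assumes "DC_decomp L f f1 f2" "L > 0"
  shows "snd (DC_space L) f \<le> sup_norm (ball 0 L) f1 + sup_norm (ball 0 L) f2"
proof -
  have "bdd_below {sup_norm (ball 0 L) f1 + sup_norm (ball 0 L) f2 | f1 f2. DC_decomp L f f1 f2}"
    using assms(2) by (intro bdd_belowI[of _ 0]) (auto simp: DC_decomp_def intro!: add_nonneg_nonneg sup_norm_nonneg)
  then show ?thesis
    unfolding DC_space_def snd_conv using assms(1) by (intro cInf_lower) auto
qed

lemma DC_norm_ge:
  assumes "f \<in> fst (DC_space L)"
    and "\<And>f1 f2. DC_decomp L f f1 f2 \<Longrightarrow> c \<le> sup_norm (ball 0 L) f1 + sup_norm (ball 0 L) f2"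
  shows "c \<le> snd (DC_space L) f"
  using assms unfolding DC_space_def snd_conv fst_conv by (intro cInf_greatest) auto

lemma DC_norm_nonneg: "f \<in> fst (DC_space L) \<Longrightarrow> L > 0 \<Longrightarrow> 0 \<le> snd (DC_space L) f"
  by (rule DC_norm_ge) (auto simp: DC_decomp_def intro!: add_nonneg_nonneg sup_norm_nonneg)

lemma K_functional_nonneg:
  assumes "x \<in> sum_space X0 X1" "\<And>y. y \<in> fst X0 \<Longrightarrow> 0 \<le> snd X0 y"
    "\<And>y. y \<in> fst X1 \<Longrightarrow> 0 \<le> snd X1 y" "t \<ge> 0"
  shows "0 \<le> K_functional t x X0 X1"
  unfolding K_functional_def using assms by (intro cInf_greatest) (auto simp: sum_space_def)

lemma K_functional_le:
  assumes "x0 \<in> fst X0" "x1 \<in> fst X1" "x = x0 + x1" "\<And>y. y \<in> fst X0 \<Longrightarrow> 0 \<le> snd X0 y"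
    "\<And>y. y \<in> fst X1 \<Longrightarrow> 0 \<le> snd X1 y" "t \<ge> 0"
  shows "K_functional t x X0 X1 \<le> snd X0 x0 + t * snd X1 x1"
  unfolding K_functional_def using assms
  by (intro cInf_lower bdd_belowI[of _ 0]) auto

lemma C_norm_nonneg: "f \<in> fst (C_space L) \<Longrightarrow> L > 0 \<Longrightarrow> 0 \<le> snd (C_space L) f"
  by (auto simp: C_space_def intro!: sup_norm_nonneg)

text \<open>The convexity inequality at a point \<open>z\<close> only needs one convex function
  below \<open>f\<close> that agrees with it at \<open>z\<close>, so \<open>f\<close> never has to
  be written as a supremum.\<close>

lemma convex_on_if_minorant:
  fixes f :: "'a::real_vector \<Rightarrow> real"
  assumes S: "convex S"
    and sup: "\<And>z. z \<in> S \<Longrightarrow> \<exists>l. convex_on S l \<and> l z = f z \<and> (\<forall>x\<in>S. l x \<le> f x)"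
  shows "convex_on S f"
proof (rule convex_onI)
  fix t :: real and x y assume t: "0 < t" "t < 1" and xy: "x \<in> S" "y \<in> S"
  have "(1 - t) *\<^sub>R x + t *\<^sub>R y \<in> S" using S xy t by (simp add: convexD_alt)
  from sup[OF this] obtain l where l: "convex_on S l" "l ((1 - t) *\<^sub>R x + t *\<^sub>R y) = f ((1 - t) *\<^sub>R x + t *\<^sub>R y)"
    "\<forall>x\<in>S. l x \<le> f x" by blast
  have "f ((1 - t) *\<^sub>R x + t *\<^sub>R y) \<le> (1 - t) * l x + t * l y"
    using convex_onD[OF l(1), of t x y] l(2) t xy by simp
  also have "\<dots> \<le> (1 - t) * f x + t * f y"
    using l(3) xy t by (intro add_mono mult_left_mono) auto
  finally show "f ((1 - t) *\<^sub>R x + t *\<^sub>R y) \<le> (1 - t) * f x + t * f y" .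
qed (rule S)

lemma convex_on_norm: "convex S \<Longrightarrow> convex_on S (norm :: 'a::real_normed_vector \<Rightarrow> real)"
  using convex_on_dist[of S "0::'a"] by (simp add: dist_norm)

section \<open>The K-functional of the power function\<close>

context
  fixes \<beta> :: real
  assumes \<beta>: "0 < \<beta>" "\<beta> < 1"
begin

text \<open>The approximant \<open>g\<close> is the lower envelope of the tangents at points at
  least \<open>\<delta>\<close>: the power itself beyond \<open>\<delta>\<close>, its tangent
  before. It is concave with slope at most \<open>m\<close>, so
  \<open>m * norm x - g (norm x)\<close> is convex, and both convex parts are bounded by
  \<open>m * L + \<delta> powr \<beta>\<close>.\<close>

lemma K_power_upper:
  fixes L t :: real
  assumes "L > 0" "t \<ge> 1"
  shows "K_functional t (restrict_ball L (H_power \<beta> :: 'a::euclidean_space \<Rightarrow> real)) (DC_space L) (C_space L)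
    \<le> (2 * L + 2) * t powr (1 - \<beta>)"
proof -
  \<comment> \<open>Balance: the DC norm costs \<open>\<delta> powr (\<beta> - 1)\<close>, the
    remainder \<open>t * \<delta> powr \<beta>\<close>, and these agree for
    \<open>\<delta> = 1 / t\<close>.\<close>
  define \<delta> where "\<delta> = 1 / t"
  have \<delta>: "\<delta> > 0" using assms by (simp add: \<delta>_def)
  define tan where "tan s r = \<beta> * s powr (\<beta> - 1) * r + (1 - \<beta>) * s powr \<beta>" for s r :: real
  have tan_ge: "r powr \<beta> \<le> tan s r" if "r \<ge> 0" "s > 0" for r s
    unfolding tan_def using powr_le_tangent \<beta> that by blast
  have tan_self: "tan r r = r powr \<beta>" if "r > 0" for r
    using that by (simp add: tan_def powr_diff field_simps)
  define g where "g r = tan (max r \<delta>) r" for r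
  have g_le: "g r \<le> tan s r" if "r \<ge> 0" "s \<ge> \<delta>" for r s
  proof (cases "r \<ge> \<delta>")
    case True
    then show ?thesis using tan_self[of r] tan_ge[of r s] that \<delta> by (simp add: g_def max_def)
  next
    case False
    have "\<delta> powr \<beta> \<le> tan s \<delta>" using that \<delta> by (intro tan_ge) auto
    \<comment> \<open>The difference of two tangents is affine in \<open>r\<close>, and the tangent
      at \<open>\<delta>\<close> is the steeper one, so the comparison at \<open>\<delta>\<close>
      extends to smaller \<open>r\<close>.\<close>
    moreover have "tan s r - tan \<delta> r = tan s \<delta> - tan \<delta> \<delta> + \<beta> * (\<delta> powr (\<beta> - 1) - s powr (\<beta> - 1)) * (\<delta> - r)"
      by (simp add: tan_def algebra_simps)
    moreover have "0 \<le> \<beta> * (\<delta> powr (\<beta> - 1) - s powr (\<beta> - 1)) * (\<delta> - r)"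
      using \<beta> False powr_mono2'[of "\<beta> - 1" \<delta> s] that \<delta> by (intro mult_nonneg_nonneg) auto
    ultimately show ?thesis using tan_self[OF \<delta>] False by (simp add: g_def max_def)
  qed
  have g_ge: "r powr \<beta> \<le> g r" if "r \<ge> 0" for r
    unfolding g_def using tan_ge that \<delta> by (metis less_max_iff_disj)
  have g_large: "g r = r powr \<beta>" if "r \<ge> \<delta>" for r
    using that tan_self[of r] \<delta> by (simp add: g_def max_def)
  have g_small: "g r \<le> \<delta> powr \<beta>" if "0 \<le> r" "r \<le> \<delta>" for r
  proof -
    have "g r \<le> tan \<delta> r" using that by (intro g_le) auto
    also have "\<dots> \<le> tan \<delta> \<delta>" unfolding tan_def using that \<beta> \<delta> by (intro add_mono mult_left_mono) auto
    finally show ?thesis using tan_self[OF \<delta>] by simp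
  qed
  define m where "m = \<beta> * \<delta> powr (\<beta> - 1)"
  have m0: "m \<ge> 0" using \<beta> by (simp add: m_def)
  define f1 where "f1 = (\<lambda>x::'a. m * norm x)"
  define f2 where "f2 = (\<lambda>x::'a. m * norm x - g (norm x))"
  have c1: "convex_on (ball 0 L) f1"
    unfolding f1_def using m0 convex_on_norm by (intro convex_on_cmul) auto
  have c2: "convex_on (ball 0 L) f2"
  proof (rule convex_on_if_minorant)
    fix z :: 'a assume "z \<in> ball 0 L"
    define s where "s = max (norm z) \<delta>"
    \<comment> \<open>This is \<open>m * norm x\<close> minus the tangent at \<open>s\<close>. Its
      coefficient of \<open>norm x\<close> is nonnegative because \<open>m\<close> is the slope of
      the steepest tangent used.\<close>
    define l where "l x = (m - \<beta> * s powr (\<beta> - 1)) * norm x + - ((1 - \<beta>) * s powr \<beta>)" for x :: 'a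
    have "s \<ge> \<delta>" by (simp add: s_def)
    then have "\<beta> * s powr (\<beta> - 1) \<le> m" unfolding m_def using \<beta> \<delta> by (intro mult_left_mono powr_mono2') auto
    then have "convex_on (ball (0::'a) L) (\<lambda>x. (m - \<beta> * s powr (\<beta> - 1)) * norm x)"
      by (intro convex_on_cmul convex_on_norm) auto
    moreover have "convex_on (ball (0::'a) L) (\<lambda>_. - ((1 - \<beta>) * s powr \<beta>))" by (simp only: convex_on_const convex_ball)
    ultimately have "convex_on (ball 0 L) l" unfolding l_def by (rule convex_on_add)
    moreover have l_eq: "l x = m * norm x - tan s (norm x)" for x by (simp add: l_def tan_def algebra_simps)
    ultimately show "\<exists>l. convex_on (ball 0 L) l \<and> l z = f2 z \<and> (\<forall>x\<in>ball 0 L. l x \<le> f2 x)"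
      using \<open>s \<ge> \<delta>\<close> by (intro exI[of _ l]) (auto simp: f2_def g_def s_def intro: g_le[unfolded g_def])
  qed simp
  have b1: "\<bar>f1 x\<bar> \<le> m * L" if "x \<in> ball 0 L" for x
    using that m0 by (auto simp: f1_def intro!: mult_left_mono)
  have b2: "\<bar>f2 x\<bar> \<le> m * L + \<delta> powr \<beta>" if "x \<in> ball 0 L" for x
  proof -
    have "g (norm x) \<le> tan \<delta> (norm x)" by (intro g_le) auto
    also have "\<dots> \<le> m * norm x + \<delta> powr \<beta>" using \<beta> by (simp add: tan_def m_def mult_left_le_one_le)
    finally have "- (\<delta> powr \<beta>) \<le> f2 x" by (simp add: f2_def)
    moreover have "0 \<le> g (norm x)" using g_ge[of "norm x"] by (meson norm_ge_zero order_trans powr_ge_zero)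
    moreover have "m * norm x \<le> m * L" using that m0 by (intro mult_left_mono) auto
    moreover have "0 \<le> m * L" using m0 assms(1) by simp
    moreover have "0 \<le> \<delta> powr \<beta>" by simp
    ultimately show ?thesis unfolding f2_def by linarith
  qed
  define F where "F = restrict_ball L (\<lambda>x::'a. g (norm x))"
  define E where "E = restrict_ball L (\<lambda>x::'a. norm x powr \<beta> - g (norm x))"
  have bE: "\<bar>E x\<bar> \<le> \<delta> powr \<beta>" for x
  proof (cases "norm x \<le> \<delta>")
    case True
    have "0 \<le> norm x powr \<beta>" by simp
    then have "\<bar>norm x powr \<beta> - g (norm x)\<bar> \<le> \<delta> powr \<beta>"
      using g_ge[of "norm x"] g_small[of "norm x"] True norm_ge_zero[of x] by linarith
    then show ?thesis by (simp add: E_def restrict_ball_def)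
  qed (use g_large[of "norm x"] in \<open>auto simp: E_def restrict_ball_def\<close>)
  have ne: "ball (0::'a) L \<noteq> {}" using assms by auto
  have dc: "DC_decomp L F f1 f2"
    unfolding DC_decomp_def bounded_iff
    using c1 c2 b1 b2 by (fastforce simp: F_def restrict_ball_def f1_def f2_def)
  have Fin: "F \<in> fst (DC_space L)"
    using dc by (auto simp: DC_space_def F_def restrict_ball_def)
  have "continuous_on UNIV g"
  proof -
    have "continuous_on UNIV (\<lambda>r. tan (max r \<delta>) r)" unfolding tan_def using \<delta>
      by (auto intro!: continuous_intros)
    then show ?thesis by (simp add: g_def[abs_def])
  qed
  then have "continuous_on (ball 0 L) (\<lambda>x::'a. norm x powr \<beta> - g (norm x))"
    using \<beta> by (intro continuous_on_diff continuous_on_powr' continuous_on_norm continuous_on_id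
        continuous_on_const continuous_on_compose2[of UNIV g "ball 0 L" norm]) auto
  then have "continuous_on (ball 0 L) E"
    by (rule continuous_on_eq) (auto simp: E_def restrict_ball_def)
  moreover have "bounded (E ` ball 0 L)" unfolding bounded_iff using bE by auto
  ultimately have Ein: "E \<in> fst (C_space L)"
    unfolding C_space_def by (auto simp: E_def restrict_ball_def)
  have "K_functional t (restrict_ball L (H_power \<beta> :: 'a \<Rightarrow> real)) (DC_space L) (C_space L)
      \<le> snd (DC_space L) F + t * snd (C_space L) E"
  proof (rule K_functional_le[OF Fin Ein])
    show "restrict_ball L (H_power \<beta> :: 'a \<Rightarrow> real) = F + E"
      by (auto simp: F_def E_def restrict_ball_def H_power_def)
  qed (use assms in \<open>auto intro: DC_norm_nonneg C_norm_nonneg\<close>)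
  also have "\<dots> \<le> (m * L + (m * L + \<delta> powr \<beta>)) + t * \<delta> powr \<beta>"
  proof (intro add_mono mult_left_mono)
    have "sup_norm (ball 0 L) f1 \<le> m * L" "sup_norm (ball 0 L) f2 \<le> m * L + \<delta> powr \<beta>"
      using b1 b2 ne by (auto intro!: sup_norm_le simp del: mem_ball_0)
    then show "snd (DC_space L) F \<le> m * L + (m * L + \<delta> powr \<beta>)"
      using DC_norm_le[OF dc assms(1)] by linarith
    show "snd (C_space L) E \<le> \<delta> powr \<beta>"
      using bE ne by (auto simp: C_space_def intro!: sup_norm_le)
  qed (use assms in auto)
  also have "\<dots> \<le> (2 * L + 2) * t powr (1 - \<beta>)"
  proof -
    have "m \<le> t powr (1 - \<beta>)" using \<beta> assms
      by (simp add: m_def \<delta>_def powr_divide powr_minus_divide[symmetric] mult_left_le_one_le)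
    then have "m * L \<le> L * t powr (1 - \<beta>)" using assms by (simp add: mult.commute)
    moreover have "t * \<delta> powr \<beta> = t powr (1 - \<beta>)" using assms
      by (simp add: \<delta>_def powr_divide powr_diff)
    moreover have "\<delta> powr \<beta> \<le> t * \<delta> powr \<beta>" using assms by (simp add: mult_le_cancel_right1)
    ultimately show ?thesis by (simp add: algebra_simps)
  qed
  finally show ?thesis .
qed

text \<open>Convexity along one line: for the upper bound \<open>\<delta> e\<close> is a combination
  of \<open>0\<close> and \<open>e/2\<close>, for the lower bound \<open>0\<close> is a combination
  of \<open>\<delta> e\<close> and \<open>-e/2\<close>.\<close>

lemma convex_small_increment:
  fixes f :: "'a::euclidean_space \<Rightarrow> real"
  assumes f: "convex_on (ball 0 1) f" "\<And>x. x \<in> ball 0 1 \<Longrightarrow> \<bar>f x\<bar> \<le> M"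
    and e: "norm e = 1" and d: "0 < \<delta>" "\<delta> < 1 / 2"
  shows "\<bar>f (\<delta> *\<^sub>R e) - f 0\<bar> \<le> 4 * \<delta> * M"
proof -
  have in': "c *\<^sub>R e \<in> ball 0 1" if "\<bar>c\<bar> < 1" for c using that e by simp
  have M: "\<bar>f (c *\<^sub>R e)\<bar> \<le> M" if "\<bar>c\<bar> < 1" for c using f(2) in'[OF that] by simp
  have "M \<ge> 0" using M[of 0] by simp
  have "f ((1 - 2 * \<delta>) *\<^sub>R (0 *\<^sub>R e) + (2 * \<delta>) *\<^sub>R ((1/2) *\<^sub>R e)) \<le> (1 - 2 * \<delta>) * f (0 *\<^sub>R e) + (2 * \<delta>) * f ((1/2) *\<^sub>R e)"
    using d by (intro convex_onD[OF f(1)] in') auto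
  then have "f (\<delta> *\<^sub>R e) - f 0 \<le> 2 * \<delta> * (f ((1/2) *\<^sub>R e) - f 0)" by (simp add: algebra_simps)
  also have "\<dots> \<le> 2 * \<delta> * (2 * M)" using M[of "1/2"] M[of 0] d by (intro mult_left_mono) auto
  finally have 1: "f (\<delta> *\<^sub>R e) - f 0 \<le> 4 * \<delta> * M" by simp
  \<comment> \<open>The weight with \<open>(1 - \<theta>) * \<delta> = \<theta> / 2\<close>, for
    which the combination of \<open>\<delta> e\<close> and \<open>-e/2\<close> is
    \<open>0\<close>.\<close>
  define \<theta> where "\<theta> = \<delta> / (\<delta> + 1/2)"
  have \<theta>: "0 \<le> \<theta>" "\<theta> \<le> 1" "\<theta> \<le> 2 * \<delta>" using d by (auto simp: \<theta>_def field_simps)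
  have "(1 - \<theta>) * \<delta> = \<theta> / 2" using d by (simp add: \<theta>_def field_simps)
  then have "(1 - \<theta>) *\<^sub>R (\<delta> *\<^sub>R e) + \<theta> *\<^sub>R ((-1/2) *\<^sub>R e) = 0" by (simp add: scaleR_add_left[symmetric])
  moreover have "f ((1 - \<theta>) *\<^sub>R (\<delta> *\<^sub>R e) + \<theta> *\<^sub>R ((-1/2) *\<^sub>R e)) \<le> (1 - \<theta>) * f (\<delta> *\<^sub>R e) + \<theta> * f ((-1/2) *\<^sub>R e)"
    using d \<theta> by (intro convex_onD[OF f(1)] in') auto
  ultimately have "f 0 \<le> (1 - \<theta>) * f (\<delta> *\<^sub>R e) + \<theta> * f ((-1/2) *\<^sub>R e)" by metis
  then have "f 0 - f (\<delta> *\<^sub>R e) \<le> \<theta> * (f ((-1/2) *\<^sub>R e) - f (\<delta> *\<^sub>R e))"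
    unfolding left_diff_distrib right_diff_distrib by linarith
  also have "\<dots> \<le> \<theta> * (2 * M)" using M[of "-1/2"] M[of \<delta>] d \<theta> by (intro mult_left_mono) auto
  also have "\<dots> \<le> 2 * \<delta> * (2 * M)" using \<theta> \<open>M \<ge> 0\<close> by (intro mult_right_mono) auto
  finally show ?thesis using 1 by simp
qed

text \<open>A decomposition is tested at the two points \<open>0\<close> and
  \<open>\<delta> e\<close> only: the power increases by \<open>\<delta> powr \<beta>\<close>, the
  DC part changes by at most \<open>4 * \<delta> * M\<close>, the continuous part by at most twice
  its sup norm.\<close>

lemma K_power_lower:
  fixes t :: real
  assumes t: "t \<ge> 1" and mem: "restrict_ball 1 (H_power \<beta> :: 'a::euclidean_space \<Rightarrow> real) \<in> sum_space (DC_space 1) (C_space 1)"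
  shows "t powr (1 - \<beta>) / 16
    \<le> K_functional t (restrict_ball 1 (H_power \<beta> :: 'a \<Rightarrow> real)) (DC_space 1) (C_space 1)"
  unfolding K_functional_def
proof (rule cInf_greatest)
  fix z assume "z \<in> {snd (DC_space 1) x0 + t * snd (C_space 1) x1 |x0 x1. x0 \<in> fst (DC_space 1) \<and> x1 \<in> fst (C_space 1)
    \<and> restrict_ball 1 (H_power \<beta> :: 'a \<Rightarrow> real) = x0 + x1}"
  then obtain F E where FE: "F \<in> fst (DC_space 1)" "E \<in> fst (C_space 1)"
    "restrict_ball 1 (H_power \<beta> :: 'a \<Rightarrow> real) = F + E" "z = snd (DC_space 1) F + t * snd (C_space 1) E" by blast
  obtain e :: 'a where e: "norm e = 1" by (metis norm_Basis nonempty_Basis ex_in_conv)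
  \<comment> \<open>Chosen so that \<open>t * (4 * \<delta> * M) = M\<close>.\<close>
  define \<delta> where "\<delta> = 1 / (4 * t)"
  have d: "0 < \<delta>" "\<delta> < 1/2" using t by (auto simp: \<delta>_def field_simps)
  have "t powr (1 - \<beta>) / 16 - t * snd (C_space 1) E \<le> snd (DC_space 1) F"
  proof (rule DC_norm_ge[OF FE(1)])
    fix f1 f2 assume dec: "DC_decomp 1 F f1 f2"
    define M where "M = sup_norm (ball 0 1) f1 + sup_norm (ball 0 1) f2"
    have ineq: "\<bar>f1 (\<delta> *\<^sub>R e) - f1 0\<bar> \<le> 4 * \<delta> * sup_norm (ball 0 1) f1"
      "\<bar>f2 (\<delta> *\<^sub>R e) - f2 0\<bar> \<le> 4 * \<delta> * sup_norm (ball 0 1) f2"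
      using dec d e unfolding DC_decomp_def by (auto intro!: convex_small_increment sup_norm_upper simp del: mem_ball_0)
    have b: "\<delta> *\<^sub>R e \<in> ball 0 1" "(0::'a) \<in> ball 0 1" using d e by auto
    have "\<bar>F (\<delta> *\<^sub>R e) - F 0\<bar> \<le> 4 * \<delta> * M"
    proof -
      have "F (\<delta> *\<^sub>R e) = f1 (\<delta> *\<^sub>R e) - f2 (\<delta> *\<^sub>R e)" "F 0 = f1 0 - f2 0"
        using dec b unfolding DC_decomp_def by blast+
      then show ?thesis using ineq unfolding M_def by (simp only: distrib_left)
    qed
    moreover have "\<bar>E x\<bar> \<le> snd (C_space 1) E" if "x \<in> ball 0 1" for x
    proof -
      have "bounded (E ` ball 0 1)" using FE(2) by (simp only: C_space_def fst_conv mem_Collect_eq)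
      from sup_norm_upper[OF this that] show ?thesis by (simp only: C_space_def snd_conv)
    qed
    from this[OF b(1)] this[OF b(2)]
    have "\<bar>E (\<delta> *\<^sub>R e) - E 0\<bar> \<le> 2 * snd (C_space 1) E" by linarith
    moreover have "\<delta> powr \<beta> = (F (\<delta> *\<^sub>R e) - F 0) + (E (\<delta> *\<^sub>R e) - E 0)"
      using fun_cong[OF FE(3), of "\<delta> *\<^sub>R e"] fun_cong[OF FE(3), of 0] b e d
      by (simp add: restrict_ball_def H_power_def)
    ultimately have "\<delta> powr \<beta> \<le> 4 * \<delta> * M + 2 * snd (C_space 1) E" by linarith
    then have "t * \<delta> powr \<beta> \<le> t * (4 * \<delta> * M + 2 * snd (C_space 1) E)" using t by (intro mult_left_mono) auto
    also have "\<dots> = M + 2 * (t * snd (C_space 1) E)" using t by (simp add: \<delta>_def algebra_simps)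
    finally have 1: "t * \<delta> powr \<beta> \<le> M + 2 * (t * snd (C_space 1) E)" .
    have "t powr (1 - \<beta>) / 4 \<le> t powr (1 - \<beta>) / 4 powr \<beta>"
      using \<beta> powr_mono[of \<beta> 1 "4::real"] by (intro divide_left_mono) auto
    also have "\<dots> = t * \<delta> powr \<beta>"
      using t by (simp add: \<delta>_def powr_divide powr_mult powr_diff)
    finally have 2: "t powr (1 - \<beta>) / 4 \<le> t * \<delta> powr \<beta>" .
    \<comment> \<open>Since \<open>M \<ge> 0\<close>, counting the norm of \<open>E\<close> once
      instead of twice loses at most a factor \<open>2\<close>; the constant \<open>1/16\<close>
      leaves room for it.\<close>
    have "M \<ge> 0" using dec by (auto simp: M_def DC_decomp_def intro!: add_nonneg_nonneg sup_norm_nonneg)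
    then show "t powr (1 - \<beta>) / 16 - t * snd (C_space 1) E \<le> sup_norm (ball 0 1) f1 + sup_norm (ball 0 1) f2"
      using 1 2 powr_ge_zero[of t "1 - \<beta>"] unfolding M_def[symmetric] by linarith
  qed
  then show "t powr (1 - \<beta>) / 16 \<le> z" using FE(4) by simp
qed (use mem in \<open>auto simp: sum_space_def\<close>)

text \<open>The decomposition \<open>0 + E\<close>. It shows membership in the sum space, and its
  bound, linear in \<open>t\<close>, makes the interpolation integral converge at \<open>0\<close>
  when \<open>\<alpha> < 1\<close>.\<close>

lemma K_power_upper_small:
  fixes L t :: real
  assumes "L > 0" "t > 0"
  shows "restrict_ball L (H_power \<beta> :: 'a::euclidean_space \<Rightarrow> real) \<in> sum_space (DC_space L) (C_space L)" (is ?A)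
    and "K_functional t (restrict_ball L (H_power \<beta> :: 'a \<Rightarrow> real)) (DC_space L) (C_space L) \<le> t * L powr \<beta>" (is ?B)
proof -
  define E where "E = restrict_ball L (H_power \<beta> :: 'a \<Rightarrow> real)"
  have ne: "ball (0::'a) L \<noteq> {}" using assms by auto
  have dc: "DC_decomp L (0 :: 'a \<Rightarrow> real) (\<lambda>_. 0) (\<lambda>_. 0)"
    by (auto simp: DC_decomp_def bounded_iff convex_on_const)
  then have Fin: "(0 :: 'a \<Rightarrow> real) \<in> fst (DC_space L)" by (auto simp: DC_space_def)
  have bE: "\<bar>E x\<bar> \<le> L powr \<beta>" for x
    using \<beta> by (auto simp: E_def restrict_ball_def H_power_def intro!: powr_mono2)
  have "continuous_on (ball 0 L) (\<lambda>x::'a. norm x powr \<beta>)"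
    using \<beta> by (intro continuous_on_powr' continuous_on_norm continuous_on_id continuous_on_const) auto
  then have "continuous_on (ball 0 L) E"
    by (rule continuous_on_eq) (auto simp: E_def restrict_ball_def H_power_def)
  moreover have "bounded (E ` ball 0 L)" unfolding bounded_iff using bE by auto
  ultimately have Ein: "E \<in> fst (C_space L)"
    unfolding C_space_def by (auto simp: E_def restrict_ball_def)
  show ?A unfolding sum_space_def E_def[symmetric] using Fin Ein by (intro CollectI exI[of _ 0] exI[of _ E]) auto
  have "K_functional t E (DC_space L) (C_space L) \<le> snd (DC_space L) (0 :: 'a \<Rightarrow> real) + t * snd (C_space L) E"
    using assms Fin Ein by (intro K_functional_le DC_norm_nonneg C_norm_nonneg) auto
  also have "\<dots> \<le> (0 + 0) + t * L powr \<beta>"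
    using DC_norm_le[OF dc assms(1)] sup_norm_le[OF ne, of "\<lambda>_. 0" 0] sup_norm_le[OF ne, of E "L powr \<beta>"] bE assms
    by (intro add_mono mult_left_mono) (auto simp: C_space_def)
  finally show ?B by (simp add: E_def)
qed

section \<open>Convergence and divergence of the interpolation integral\<close>

lemma nn_integral_powr_finite:
  fixes a c :: real
  assumes "c \<ge> 0"
  shows "a > -1 \<Longrightarrow> (\<integral>\<^sup>+ t. ennreal (c * t powr a) * indicator {0..1} t \<partial>lborel) < \<infinity>"
    and "a < -1 \<Longrightarrow> (\<integral>\<^sup>+ t. ennreal (c * t powr a) * indicator {1..} t \<partial>lborel) < \<infinity>"
proof -
  have gen: "(\<integral>\<^sup>+ t. ennreal (c * t powr a) * indicator A t \<partial>lborel) < \<infinity>"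
    if "((\<lambda>t. t powr a) has_integral I) A" "A \<in> sets borel" for A I
  proof -
    have "((\<lambda>t. c * t powr a) has_integral c * I) A" using that(1) by (rule has_integral_mult_right)
    then have "((\<lambda>t. if t \<in> A then c * t powr a else 0) has_integral c * I) UNIV"
      by (simp add: has_integral_restrict_UNIV)
    then have "(\<integral>\<^sup>+ t. ennreal (if t \<in> A then c * t powr a else 0) \<partial>lborel) = ennreal (c * I)"
      using assms that(2) by (intro nn_integral_has_integral_lborel) (auto intro!: measurable_If_set)
    moreover have "ennreal (if t \<in> A then c * t powr a else 0) = ennreal (c * t powr a) * indicator A t" for t
      by (auto simp: indicator_def)
    ultimately show ?thesis by simp
  qed
  show "a > -1 \<Longrightarrow> (\<integral>\<^sup>+ t. ennreal (c * t powr a) * indicator {0..1} t \<partial>lborel) < \<infinity>"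
    by (rule gen[OF has_integral_powr_from_0]) auto
  show "a < -1 \<Longrightarrow> (\<integral>\<^sup>+ t. ennreal (c * t powr a) * indicator {1..} t \<partial>lborel) < \<infinity>"
    by (rule gen[OF has_integral_powr_to_inf]) auto
qed

lemma interp_norm_1_finite_iff:
  "interp_norm X0 X1 \<alpha> 1 x < \<infinity> \<longleftrightarrow>
    (\<integral>\<^sup>+ t\<in>{0<..}. ennreal ((t powr (-\<alpha>) * K_functional t x X0 X1) powr 1 / t) \<partial>lborel) < \<infinity>"
  by (simp add: interp_norm_def Let_def less_top)

text \<open>The integrand is at most a multiple of \<open>t powr (-\<alpha>)\<close> for
  \<open>t \<le> 1\<close> and of \<open>t powr (-\<alpha>-\<beta>)\<close> for
  \<open>t \<ge> 1\<close>; convergence at the two ends is \<open>\<alpha> < 1\<close> and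
  \<open>\<alpha> + \<beta> > 1\<close>.\<close>

lemma H_power_in_Ham_space:
  assumes \<alpha>: "0 < \<alpha>" "\<alpha> < 1" "\<alpha> + \<beta> > 1"
  shows "(H_power \<beta> :: 'a::euclidean_space \<Rightarrow> real) \<in> Ham_space \<alpha>"
proof -
  have "interp_norm (DC_space L) (C_space L) \<alpha> 1 (restrict_ball L (H_power \<beta> :: 'a \<Rightarrow> real)) < \<infinity>"
    if L: "L > 0" for L
  proof -
    define K where "K t = K_functional t (restrict_ball L (H_power \<beta> :: 'a \<Rightarrow> real)) (DC_space L) (C_space L)" for t
    have K0: "0 \<le> K t" if "t > 0" for t unfolding K_def
      using that L by (intro K_functional_nonneg K_power_upper_small DC_norm_nonneg C_norm_nonneg) auto
    define c where "c = 2 * L + 2"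
    have "ennreal ((t powr (-\<alpha>) * K t) powr 1 / t) * indicator {0<..} t \<le>
      ennreal (L powr \<beta> * t powr (-\<alpha>)) * indicator {0..1} t + ennreal (c * t powr (-\<alpha>-\<beta>)) * indicator {1..} t" for t
    proof (cases "t > 0")
      case t: True
      have e: "(t powr (-\<alpha>) * K t) powr 1 = t powr (-\<alpha>) * K t" using K0[OF t] by simp
      show ?thesis
      proof (cases "t \<ge> 1")
        case True
        have "t powr (-\<alpha>) * K t / t \<le> t powr (-\<alpha>) * (c * t powr (1-\<beta>)) / t"
          using t True K_power_upper[OF L True, where ?'a='a] unfolding K_def c_def
          by (intro divide_right_mono mult_left_mono) auto
        also have "\<dots> = c * t powr (-\<alpha>-\<beta>)" using t by (simp add: powr_diff powr_minus field_simps)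
        finally show ?thesis using t True unfolding e
          by (intro add_increasing) (auto simp: indicator_def intro!: ennreal_leI)
      next
        case False
        have "t powr (-\<alpha>) * K t / t \<le> t powr (-\<alpha>) * (t * L powr \<beta>) / t"
          using t K_power_upper_small(2)[OF L t, where ?'a='a] unfolding K_def
          by (intro divide_right_mono mult_left_mono) auto
        also have "\<dots> = L powr \<beta> * t powr (-\<alpha>)" using t by simp
        finally show ?thesis using t False unfolding e
          by (auto simp: indicator_def intro!: ennreal_leI)
      qed
    qed auto
    then have "(\<integral>\<^sup>+ t. ennreal ((t powr (-\<alpha>) * K t) powr 1 / t) * indicator {0<..} t \<partial>lborel) \<le>
      (\<integral>\<^sup>+ t. ennreal (L powr \<beta> * t powr (-\<alpha>)) * indicator {0..1} t + ennreal (c * t powr (-\<alpha>-\<beta>)) * indicator {1..} t \<partial>lborel)"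
      by (rule nn_integral_mono)
    also have "\<dots> = (\<integral>\<^sup>+ t. ennreal (L powr \<beta> * t powr (-\<alpha>)) * indicator {0..1} t \<partial>lborel) +
       (\<integral>\<^sup>+ t. ennreal (c * t powr (-\<alpha>-\<beta>)) * indicator {1..} t \<partial>lborel)"
      by (intro nn_integral_add) auto
    also have "\<dots> < \<infinity>"
      using nn_integral_powr_finite(1)[of "L powr \<beta>" "-\<alpha>"] nn_integral_powr_finite(2)[of c "-\<alpha>-\<beta>"] \<alpha> \<beta> L
      by (simp add: c_def)
    finally show ?thesis unfolding interp_norm_1_finite_iff K_def .
  qed
  moreover have "continuous_on UNIV (H_power \<beta> :: 'a \<Rightarrow> real)"
    unfolding H_power_def[abs_def] using \<beta> by (intro continuous_on_powr' continuous_intros) auto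
  ultimately show ?thesis
    using K_power_upper_small(1)[where t=1] by (auto simp: Ham_space_def interp_space_def)
qed

text \<open>Radius \<open>1\<close> is enough to violate membership: the integrand is at least
  \<open>1 / (16 * t)\<close> for \<open>t \<ge> 1\<close>, so the integral diverges at least
  logarithmically, the borderline \<open>\<alpha> + \<beta> = 1\<close> included.\<close>

lemma H_power_notin_Ham_space:
  assumes \<alpha>: "\<alpha> + \<beta> \<le> 1"
  shows "(H_power \<beta> :: 'a::euclidean_space \<Rightarrow> real) \<notin> Ham_space \<alpha>"
proof
  assume "(H_power \<beta> :: 'a \<Rightarrow> real) \<in> Ham_space \<alpha>"
  then have *: "interp_norm (DC_space 1) (C_space 1) \<alpha> 1 (restrict_ball 1 (H_power \<beta> :: 'a \<Rightarrow> real)) < \<infinity>"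
    by (auto simp: Ham_space_def interp_space_def)
  define K where "K t = K_functional t (restrict_ball 1 (H_power \<beta> :: 'a \<Rightarrow> real)) (DC_space 1) (C_space 1)" for t
  define I where "I = (\<integral>\<^sup>+ t\<in>{0<..}. ennreal ((t powr (-\<alpha>) * K t) powr 1 / t) \<partial>lborel)"
  have I: "I < \<infinity>" using * unfolding interp_norm_1_finite_iff I_def K_def .
  have bound: "ennreal (ln n / 16) \<le> I" if n: "n \<ge> 1" for n
  proof -
    have "(\<integral>\<^sup>+ t. ennreal (1 / (16 * t)) * indicator {1..n} t \<partial>lborel) = ln n / 16 - ln 1 / 16"
      using n by (intro nn_integral_FTC_Icc) (auto intro!: derivative_eq_intros)
    moreover have "ennreal (1 / (16 * t)) * indicator {1..n} t \<le> ennreal ((t powr (-\<alpha>) * K t) powr 1 / t) * indicator {0<..} t" for t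
    proof (cases "t \<in> {1..n}")
      case True
      then have t: "t \<ge> 1" by simp
      have K: "t powr (1 - \<beta>) / 16 \<le> K t" unfolding K_def
        using t by (intro K_power_lower K_power_upper_small(1)[of 1 1]) auto
      then have "0 \<le> K t" using powr_ge_zero[of t "1 - \<beta>"] by linarith
      then have e: "(t powr (-\<alpha>) * K t) powr 1 = t powr (-\<alpha>) * K t" by simp
      have "1 \<le> t powr (-\<alpha> + (1 - \<beta>))" using t \<alpha> by (intro ge_one_powr_ge_zero) auto
      then have "1 / 16 \<le> t powr (-\<alpha>) * (t powr (1 - \<beta>) / 16)" by (simp only: powr_add)
      also have "\<dots> \<le> t powr (-\<alpha>) * K t" using K by (intro mult_left_mono) auto
      finally have "1 / 16 / t \<le> t powr (-\<alpha>) * K t / t" using t by (intro divide_right_mono) auto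
      then show ?thesis using True t unfolding e by (auto intro!: ennreal_leI)
    qed auto
    then have "(\<integral>\<^sup>+ t. ennreal (1 / (16 * t)) * indicator {1..n} t \<partial>lborel) \<le> I"
      unfolding I_def by (rule nn_integral_mono)
    ultimately show ?thesis by simp
  qed
  have "I = ennreal (enn2real I)" using I by simp
  \<comment> \<open>The upper limit is taken so large that \<open>ln n / 16\<close> equals the
    finite value of \<open>I\<close> plus \<open>1\<close>.\<close>
  then have "ennreal (ln (exp (16 * (enn2real I + 1))) / 16) \<le> ennreal (enn2real I)"
    using bound[of "exp (16 * (enn2real I + 1))"] enn2real_nonneg[of I] by simp
  then show False by (simp add: ennreal_le_iff)
qed

end

section \<open>Affine minorants and the Hopf formula\<close>

text \<open>These are the convex functions that are 1-Lipschitz. They are described by subgradients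
  because the Hopf formula consumes and produces affine minorants.\<close>

definition supported :: "('a::euclidean_space \<Rightarrow> real) \<Rightarrow> bool" where
  "supported f \<longleftrightarrow> (\<forall>x. \<exists>p. norm p \<le> 1 \<and> (\<forall>z. f x + p \<bullet> (z - x) \<le> f z))"

text \<open>Hopf's formula for convex data. The intercept \<open>K\<close> stands for minus the
  convex conjugate of \<open>f\<close> at \<open>p\<close>, which avoids infinite values. The
  argument \<open>y\<close> is the signed increment of the path, not the time.\<close>

definition hopf :: "('a::euclidean_space \<Rightarrow> real) \<Rightarrow> ('a \<Rightarrow> real) \<Rightarrow> real \<Rightarrow> 'a \<Rightarrow> real" where
  "hopf H f y x = Sup {p \<bullet> x + K + y * H p | p K. \<forall>z. p \<bullet> z + K \<le> f z}"

lemma supported_lipschitz: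
  assumes "supported f"
  shows "\<bar>f x - f z\<bar> \<le> norm (x - z)"
proof -
  have *: "f x - f z \<le> norm (x - z)" for x z
  proof -
    obtain p where p: "norm p \<le> 1" "f x + p \<bullet> (z - x) \<le> f z"
      using assms unfolding supported_def by blast
    have "p \<bullet> (x - z) \<le> norm p * norm (x - z)" by (rule norm_cauchy_schwarz)
    also have "\<dots> \<le> norm (x - z)" using p by (simp add: mult_left_le_one_le)
    finally show ?thesis using p(2) by (simp add: inner_diff_right)
  qed
  show ?thesis using *[of x z] *[of z x] by (simp add: norm_minus_commute)
qed

lemma minorant_slope_le_1:
  assumes "supported f" "\<And>z. p \<bullet> z + K \<le> f z"
  shows "norm p \<le> 1"
proof (rule ccontr)
  assume *: "\<not> norm p \<le> 1"
  define c where "c = norm p * (norm p - 1)"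
  have c: "c > 0" unfolding c_def using * by (intro mult_pos_pos; linarith)
  have "K \<le> f 0" using assms(2)[of 0] by simp
  \<comment> \<open>In direction \<open>p\<close> the minorant gains on the Lipschitz bound of
    \<open>f\<close> at rate \<open>c\<close>; this \<open>s\<close> lies beyond their
    crossing.\<close>
  define s where "s = (f 0 - K + 1) / c"
  have s: "s > 0" using c \<open>K \<le> f 0\<close> by (simp add: s_def)
  have "p \<bullet> (s *\<^sub>R p) + K \<le> f (s *\<^sub>R p)" by (rule assms(2))
  also have "\<dots> \<le> f 0 + s * norm p" using supported_lipschitz[OF assms(1), of "s *\<^sub>R p" 0] s by simp
  finally have "s * c \<le> f 0 - K" by (simp add: c_def power2_norm_eq_inner[symmetric] power2_eq_square algebra_simps)
  then show False using c by (simp add: s_def)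
qed

text \<open>The upper bound on \<open>H\<close> concerns the unit ball, where all slopes of
  minorants lie. Comparison meets slopes of any size, and there uniform continuity on the whole
  space absorbs a small perturbation of the slope.\<close>

locale hamiltonian =
  fixes H :: "'a::euclidean_space \<Rightarrow> real"
  assumes H_nonneg: "0 \<le> H p"
    and H_le_1: "norm p \<le> 1 \<Longrightarrow> H p \<le> 1"
    and H_uniformly_continuous: "uniformly_continuous_on UNIV H"
begin

lemma H_continuous: "continuous_on A H"
  using H_uniformly_continuous uniformly_continuous_imp_continuous continuous_on_subset by blast

lemma abs_H_le: "norm p \<le> 1 \<Longrightarrow> \<bar>y * H p\<bar> \<le> \<bar>y\<bar>"
  using H_nonneg[of p] H_le_1[of p] by (simp add: abs_mult mult_left_le)

text \<open>Compactness: slopes lie in the unit ball, every minorant has \<open>K \<le> f 0\<close>,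
  and a value of at least \<open>V\<close> forces \<open>K \<ge> V - norm x - \<bar>y\<bar>\<close>.
  The optimal pair is what the later properties are read off from.\<close>

lemma hopf_attained:
  assumes f: "supported f"
  shows "\<exists>p K. norm p \<le> 1 \<and> (\<forall>z. p \<bullet> z + K \<le> f z) \<and> hopf H f y x = p \<bullet> x + K + y * H p \<and>
    (\<forall>q k. (\<forall>z. q \<bullet> z + k \<le> f z) \<longrightarrow> q \<bullet> x + k + y * H q \<le> hopf H f y x)"
proof -
  define val where "val = (\<lambda>(p, K). p \<bullet> x + K + y * H p)"
  obtain p0 where p0: "norm p0 \<le> 1" "\<And>z. f 0 + p0 \<bullet> z \<le> f z"
    using f unfolding supported_def by (metis diff_zero)
  define V where "V = val (p0, f 0)"
  define S where "S = (cball 0 1 \<times> {V - norm x - \<bar>y\<bar>..f 0}) \<inter> (\<Inter>z. {(p, K). p \<bullet> z + K \<le> f z})"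
  have inS: "(q, k) \<in> S" if q: "\<And>z. q \<bullet> z + k \<le> f z" "V \<le> val (q, k)" for q k
  proof -
    have n: "norm q \<le> 1" using minorant_slope_le_1[OF f q(1)] .
    have "q \<bullet> x \<le> norm x" using norm_cauchy_schwarz[of q x] n
      by (metis mult_left_le_one_le norm_ge_zero order_trans)
    moreover have "y * H q \<le> \<bar>y\<bar>" using abs_H_le[OF n, of y] by linarith
    moreover have "k \<le> f 0" using q(1)[of 0] by simp
    ultimately show ?thesis using n q by (auto simp: S_def val_def)
  qed
  have "closed {(p, K). p \<bullet> z + K \<le> f z}" for z :: 'a
    unfolding case_prod_unfold by (intro closed_Collect_le continuous_intros)
  then have "compact S" unfolding S_def by (intro compact_Int_closed compact_Times closed_INT) auto
  moreover have S0: "(p0, f 0) \<in> S" using p0 by (intro inS) (auto simp: V_def add.commute)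
  moreover have "continuous_on S val" unfolding val_def case_prod_beta
    by (intro continuous_intros continuous_on_compose2[OF H_continuous[of UNIV]]) auto
  ultimately obtain m where m: "m \<in> S" "\<And>s. s \<in> S \<Longrightarrow> val s \<le> val m"
    using continuous_attains_sup[of S val] by blast
  obtain p K where pK: "m = (p, K)" by (cases m)
  have max: "val (q, k) \<le> val (p, K)" if "\<And>z. q \<bullet> z + k \<le> f z" for q k
    using inS[OF that] m S0 unfolding pK V_def by (metis linorder_le_cases order_trans)
  have mem: "\<forall>z. p \<bullet> z + K \<le> f z" "norm p \<le> 1" using m(1) by (auto simp: S_def pK)
  have "hopf H f y x = p \<bullet> x + K + y * H p"
    unfolding hopf_def using mem max by (intro cSup_eq_maximum) (auto simp: val_def)
  then show ?thesis using mem max by (intro exI[of _ p] exI[of _ K]) (auto simp: val_def)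
qed

lemma hopf_upper:
  assumes "supported f" "\<And>z. q \<bullet> z + k \<le> f z"
  shows "q \<bullet> x + k + y * H q \<le> hopf H f y x"
  using hopf_attained[OF assms(1), of y x] assms(2) by blast

text \<open>The optimal pair satisfies \<open>K \<le> f z - p \<bullet> z\<close> for every
  \<open>z\<close>. Upper bounds for the Hopf formula thus follow from one well chosen
  \<open>z\<close>, with no conjugate to compute.\<close>

lemma hopf_le:
  assumes "supported f"
  obtains p where "norm p \<le> 1" "\<And>z. hopf H f y x \<le> f z + p \<bullet> (x - z) + y * H p"
proof -
  obtain p K where "norm p \<le> 1" "\<And>z. p \<bullet> z + K \<le> f z" "hopf H f y x = p \<bullet> x + K + y * H p"
    using hopf_attained[OF assms, of y x] by blast
  then show ?thesis by (intro that[of p]) (auto simp: inner_diff_right algebra_simps)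
qed

text \<open>The formula is a supremum of functions affine in \<open>(x, y)\<close>, and the optimal
  one touches it from below. Its gradient \<open>(p, H p)\<close> satisfies the equation.\<close>

lemma hopf_support:
  assumes "supported f"
  obtains p where "norm p \<le> 1"
    "\<And>z y'. hopf H f y x + p \<bullet> (z - x) + (y' - y) * H p \<le> hopf H f y' z"
proof -
  obtain p K where p: "norm p \<le> 1" "\<And>z. p \<bullet> z + K \<le> f z" "hopf H f y x = p \<bullet> x + K + y * H p"
    using hopf_attained[OF assms, of y x] by blast
  show ?thesis
    using hopf_upper[OF assms p(2)] p by (intro that[of p]) (auto simp: inner_diff_right algebra_simps)
qed

lemma hopf_supported: "supported f \<Longrightarrow> supported (hopf H f y)"
  unfolding supported_def[of "hopf H f y"]
proof
  fix x assume f: "supported f"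
  obtain p where "norm p \<le> 1" "\<And>z y'. hopf H f y x + p \<bullet> (z - x) + (y' - y) * H p \<le> hopf H f y' z"
    using hopf_support[OF f] by blast
  from this(1) this(2)[of _ y]
  show "\<exists>p. norm p \<le> 1 \<and> (\<forall>z. hopf H f y x + p \<bullet> (z - x) \<le> hopf H f y z)" by auto
qed

lemma hopf_0: assumes f: "supported f" shows "hopf H f 0 x = f x"
proof (rule antisym)
  show "hopf H f 0 x \<le> f x"
    using hopf_le[OF f, of 0 x] by (metis add.right_neutral cancel_comm_monoid_add_class.diff_cancel inner_zero_right mult_zero_left)
  obtain p where p: "norm p \<le> 1" "\<And>z. f x + p \<bullet> (z - x) \<le> f z"
    using f unfolding supported_def by blast
  then show "f x \<le> hopf H f 0 x"
    using hopf_upper[OF f, of p "f x - p \<bullet> x" x 0] by (simp add: inner_diff_right algebra_simps)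
qed

lemma hopf_lipschitz_time:
  assumes f: "supported f"
  shows "\<bar>hopf H f y x - hopf H f y' x\<bar> \<le> \<bar>y - y'\<bar>"
proof -
  have *: "hopf H f y x - hopf H f y' x \<le> \<bar>y - y'\<bar>" for y y'
  proof -
    obtain p where "norm p \<le> 1" "hopf H f y x + p \<bullet> (x - x) + (y' - y) * H p \<le> hopf H f y' x"
      using hopf_support[OF f] by blast
    then show ?thesis using abs_H_le[of p "y' - y"] by (simp add: abs_minus_commute)
  qed
  show ?thesis using *[of y y'] *[of y' y] by linarith
qed

text \<open>Joint convexity extends a lower test function from a neighbourhood of the contact point back to
  the initial time, which is how the supersolution property is obtained below.\<close>

lemma hopf_convex:
  assumes f: "supported f" and \<mu>: "0 \<le> \<mu>" "\<mu> \<le> 1"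
  shows "hopf H f ((1 - \<mu>) * y + \<mu> * y') ((1 - \<mu>) *\<^sub>R x + \<mu> *\<^sub>R x')
    \<le> (1 - \<mu>) * hopf H f y x + \<mu> * hopf H f y' x'"
proof -
  define X where "X = (1 - \<mu>) *\<^sub>R x + \<mu> *\<^sub>R x'"
  define Y where "Y = (1 - \<mu>) * y + \<mu> * y'"
  obtain p where p: "\<And>z y'. hopf H f Y X + p \<bullet> (z - X) + (y' - Y) * H p \<le> hopf H f y' z"
    using hopf_support[OF f] by blast
  have "(1 - \<mu>) * (hopf H f Y X + p \<bullet> (x - X) + (y - Y) * H p) + \<mu> * (hopf H f Y X + p \<bullet> (x' - X) + (y' - Y) * H p)
     \<le> (1 - \<mu>) * hopf H f y x + \<mu> * hopf H f y' x'"
    using p \<mu> by (intro add_mono mult_left_mono) auto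
  moreover have "(1 - \<mu>) * (hopf H f Y X + p \<bullet> (x - X) + (y - Y) * H p) + \<mu> * (hopf H f Y X + p \<bullet> (x' - X) + (y' - Y) * H p)
    = hopf H f Y X + p \<bullet> ((1 - \<mu>) *\<^sub>R (x - X) + \<mu> *\<^sub>R (x' - X)) + ((1 - \<mu>) * (y - Y) + \<mu> * (y' - Y)) * H p"
    by (simp add: inner_add_right algebra_simps)
  moreover have "(1 - \<mu>) *\<^sub>R (x - X) + \<mu> *\<^sub>R (x' - X) = 0" by (simp add: X_def algebra_simps)
  moreover have "(1 - \<mu>) * (y - Y) + \<mu> * (y' - Y) = 0" by (simp add: Y_def algebra_simps)
  ultimately show ?thesis unfolding X_def[symmetric] Y_def[symmetric] by simp
qed

end

text \<open>Expansion along a single ray with \<open>\<mu>\<close> tending to \<open>0\<close> from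
  the right: contact is exploited on segments that go back in time (\<open>k < 0\<close>) or stay at
  one time (\<open>k = 0\<close>).\<close>

lemma C1_test_directional:
  assumes "C1_test \<phi> D\<phi> \<phi>t" "\<eta> > 0"
  shows "eventually (\<lambda>\<mu>. \<bar>\<phi> (x0 + \<mu> *\<^sub>R h, t0 + \<mu> * k) - \<phi> (x0, t0) - \<mu> * (D\<phi> (x0, t0) \<bullet> h + \<phi>t (x0, t0) * k)\<bar> \<le> \<eta> * \<mu>)
    (at_right 0)"
proof -
  define F where "F \<mu> = \<phi> (x0 + \<mu> *\<^sub>R h, t0 + \<mu> * k)" for \<mu>
  define D where "D = D\<phi> (x0, t0) \<bullet> h + \<phi>t (x0, t0) * k"
  have "(\<phi> has_derivative (\<lambda>(h, s). D\<phi> (x0, t0) \<bullet> h + \<phi>t (x0, t0) * s)) (at (x0 + 0 *\<^sub>R h, t0 + 0 * k))"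
    using assms(1) by (simp add: C1_test_def)
  moreover have "((\<lambda>\<mu>. (x0 + \<mu> *\<^sub>R h, t0 + \<mu> * k)) has_derivative (\<lambda>\<mu>. (\<mu> *\<^sub>R h, \<mu> * k))) (at 0)"
    by (auto intro!: derivative_eq_intros)
  ultimately have "(F has_derivative (\<lambda>\<mu>. D\<phi> (x0, t0) \<bullet> (\<mu> *\<^sub>R h) + \<phi>t (x0, t0) * (\<mu> * k))) (at 0)"
    unfolding F_def by (auto dest: has_derivative_compose)
  moreover have "(\<lambda>\<mu>. D\<phi> (x0, t0) \<bullet> (\<mu> *\<^sub>R h) + \<phi>t (x0, t0) * (\<mu> * k)) = (*) D"
    by (auto simp: D_def algebra_simps)
  ultimately have "(F has_field_derivative D) (at 0)" by (simp add: has_field_derivative_def)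
  then have "((\<lambda>\<mu>. (F (0 + \<mu>) - F 0) / \<mu>) \<longlongrightarrow> D) (at 0)" by (simp only: DERIV_def)
  then have "((\<lambda>\<mu>. (F \<mu> - F 0) / \<mu>) \<longlongrightarrow> D) (at_right 0)" by (simp add: filterlim_at_split)
  from tendstoD[OF this assms(2)] have ev: "\<forall>\<^sub>F \<mu> in at_right 0. dist ((F \<mu> - F 0) / \<mu>) D < \<eta>" .
  have "\<forall>\<^sub>F \<mu> in at_right 0. \<mu> > (0::real)" by (simp add: eventually_at_right_less)
  with ev show ?thesis
  proof eventually_elim
    case (elim \<mu>)
    have "\<bar>F \<mu> - F 0 - \<mu> * D\<bar> = \<bar>(F \<mu> - F 0) / \<mu> - D\<bar> * \<mu>"
    proof -
      have "F \<mu> - F 0 - \<mu> * D = ((F \<mu> - F 0) / \<mu> - D) * \<mu>" using elim by (simp add: field_simps)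
      then show ?thesis using elim by (simp add: abs_mult)
    qed
    also have "\<dots> \<le> \<eta> * \<mu>" using elim by (intro mult_right_mono) (auto simp: dist_real_def)
    finally show ?case by (simp add: F_def D_def)
  qed
qed

text \<open>The bound is asked for almost everywhere on the open interval, which is the form in
  which the viscosity definition supplies bounds on \<open>b\<close> within a phase.\<close>

lemma set_integral_increment_le:
  fixes b :: "real \<Rightarrow> real"
  assumes b: "set_integrable lborel {0..T} b" and st: "0 \<le> s" "s \<le> t" "t \<le> T"
    and le: "AE r in lborel. r \<in> {s<..<t} \<longrightarrow> b r \<le> C"
  shows "(LBINT r:{0..t}. b r) - (LBINT r:{0..s}. b r) \<le> C * (t - s)"
proof -
  have int: "set_integrable lborel A b" if "A \<subseteq> {0..T}" "A \<in> sets borel" for A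
    using set_integrable_subset[OF b] that by auto
  have "(LBINT r:{0..t}. b r) = (LBINT r:{0..s} \<union> {s<..t}. b r)"
    using st by (intro arg_cong[where f="\<lambda>A. LBINT r:A. b r"]) auto
  also have "\<dots> = (LBINT r:{0..s}. b r) + (LBINT r:{s<..t}. b r)"
    using st by (intro set_integral_Un int) auto
  finally have "(LBINT r:{0..t}. b r) - (LBINT r:{0..s}. b r) = (LBINT r:{s<..t}. b r)" by simp
  also have "\<dots> \<le> (LBINT r:{s<..t}. C)"
  proof (rule set_integral_mono_AE)
    show "set_integrable lborel {s<..t} b" using st by (intro int) auto
    show "set_integrable lborel {s<..t} (\<lambda>_. C)"
      unfolding set_integrable_def real_scaleR_def using st
      by (intro integrable_mult_left integrable_real_indicator) auto
    have "AE r in lborel. r \<noteq> t" by (rule AE_lborel_singleton)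
    with le show "AE r\<in>{s<..t} in lborel. b r \<le> C" by eventually_elim auto
  qed
  also have "\<dots> = C * (t - s)" using st by (simp add: set_lebesgue_integral_def)
  finally show ?thesis .
qed

lemma set_integral_increment_ge:
  fixes b :: "real \<Rightarrow> real"
  assumes b: "set_integrable lborel {0..T} b" and st: "0 \<le> s" "s \<le> t" "t \<le> T"
    and le: "AE r in lborel. r \<in> {s<..<t} \<longrightarrow> C \<le> b r"
  shows "C * (t - s) \<le> (LBINT r:{0..t}. b r) - (LBINT r:{0..s}. b r)"
proof -
  have "(LBINT r:{0..t}. - b r) - (LBINT r:{0..s}. - b r) \<le> - C * (t - s)"
    using assms by (intro set_integral_increment_le[where T=T]) (auto simp: set_integrable_def)
  then show ?thesis by (simp add: set_lebesgue_integral_def)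
qed

section \<open>Viscosity property of the Hopf formula\<close>

lemma continuous_on_fst_near:
  fixes G :: "real \<times> 'a::euclidean_space \<Rightarrow> real"
  assumes "continuous_on (({0<..T} \<inter> ball t0 \<delta>) \<times> ball p \<delta>) G" "t0 \<in> {0<..T}" "\<delta> > 0" "\<eta> > 0"
  obtains r where "0 < r" "r \<le> \<delta>" "\<And>s. s \<in> {0<..T} \<Longrightarrow> \<bar>s - t0\<bar> < r \<Longrightarrow> \<bar>G (s, p) - G (t0, p)\<bar> \<le> \<eta>"
proof -
  have "(t0, p) \<in> ({0<..T} \<inter> ball t0 \<delta>) \<times> ball p \<delta>" using assms by auto
  with assms(1,4) obtain d where d: "d > 0"
    "\<And>z. z \<in> ({0<..T} \<inter> ball t0 \<delta>) \<times> ball p \<delta> \<Longrightarrow> dist z (t0, p) < d \<Longrightarrow> dist (G z) (G (t0, p)) < \<eta>"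
    unfolding continuous_on_iff by metis
  show ?thesis
  proof (rule that[of "min d \<delta>"])
    fix s assume s: "s \<in> {0<..T}" "\<bar>s - t0\<bar> < min d \<delta>"
    then have "(s, p) \<in> ({0<..T} \<inter> ball t0 \<delta>) \<times> ball p \<delta>" "dist (s, p) (t0, p) < d"
      using assms(3) by (auto simp: dist_real_def dist_Pair_Pair)
    then show "\<bar>G (s, p) - G (t0, p)\<bar> \<le> \<eta>" using d(2)[of "(s, p)"] by (simp add: dist_real_def)
  qed (use d assms in auto)
qed

lemma eventually_right_small:
  fixes \<delta> c :: real
  assumes "\<delta> > 0"
  shows "eventually (\<lambda>\<mu>. \<mu> * c < \<delta>) (at_right 0)"
proof -
  have "((\<lambda>\<mu>. \<mu> * c) \<longlongrightarrow> 0 * c) (at_right 0)" by (intro tendsto_intros)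
  then show ?thesis using assms by (intro order_tendstoD(2)[of _ "0 * c"]) auto
qed

lemma eventually_at_right_const: "\<forall>\<^sub>F \<mu> in at_right (0::real). 0 < \<mu> \<and> P \<Longrightarrow> P"
  using eventually_happens'[OF trivial_limit_at_right_real] by blast

context hamiltonian
begin

text \<open>Only times before the contact point are used in the next two lemmas, so that they also
  apply at the time where one phase ends and the next one begins.\<close>

lemma hopf_visc_super_at:
  fixes u :: "'a \<times> real \<Rightarrow> real"
  assumes f: "supported f" and t0: "0 \<le> s0" "s0 < t0" "t0 \<le> T"
    and u: "\<And>x t. t \<in> {s0..t0} \<Longrightarrow> u (x, t) = hopf H f (c * (t - s0)) x"
    and \<phi>: "C1_test \<phi> D\<phi> \<phi>t" and b: "set_integrable lborel {0..T} b" and \<delta>: "\<delta> > 0"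
    and min: "\<And>x t. x \<in> ball x0 \<delta> \<Longrightarrow> t \<in> {0<..T} \<inter> ball t0 \<delta> \<Longrightarrow>
       u (x0, t0) - \<phi> (x0, t0) - (LBINT s:{0..t0}. b s) \<le> u (x, t) - \<phi> (x, t) - (LBINT s:{0..t}. b s)"
    and G: "continuous_on (({0<..T} \<inter> ball t0 \<delta>) \<times> ball (D\<phi> (x0, t0)) \<delta>) G"
    and FG: "AE t in lborel. t \<in> {0<..T} \<inter> ball t0 \<delta> \<longrightarrow> (\<forall>p\<in>ball (D\<phi> (x0, t0)) \<delta>. G (t, p) \<le> F t p - b t)"
    and F: "AE t in lborel. t \<in> {s0<..<t0} \<longrightarrow> (\<forall>p. F t p = c * H p)"
  shows "G (t0, D\<phi> (x0, t0)) \<le> \<phi>t (x0, t0)"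
proof (rule ccontr)
  define p where "p = D\<phi> (x0, t0)"
  define a where "a = \<phi>t (x0, t0)"
  define \<Delta> where "\<Delta> = t0 - s0"
  define U where "U = u (x0, t0)"
  define \<eta> where "\<eta> = (G (t0, p) - a) / 3"
  assume "\<not> G (t0, D\<phi> (x0, t0)) \<le> \<phi>t (x0, t0)"
  then have \<eta>: "\<eta> > 0" by (simp add: \<eta>_def p_def a_def)
  have \<Delta>: "\<Delta> > 0" using t0 by (simp add: \<Delta>_def)
  obtain r where r: "0 < r" "r \<le> \<delta>"
    "\<And>s. s \<in> {0<..T} \<Longrightarrow> \<bar>s - t0\<bar> < r \<Longrightarrow> \<bar>G (s, p) - G (t0, p)\<bar> \<le> \<eta>"
    using continuous_on_fst_near[OF G _ \<delta> \<eta>] t0 unfolding p_def by auto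
  \<comment> \<open>If \<open>G (t0, p) > a\<close>, the affine function of slope \<open>p\<close>
    with value \<open>U - Q * \<Delta>\<close> at \<open>x0\<close> is a minorant of the initial
    datum. Evolved over the phase it reaches \<open>U + (c * H p - Q) * \<Delta>\<close> at
    \<open>x0\<close>, so \<open>c * H p \<le> Q\<close>; but
    \<open>Q = c * H p - \<eta>\<close>.\<close>
  define Q where "Q = a + c * H p - G (t0, p) + 2 * \<eta>"
  have minor: "p \<bullet> x' + (U - p \<bullet> x0 - Q * \<Delta>) \<le> f x'" for x'
  proof -
    have "\<forall>\<^sub>F \<mu> in at_right 0. \<mu> < (1::real)" using eventually_right_small[of 1 1] by simp
    moreover have "\<forall>\<^sub>F \<mu> in at_right 0. \<mu> > (0::real)" by (simp add: eventually_at_right_less)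
    moreover have "\<forall>\<^sub>F \<mu> in at_right 0. \<mu> * \<Delta> < r" using eventually_right_small r by blast
    moreover have "\<forall>\<^sub>F \<mu> in at_right 0. \<mu> * norm (x' - x0) < \<delta>" using eventually_right_small \<delta> by blast
    moreover have "\<forall>\<^sub>F \<mu> in at_right 0. \<bar>\<phi> (x0 + \<mu> *\<^sub>R (x' - x0), t0 + \<mu> * - \<Delta>) - \<phi> (x0, t0) -
      \<mu> * (D\<phi> (x0, t0) \<bullet> (x' - x0) + \<phi>t (x0, t0) * - \<Delta>)\<bar> \<le> (\<eta> * \<Delta>) * \<mu>"
      using \<phi> \<eta> \<Delta> by (intro C1_test_directional) auto
    ultimately have "\<forall>\<^sub>F \<mu> in at_right (0::real). 0 < \<mu> \<and> p \<bullet> x' + (U - p \<bullet> x0 - Q * \<Delta>) \<le> f x'"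
    proof eventually_elim
      case (elim \<mu>)
      define x where "x = x0 + \<mu> *\<^sub>R (x' - x0)"
      define t where "t = t0 + \<mu> * - \<Delta>"
      have t: "s0 < t" "t < t0" "\<bar>t - t0\<bar> < r" "t0 - t = \<mu> * \<Delta>"
      proof -
        have "\<mu> * \<Delta> < 1 * \<Delta>" using elim \<Delta> by (intro mult_strict_right_mono) auto
        then show "s0 < t" by (simp add: t_def \<Delta>_def algebra_simps)
        show "t < t0" "t0 - t = \<mu> * \<Delta>" using elim \<Delta> by (auto simp: t_def)
        show "\<bar>t - t0\<bar> < r" using elim \<Delta> by (auto simp: t_def)
      qed
      have eqx: "(1 - \<mu>) *\<^sub>R x0 + \<mu> *\<^sub>R x' = x" by (simp add: x_def algebra_simps)
      have eqt: "(1 - \<mu>) * (c * \<Delta>) + \<mu> * 0 = c * (t - s0)" by (simp add: t_def \<Delta>_def algebra_simps)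
      \<comment> \<open>\<open>(x, t)\<close> lies at fraction \<open>\<mu>\<close> of the segment
        from \<open>(x0, t0)\<close> to \<open>(x', s0)\<close>. Joint convexity turns local contact
        into a bound on \<open>f x'\<close> for arbitrary \<open>x'\<close>.\<close>
      have "u (x, t) \<le> (1 - \<mu>) * U + \<mu> * f x'"
      proof -
        have "u (x, t) = hopf H f (c * (t - s0)) x" "U = hopf H f (c * \<Delta>) x0"
          using t t0 by (auto simp: u U_def \<Delta>_def)
        then show ?thesis using hopf_convex[OF f, of \<mu> "c * \<Delta>" 0 x0 x'] elim
          unfolding eqx eqt hopf_0[OF f] by simp
      qed
      moreover have "U - \<phi> (x0, t0) - (LBINT s:{0..t0}. b s) \<le> u (x, t) - \<phi> (x, t) - (LBINT s:{0..t}. b s)"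
        unfolding U_def using t t0 r elim by (intro min) (auto simp: x_def dist_norm dist_real_def)
      moreover have "(LBINT s:{0..t0}. b s) - (LBINT s:{0..t}. b s) \<le> (c * H p - G (t0, p) + \<eta>) * (t0 - t)"
      proof (rule set_integral_increment_le[OF b])
        show "AE s in lborel. s \<in> {t<..<t0} \<longrightarrow> b s \<le> c * H p - G (t0, p) + \<eta>"
          using FG F
        proof eventually_elim
          case (elim s)
          show ?case
          proof
            assume s: "s \<in> {t<..<t0}"
            then have s': "s \<in> {0<..T} \<inter> ball t0 \<delta>" "s \<in> {s0<..<t0}" "\<bar>s - t0\<bar> < r"
              using t t0 r by (auto simp: dist_real_def)
            have "G (s, p) \<le> F s p - b s" using elim(1) s'(1) \<delta> unfolding p_def[symmetric] by auto
            moreover have "F s p = c * H p" using elim(2) s'(2) by blast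
            moreover have "\<bar>G (s, p) - G (t0, p)\<bar> \<le> \<eta>" using r(3) s' by blast
            ultimately show "b s \<le> c * H p - G (t0, p) + \<eta>" by linarith
          qed
        qed
      qed (use t t0 in auto)
      moreover have "\<mu> * (p \<bullet> (x' - x0) + a * - \<Delta>) - (\<eta> * \<Delta>) * \<mu> \<le> \<phi> (x, t) - \<phi> (x0, t0)"
        using elim(5) unfolding x_def t_def p_def a_def by (simp add: abs_le_iff)
      ultimately have "\<mu> * (p \<bullet> (x' - x0) + a * - \<Delta>) - (\<eta> * \<Delta>) * \<mu> - (c * H p - G (t0, p) + \<eta>) * (\<mu> * \<Delta>)
          \<le> \<mu> * (f x' - U)"
        unfolding t(4) by (simp add: algebra_simps)
      then have "\<mu> * (p \<bullet> (x' - x0) - Q * \<Delta>) \<le> \<mu> * (f x' - U)"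
        by (simp add: Q_def algebra_simps)
      then have "p \<bullet> (x' - x0) - Q * \<Delta> \<le> f x' - U" using elim by (simp add: mult_le_cancel_left)
      then show ?case using elim by (simp add: inner_diff_right)
    qed
    then show ?thesis by (rule eventually_at_right_const)
  qed
  have "p \<bullet> x0 + (U - p \<bullet> x0 - Q * \<Delta>) + c * \<Delta> * H p \<le> hopf H f (c * \<Delta>) x0"
    by (rule hopf_upper[OF f minor])
  also have "\<dots> = U" using t0 by (simp add: U_def u \<Delta>_def)
  finally have "(c * H p - Q) * \<Delta> \<le> 0" by (simp add: algebra_simps)
  then have "c * H p \<le> Q" using \<Delta> by (simp add: mult_le_0_iff)
  moreover have "3 * \<eta> = G (t0, p) - a" by (simp add: \<eta>_def)
  ultimately show False using \<eta> unfolding Q_def by linarith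
qed

lemma hopf_visc_sub_at:
  fixes u :: "'a \<times> real \<Rightarrow> real"
  assumes f: "supported f" and t0: "0 \<le> s0" "s0 < t0" "t0 \<le> T"
    and u: "\<And>x t. t \<in> {s0..t0} \<Longrightarrow> u (x, t) = hopf H f (c * (t - s0)) x"
    and \<phi>: "C1_test \<phi> D\<phi> \<phi>t" and b: "set_integrable lborel {0..T} b" and \<delta>: "\<delta> > 0"
    and max: "\<And>x t. x \<in> ball x0 \<delta> \<Longrightarrow> t \<in> {0<..T} \<inter> ball t0 \<delta> \<Longrightarrow>
       u (x, t) - \<phi> (x, t) - (LBINT s:{0..t}. b s) \<le> u (x0, t0) - \<phi> (x0, t0) - (LBINT s:{0..t0}. b s)"
    and G: "continuous_on (({0<..T} \<inter> ball t0 \<delta>) \<times> ball (D\<phi> (x0, t0)) \<delta>) G"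
    and FG: "AE t in lborel. t \<in> {0<..T} \<inter> ball t0 \<delta> \<longrightarrow> (\<forall>p\<in>ball (D\<phi> (x0, t0)) \<delta>. F t p - b t \<le> G (t, p))"
    and F: "AE t in lborel. t \<in> {s0<..<t0} \<longrightarrow> (\<forall>p. F t p = c * H p)"
  shows "\<phi>t (x0, t0) \<le> G (t0, D\<phi> (x0, t0))"
proof (rule field_le_epsilon)
  fix \<eta>' :: real assume "\<eta>' > 0"
  define p where "p = D\<phi> (x0, t0)"
  define a where "a = \<phi>t (x0, t0)"
  define \<Delta> where "\<Delta> = t0 - s0"
  define U where "U = u (x0, t0)"
  define \<eta> where "\<eta> = \<eta>' / 2"
  have \<eta>: "\<eta> > 0" using \<open>\<eta>' > 0\<close> by (simp add: \<eta>_def)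
  have \<Delta>: "\<Delta> > 0" using t0 by (simp add: \<Delta>_def)
  obtain r where r: "0 < r" "r \<le> \<delta>"
    "\<And>s. s \<in> {0<..T} \<Longrightarrow> \<bar>s - t0\<bar> < r \<Longrightarrow> \<bar>G (s, p) - G (t0, p)\<bar> \<le> \<eta>"
    using continuous_on_fst_near[OF G _ \<delta> \<eta>] t0 unfolding p_def by auto
  \<comment> \<open>The affine function touching from below at the contact point, with slope
    \<open>q\<close> in space and \<open>H q\<close> in the path variable.\<close>
  obtain q where q': "\<And>z y'. hopf H f (c * \<Delta>) x0 + q \<bullet> (z - x0) + (y' - c * \<Delta>) * H q \<le> hopf H f y' z"
    using hopf_support[OF f] by blast
  have q: "U + q \<bullet> (z - x0) + c * (t - t0) * H q \<le> u (z, t)" if "t \<in> {s0..t0}" for z t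
  proof -
    have "c * (t - s0) - c * \<Delta> = c * (t - t0)" by (simp add: \<Delta>_def algebra_simps)
    then show ?thesis using q'[of z "c * (t - s0)"] that t0 by (simp add: u U_def \<Delta>_def)
  qed
  \<comment> \<open>\<open>u\<close> lies above an affine function of slope \<open>q\<close> and, up
    to a constant, below a function with spatial gradient \<open>p\<close>, so contact makes the
    slopes equal. All points compared have time \<open>t0\<close>, hence the integrals of
    \<open>b\<close> cancel.\<close>
  have "q = p"
  proof -
    define h where "h = q - p"
    have "norm h ^ 2 \<le> e" if e: "e > 0" for e
    proof -
      have "\<forall>\<^sub>F \<mu> in at_right 0. \<mu> > (0::real)" by (simp add: eventually_at_right_less)
      moreover have "\<forall>\<^sub>F \<mu> in at_right 0. \<mu> * norm h < \<delta>" using eventually_right_small \<delta> by blast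
      moreover have "\<forall>\<^sub>F \<mu> in at_right 0. \<bar>\<phi> (x0 + \<mu> *\<^sub>R h, t0 + \<mu> * 0) - \<phi> (x0, t0) -
        \<mu> * (D\<phi> (x0, t0) \<bullet> h + \<phi>t (x0, t0) * 0)\<bar> \<le> e * \<mu>"
        using \<phi> e by (intro C1_test_directional) auto
      ultimately have "\<forall>\<^sub>F \<mu> in at_right (0::real). 0 < \<mu> \<and> norm h ^ 2 \<le> e"
      proof eventually_elim
        case (elim \<mu>)
        have "u (x0 + \<mu> *\<^sub>R h, t0) - \<phi> (x0 + \<mu> *\<^sub>R h, t0) \<le> U - \<phi> (x0, t0)"
          using max[of "x0 + \<mu> *\<^sub>R h" t0] elim \<delta> t0 by (auto simp: dist_norm U_def)
        moreover have "U + \<mu> * (q \<bullet> h) \<le> u (x0 + \<mu> *\<^sub>R h, t0)"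
          using q[of t0 "x0 + \<mu> *\<^sub>R h"] t0 by simp
        moreover have "\<phi> (x0 + \<mu> *\<^sub>R h, t0) - \<phi> (x0, t0) \<le> \<mu> * (p \<bullet> h) + e * \<mu>"
          using elim(3) by (simp add: p_def abs_le_iff)
        ultimately have "\<mu> * (q \<bullet> h) \<le> \<mu> * (p \<bullet> h + e)" by (simp add: algebra_simps)
        then have "q \<bullet> h \<le> p \<bullet> h + e" using elim by simp
        then show ?case using elim by (simp add: h_def power2_norm_eq_inner inner_diff_left)
      qed
      then show ?thesis by (rule eventually_at_right_const)
    qed
    then have "norm h ^ 2 \<le> 0" by (meson dense_le field_le_epsilon linorder_not_less)
    then show ?thesis by (simp add: h_def)
  qed
  have "\<forall>\<^sub>F \<mu> in at_right 0. \<mu> < (1::real)" using eventually_right_small[of 1 1] by simp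
  moreover have "\<forall>\<^sub>F \<mu> in at_right 0. \<mu> > (0::real)" by (simp add: eventually_at_right_less)
  moreover have "\<forall>\<^sub>F \<mu> in at_right 0. \<mu> * \<Delta> < r" using eventually_right_small r by blast
  moreover have "\<forall>\<^sub>F \<mu> in at_right 0. \<bar>\<phi> (x0 + \<mu> *\<^sub>R 0, t0 + \<mu> * - \<Delta>) - \<phi> (x0, t0) -
    \<mu> * (D\<phi> (x0, t0) \<bullet> 0 + \<phi>t (x0, t0) * - \<Delta>)\<bar> \<le> (\<eta> * \<Delta>) * \<mu>"
    using \<phi> \<eta> \<Delta> by (intro C1_test_directional) auto
  ultimately have "\<forall>\<^sub>F \<mu> in at_right (0::real). 0 < \<mu> \<and> a \<le> G (t0, p) + 2 * \<eta>"
  proof eventually_elim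
    case (elim \<mu>)
    define t where "t = t0 + \<mu> * - \<Delta>"
    have t: "s0 < t" "t < t0" "\<bar>t - t0\<bar> < r" "t0 - t = \<mu> * \<Delta>"
    proof -
      have "\<mu> * \<Delta> < 1 * \<Delta>" using elim \<Delta> by (intro mult_strict_right_mono) auto
      then show "s0 < t" by (simp add: t_def \<Delta>_def algebra_simps)
      show "t < t0" "t0 - t = \<mu> * \<Delta>" using elim \<Delta> by (auto simp: t_def)
      show "\<bar>t - t0\<bar> < r" using elim \<Delta> by (auto simp: t_def)
    qed
    \<comment> \<open>The touching affine function bounds \<open>u\<close> from below at earlier
      times; with contact from above this limits the time derivative of the test function.\<close>
    have "U - c * H p * (t0 - t) \<le> u (x0, t)" using q[of t x0] t \<open>q = p\<close> by (simp add: algebra_simps)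
    moreover have "u (x0, t) - \<phi> (x0, t) - (LBINT s:{0..t}. b s) \<le> U - \<phi> (x0, t0) - (LBINT s:{0..t0}. b s)"
      unfolding U_def using t t0 r \<delta> by (intro max) (auto simp: dist_real_def)
    moreover have "(c * H p - G (t0, p) - \<eta>) * (t0 - t) \<le> (LBINT s:{0..t0}. b s) - (LBINT s:{0..t}. b s)"
    proof (rule set_integral_increment_ge[OF b])
      show "AE s in lborel. s \<in> {t<..<t0} \<longrightarrow> c * H p - G (t0, p) - \<eta> \<le> b s"
        using FG F
      proof eventually_elim
        case (elim s)
        show ?case
        proof
          assume s: "s \<in> {t<..<t0}"
          then have s': "s \<in> {0<..T} \<inter> ball t0 \<delta>" "s \<in> {s0<..<t0}" "\<bar>s - t0\<bar> < r"
            using t t0 r by (auto simp: dist_real_def)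
          have "F s p - b s \<le> G (s, p)" using elim(1) s'(1) \<delta> unfolding p_def[symmetric] by auto
          moreover have "F s p = c * H p" using elim(2) s'(2) by blast
          moreover have "\<bar>G (s, p) - G (t0, p)\<bar> \<le> \<eta>" using r(3) s' by blast
          ultimately show "c * H p - G (t0, p) - \<eta> \<le> b s" by linarith
        qed
      qed
    qed (use t t0 in auto)
    moreover have "\<phi> (x0, t) - \<phi> (x0, t0) \<le> - a * (t0 - t) + \<eta> * (t0 - t)"
      using elim(4) unfolding t(4) unfolding t_def a_def by (simp add: abs_le_iff algebra_simps)
    ultimately have "(a - (G (t0, p) + 2 * \<eta>)) * (t0 - t) \<le> 0"
      by (simp add: algebra_simps)
    then show ?case using t elim \<Delta> by (auto simp: mult_le_0_iff)
  qed
  then have "a \<le> G (t0, p) + 2 * \<eta>" by (rule eventually_at_right_const)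
  then show "\<phi>t (x0, t0) \<le> G (t0, D\<phi> (x0, t0)) + \<eta>'"
    by (simp add: a_def p_def \<eta>_def)
qed

end

section \<open>Comparison and uniqueness\<close>

text \<open>Chaining: a segment in the convex strip is divided into steps shorter than
  \<open>\<delta>\<close>, each changing \<open>v\<close> by less than \<open>1\<close>. Linear
  growth is what lets a quadratic penalty force the doubled variables together on an unbounded
  space.\<close>

lemma uniformly_continuous_linear_growth:
  fixes v :: "'a::real_normed_vector \<times> real \<Rightarrow> real"
  assumes v: "uniformly_continuous_on (UNIV \<times> {s0..s1}) v"
  obtains A where "A \<ge> 0"
    "\<And>x y t s. t \<in> {s0..s1} \<Longrightarrow> s \<in> {s0..s1} \<Longrightarrow> \<bar>v (x, t) - v (y, s)\<bar> \<le> A * (1 + norm (x - y))"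
proof -
  define S :: "('a \<times> real) set" where "S = UNIV \<times> {s0..s1}"
  have S: "convex S" by (simp add: S_def convex_Times)
  obtain \<delta> where \<delta>: "\<delta> > 0" "\<And>z z'. z \<in> S \<Longrightarrow> z' \<in> S \<Longrightarrow> dist z' z < \<delta> \<Longrightarrow> dist (v z') (v z) < 1"
    using v unfolding uniformly_continuous_on_def S_def by (metis zero_less_one)
  have chain: "\<bar>v z - v z'\<bar> \<le> real n" if "z \<in> S" "z' \<in> S" "dist z z' \<le> n * (\<delta> / 2)" for n z z'
    using that
  proof (induction n arbitrary: z')
    case (Suc n)
    define w where "w = (1 - 1 / (n + 1)) *\<^sub>R z' + (1 / (n + 1)) *\<^sub>R z"
    have w: "w \<in> S" unfolding w_def using S Suc.prems by (intro convexD_alt) auto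
    have d: "dist z' w = dist z z' / (n + 1)"
    proof -
      have "z' - w = (1 / (n + 1)) *\<^sub>R (z' - z)" by (simp add: w_def algebra_simps)
      then show ?thesis by (simp add: dist_norm norm_minus_commute)
    qed
    have d': "dist z w = dist z z' * (n / (n + 1))"
    proof -
      have "z - w = (1 - 1 / (n + 1)) *\<^sub>R (z - z')" by (simp add: w_def algebra_simps)
      moreover have "1 - 1 / (real n + 1) = n / (1 + n)" "1 - 1 / (1 + real n) = n / (1 + n)" by (simp_all add: field_simps)
      ultimately show ?thesis by (simp add: dist_norm mult.commute)
    qed
    have "dist z z' * (n / (n + 1)) \<le> (Suc n * (\<delta> / 2)) * (n / (n + 1))"
      using Suc.prems by (intro mult_right_mono) auto
    moreover have "(Suc n * (\<delta> / 2)) * (n / (n + 1)) = n * (\<delta> / 2)"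
    proof -
      have "real (Suc n) = real (n + 1)" "real (n + 1) \<noteq> 0" by auto
      then show ?thesis by (simp only: times_divide_eq_right times_divide_eq_left) (simp add: divide_simps)
    qed
    ultimately have "dist z w \<le> n * (\<delta> / 2)" unfolding d' by linarith
    then have "\<bar>v z - v w\<bar> \<le> n" using Suc w by blast
    moreover have "dist z' w < \<delta>"
      using Suc.prems(3) \<delta>(1) unfolding d by (simp add: field_simps) (smt (verit) mult_nonneg_nonneg of_nat_0_le_iff)
    then have "dist (v z') (v w) < 1" using \<delta>(2)[OF w Suc.prems(2)] by simp
    ultimately show ?case by (simp add: dist_real_def)
  qed simp
  define A where "A = 1 + 2 * \<bar>s1 - s0\<bar> / \<delta> + 2 / \<delta>"
  show ?thesis
  proof (rule that[of A])
    show "A \<ge> 0" using \<delta> by (simp add: A_def)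
    fix x y :: 'a and t s assume ts: "t \<in> {s0..s1}" "s \<in> {s0..s1}"
    define n where "n = nat \<lceil>2 * dist (x, t) (y, s) / \<delta>\<rceil>"
    have "2 * dist (x, t) (y, s) / \<delta> \<le> n" by (simp add: n_def real_nat_ceiling_ge)
    then have "dist (x, t) (y, s) \<le> n * (\<delta> / 2)" using \<delta> by (simp add: field_simps)
    then have "\<bar>v (x, t) - v (y, s)\<bar> \<le> n" using ts by (intro chain) (auto simp: S_def)
    also have "real n \<le> 2 * dist (x, t) (y, s) / \<delta> + 1"
      using \<delta> by (simp add: n_def of_nat_nat ceiling_le_iff)
    also have "\<dots> \<le> 2 * (norm (x - y) + \<bar>s1 - s0\<bar>) / \<delta> + 1"
    proof -
      have "dist (x, t) (y, s) \<le> dist x y + dist t s"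
        by (simp add: dist_Pair_Pair sqrt_sum_squares_le_sum)
      also have "\<dots> \<le> norm (x - y) + \<bar>s1 - s0\<bar>" using ts by (auto simp: dist_norm)
      finally show ?thesis using \<delta> by (intro add_mono divide_right_mono mult_left_mono) auto
    qed
    also have "\<dots> \<le> A * (1 + norm (x - y))"
      using \<delta> by (simp add: A_def algebra_simps add_divide_distrib)
    finally show "\<bar>v (x, t) - v (y, s)\<bar> \<le> A * (1 + norm (x - y))" .
  qed
qed

text \<open>One family serves both sides of the doubling: \<open>e > 0\<close> with weights
  \<open>l\<close>, \<open>a\<close> for the subsolution, and \<open>- e\<close> with zero weights
  for the supersolution, where the quadratic penalty has the opposite sign. The root is a smooth
  substitute for \<open>norm x\<close> with gradient of norm below \<open>1\<close>.\<close>

lemma C1_test_penalty: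
  fixes y :: "'a::euclidean_space"
  assumes "e \<noteq> 0"
  shows "C1_test (\<lambda>(x, t). ((x - y) \<bullet> (x - y) + (t - s)\<^sup>2) / (2 * e) + l * sqrt (1 + x \<bullet> x) + a * exp (N * (t - b)))
    (\<lambda>(x, t). (1 / e) *\<^sub>R (x - y) + (l / sqrt (1 + x \<bullet> x)) *\<^sub>R x)
    (\<lambda>(x, t). (t - s) / e + a * N * exp (N * (t - b)))"
proof -
  have pos: "1 + x \<bullet> x > 0" for x :: 'a by (simp add: add_pos_nonneg)
  then have ne: "1 + x \<bullet> x \<noteq> 0" for x :: 'a by (metis less_irrefl)
  show ?thesis
    unfolding C1_test_def case_prod_unfold
  proof (intro conjI allI)
    show "continuous_on UNIV (\<lambda>z::'a \<times> real. (1 / e) *\<^sub>R (fst z - y) + (l / sqrt (1 + fst z \<bullet> fst z)) *\<^sub>R fst z)"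
      using ne by (intro continuous_intros) auto
    show "continuous_on UNIV (\<lambda>z::'a \<times> real. (snd z - s) / e + a * N * exp (N * (snd z - b)))"
      using assms by (intro continuous_intros) auto
    fix z :: "'a \<times> real"
    have 1: "((\<lambda>z::'a \<times> real. ((fst z - y) \<bullet> (fst z - y) + (snd z - s)\<^sup>2) / (2 * e)) has_derivative
      (\<lambda>w. (1 / e) * ((fst z - y) \<bullet> fst w) + (snd z - s) / e * snd w)) (at z)"
      using assms by (auto intro!: derivative_eq_intros simp: fun_eq_iff inner_commute field_simps)
    have 2: "((\<lambda>z::'a \<times> real. l * sqrt (1 + fst z \<bullet> fst z)) has_derivative
      (\<lambda>w. (l / sqrt (1 + fst z \<bullet> fst z)) * (fst z \<bullet> fst w))) (at z)"
      using pos[of "fst z"] by (auto intro!: derivative_eq_intros simp: fun_eq_iff inner_commute field_simps)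
    have 3: "((\<lambda>z::'a \<times> real. a * exp (N * (snd z - b))) has_derivative
      (\<lambda>w. a * N * exp (N * (snd z - b)) * snd w)) (at z)"
      by (auto intro!: derivative_eq_intros simp: fun_eq_iff algebra_simps)
    show "((\<lambda>z. ((fst z - y) \<bullet> (fst z - y) + (snd z - s)\<^sup>2) / (2 * e) + l * sqrt (1 + fst z \<bullet> fst z) + a * exp (N * (snd z - b))) has_derivative
      (\<lambda>w. ((1 / e) *\<^sub>R (fst z - y) + (l / sqrt (1 + fst z \<bullet> fst z)) *\<^sub>R fst z) \<bullet> fst w +
        ((snd z - s) / e + a * N * exp (N * (snd z - b))) * snd w)) (at z)"
      by (rule has_derivative_eq_rhs[OF has_derivative_add[OF has_derivative_add[OF 1 2] 3]])
        (simp add: fun_eq_iff inner_add_left distrib_right)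
  qed
qed

context hamiltonian
begin

text \<open>Doubling of variables. The exponential penalty in time keeps the maximum away from the final
  time; being a global \<open>C\<^sup>1\<close> function it is admissible as part of a test function.\<close>

lemma comparison_interior:
  fixes v u :: "'a \<times> real \<Rightarrow> real"
  assumes v_uc: "uniformly_continuous_on (UNIV \<times> {s0..s1}) v"
    and u_uc: "uniformly_continuous_on (UNIV \<times> {s0..s1}) u"
    and sub: "\<And>\<phi> D\<phi> \<phi>t x0 t0 \<delta>. C1_test \<phi> D\<phi> \<phi>t \<Longrightarrow> t0 \<in> {s0<..<s1} \<Longrightarrow> \<delta> > 0 \<Longrightarrow>
      (\<And>x t. x \<in> ball x0 \<delta> \<Longrightarrow> t \<in> ball t0 \<delta> \<Longrightarrow> v (x, t) - \<phi> (x, t) \<le> v (x0, t0) - \<phi> (x0, t0)) \<Longrightarrow>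
      \<phi>t (x0, t0) \<le> c * H (D\<phi> (x0, t0))"
    and super: "\<And>\<phi> D\<phi> \<phi>t x0 t0 \<delta>. C1_test \<phi> D\<phi> \<phi>t \<Longrightarrow> t0 \<in> {s0<..<s1} \<Longrightarrow> \<delta> > 0 \<Longrightarrow>
      (\<And>x t. x \<in> ball x0 \<delta> \<Longrightarrow> t \<in> ball t0 \<delta> \<Longrightarrow> u (x0, t0) - \<phi> (x0, t0) \<le> u (x, t) - \<phi> (x, t)) \<Longrightarrow>
      c * H (D\<phi> (x0, t0)) \<le> \<phi>t (x0, t0)"
    and init: "\<And>x. v (x, s0) \<le> u (x, s0)"
    and tb: "tb \<in> {s0<..<s1}"
  shows "v (xb, tb) \<le> u (xb, tb)"
proof (rule ccontr)
  \<comment> \<open>A quarter of the presumed gap: one share pays for \<open>g\<close>, one for the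
    penalty at infinity, and \<open>2 * \<sigma>\<close> remains at \<open>(xb, tb)\<close>.\<close>
  define \<sigma> where "\<sigma> = (v (xb, tb) - u (xb, tb)) / 4"
  assume "\<not> v (xb, tb) \<le> u (xb, tb)"
  then have \<sigma>: "\<sigma> > 0" by (simp add: \<sigma>_def)
  obtain Av where Av: "Av \<ge> 0" "\<And>x y t s. t \<in> {s0..s1} \<Longrightarrow> s \<in> {s0..s1} \<Longrightarrow> \<bar>v (x, t) - v (y, s)\<bar> \<le> Av * (1 + norm (x - y))"
    using uniformly_continuous_linear_growth[OF v_uc] by blast
  obtain Au where Au: "Au \<ge> 0" "\<And>x y t s. t \<in> {s0..s1} \<Longrightarrow> s \<in> {s0..s1} \<Longrightarrow> \<bar>u (x, t) - u (y, s)\<bar> \<le> Au * (1 + norm (x - y))"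
    using uniformly_continuous_linear_growth[OF u_uc] by blast
  define C where "C = Av + Au + 1"
  have C: "C \<ge> 1" using Av Au by (simp add: C_def)
  have growth: "v (x, t) - u (y, s) \<le> C * (1 + norm (x - y))" if "t \<in> {s0..s1}" "s \<in> {s0..s1}" for x y t s
  proof -
    have s0: "s0 \<in> {s0..s1}" using tb by auto
    have "v (x, t) - v (x, s0) \<le> Av" using Av(2)[OF that(1) s0, of x x] by simp
    moreover have "u (x, s0) - u (y, s) \<le> Au * (1 + norm (x - y))" using Au(2)[OF s0 that(2), of x y] by simp
    moreover have "Av \<le> Av * (1 + norm (x - y))" using Av(1) by (simp add: mult_le_cancel_left1)
    moreover have "C * (1 + norm (x - y)) = Av * (1 + norm (x - y)) + Au * (1 + norm (x - y)) + (1 + norm (x - y))"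
      by (simp add: C_def algebra_simps)
    ultimately show ?thesis using init[of x] norm_ge_zero[of "x - y"] by linarith
  qed
  define s2 where "s2 = (tb + s1) / 2"
  have s2: "tb < s2" "s2 < s1" "s0 < tb" using tb by (auto simp: s2_def)
  \<comment> \<open>Large enough for \<open>g\<close> to grow from \<open>\<sigma>\<close> at
    \<open>tb\<close> beyond \<open>C + C\<^sup>2\<close> at \<open>s2\<close>. By
    \<open>pen\<close> this exceeds linear growth minus quadratic penalty, so no positive maximum
    lies at \<open>s2\<close>.\<close>
  define N where "N = ln ((C + C\<^sup>2 + 1) / \<sigma> + 1) / (s2 - tb)"
  define g where "g t = \<sigma> * exp (N * (t - tb))" for t
  have pos1: "(C + C\<^sup>2 + 1) / \<sigma> > 0" using C \<sigma> by (intro divide_pos_pos add_pos_nonneg) auto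
  then have N: "N > 0" using s2 by (simp add: N_def)
  have "exp (N * (s2 - tb)) = (C + C\<^sup>2 + 1) / \<sigma> + 1" using s2 pos1 by (simp add: N_def)
  then have g_s2: "g s2 > C + C\<^sup>2" using \<sigma> by (simp add: g_def field_simps)
  have g_tb: "g tb = \<sigma>" by (simp add: g_def)
  have g_pos: "g t > 0" for t using \<sigma> by (simp add: g_def)
  \<comment> \<open>Lower bound for the derivative of \<open>g\<close> from time \<open>s0\<close>
    on: the strict surplus behind the final contradiction.\<close>
  define k where "k = \<sigma> * N * exp (N * (s0 - tb))"
  have k: "k > 0" using \<sigma> N by (simp add: k_def)
  have k_le: "k \<le> \<sigma> * N * exp (N * (t - tb))" if "s0 \<le> t" for t
    using \<sigma> N that by (simp add: k_def)
  have "k / (\<bar>c\<bar> + 1) > 0" using k by simp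
  then obtain \<delta>H where \<delta>H: "\<delta>H > 0" "\<And>p q. dist q p < \<delta>H \<Longrightarrow> dist (H q) (H p) < k / (\<bar>c\<bar> + 1)"
    using H_uniformly_continuous unfolding uniformly_continuous_on_def by (metis UNIV_I)
  have sq1: "sqrt (1 + x \<bullet> x) \<ge> 1" "norm x \<le> sqrt (1 + x \<bullet> x)" for x :: 'a
    by (auto simp: norm_eq_sqrt_inner)
  \<comment> \<open>Two constraints: the penalty at infinity costs at most \<open>\<sigma>\<close>
    at \<open>xb\<close>, and its gradient is shorter than \<open>\<delta>H\<close>.\<close>
  define l where "l = min (\<sigma> / sqrt (1 + xb \<bullet> xb)) (\<delta>H / 2)"
  have "\<sigma> / sqrt (1 + xb \<bullet> xb) > 0" using \<sigma> sq1(1)[of xb] by (intro divide_pos_pos) linarith+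
  then have l: "l > 0" "l < \<delta>H" using \<delta>H(1) unfolding l_def by auto
  have "l \<le> \<sigma> / sqrt (1 + xb \<bullet> xb)" by (simp add: l_def)
  then have l_xb: "l * sqrt (1 + xb \<bullet> xb) \<le> \<sigma>" using sq1(1)[of xb]
    by (subst (asm) pos_le_divide_eq) linarith+
  obtain \<rho>1 where \<rho>1: "\<rho>1 > 0" "\<And>z z'. z \<in> UNIV \<times> {s0..s1} \<Longrightarrow> z' \<in> UNIV \<times> {s0..s1} \<Longrightarrow> dist z' z < \<rho>1 \<Longrightarrow> dist (v z') (v z) < \<sigma>"
    using v_uc \<sigma> unfolding uniformly_continuous_on_def by metis
  obtain \<rho>2 where \<rho>2: "\<rho>2 > 0" "\<And>z z'. z \<in> UNIV \<times> {s0..s1} \<Longrightarrow> z' \<in> UNIV \<times> {s0..s1} \<Longrightarrow> dist z' z < \<rho>2 \<Longrightarrow> dist (u z') (u z) < \<sigma>"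
    using u_uc \<sigma> unfolding uniformly_continuous_on_def by metis
  \<comment> \<open>\<open>\<rho>1\<close> and \<open>\<rho>2\<close> exclude maxima at the initial
    time, and \<open>s1 - s2\<close> ensures \<open>s < s1\<close> once
    \<open>t < s2\<close>.\<close>
  define \<rho> where "\<rho> = min (min \<rho>1 \<rho>2) (s1 - s2) / 2"
  have \<rho>: "\<rho> > 0" "2 * \<rho> \<le> \<rho>1" "2 * \<rho> \<le> \<rho>2" "\<rho> < s1 - s2" using \<rho>1 \<rho>2 s2 by (auto simp: \<rho>_def)
  \<comment> \<open>The choice of \<open>e\<close> below gives
    \<open>d\<^sup>2 + (t - s)\<^sup>2 < \<theta> * (1 + d)\<close> at a maximum; this
    \<open>\<theta>\<close> then makes \<open>d\<close> and the time gap both smaller than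
    \<open>\<rho>\<close>.\<close>
  define \<theta> where "\<theta> = \<rho>\<^sup>2 / (2 * (1 + \<rho>))"
  have \<theta>: "\<theta> > 0" "\<theta> * (1 + \<rho>) < \<rho>\<^sup>2" 
  proof -
    show "\<theta> > 0" using \<rho> by (simp add: \<theta>_def)
    have "\<theta> * (1 + \<rho>) = \<rho>\<^sup>2 / 2" using \<rho> by (simp add: \<theta>_def divide_simps)
    moreover have "\<rho>\<^sup>2 > 0" using \<rho> by simp
    ultimately show "\<theta> * (1 + \<rho>) < \<rho>\<^sup>2" by linarith
  qed
  define e where "e = min (\<theta> / (2 * C)) 1"
  have e: "e > 0" "e \<le> 1" "2 * e * C \<le> \<theta>" using C \<theta> by (auto simp: e_def min_def field_simps)
  define \<Phi> where "\<Phi> = (\<lambda>((x, t), (y, s)). v (x, t) - u (y, s) - ((x - y) \<bullet> (x - y) + (t - s)\<^sup>2) / (2 * e)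
     - l * sqrt (1 + x \<bullet> x) - g t)"
  define R where "R = (C + C\<^sup>2) / l"
  \<comment> \<open>Outside this compact set \<open>\<Phi>\<close> is negative on the strip, so a
    maximiser over \<open>K\<close> is one over the whole strip.\<close>
  define K where "K = (cball (0::'a) R \<times> {s0..s2}) \<times> (cball (0::'a) (R + (2 * C + 2)) \<times> {s0..s1})"
  have pen: "C * (1 + d) - d\<^sup>2 / 2 \<le> C + C\<^sup>2" for d :: real
  proof -
    have "0 \<le> (C - d)\<^sup>2 + C\<^sup>2" by simp
    then show ?thesis by (simp add: power2_eq_square algebra_simps)
  qed
  have \<Phi>_le: "\<Phi> ((x, t), (y, s)) \<le> C * (1 + norm (x - y)) - (norm (x - y))\<^sup>2 / 2 - l * norm x - g t"
    if "t \<in> {s0..s1}" "s \<in> {s0..s1}" for x y t s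
  proof -
    have "(norm (x - y))\<^sup>2 / 2 \<le> ((norm (x - y))\<^sup>2 + (t - s)\<^sup>2) / (2 * e)"
      using e by (intro frac_le) auto
    moreover have "l * norm x \<le> l * sqrt (1 + x \<bullet> x)" using l sq1 by (intro mult_left_mono) auto
    moreover have "\<Phi> ((x, t), (y, s)) = v (x, t) - u (y, s) - ((norm (x - y))\<^sup>2 + (t - s)\<^sup>2) / (2 * e)
       - l * sqrt (1 + x \<bullet> x) - g t" by (simp add: \<Phi>_def power2_norm_eq_inner)
    ultimately show ?thesis using growth[OF that, of x y] by linarith
  qed
  have outside: "\<Phi> ((x, t), (y, s)) < 0" if ts: "t \<in> {s0..s2}" "s \<in> {s0..s1}" and out: "((x, t), (y, s)) \<notin> K" for x y t s
  proof -
    have t: "t \<in> {s0..s1}" using ts s2 by auto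
    define d where "d = norm (x - y)"
    have le: "\<Phi> ((x, t), (y, s)) \<le> C * (1 + d) - d\<^sup>2 / 2 - l * norm x - g t"
      using \<Phi>_le[OF t ts(2)] by (simp add: d_def)
    show ?thesis
    proof (cases "norm x > R")
      case True
      then have "C + C\<^sup>2 < l * norm x" using l by (simp add: R_def field_simps)
      then show ?thesis using le pen[of d] g_pos[of t] by linarith
    next
      case False
      then have "R + (2 * C + 2) < norm y" using out ts by (auto simp: K_def)
      moreover have "norm y \<le> norm x + d" using norm_triangle_sub[of y x] by (simp add: d_def norm_minus_commute)
      ultimately have d: "d > 2 * C + 2" using False by linarith
      then have "(2 * C + 2) * d \<le> d * d" using C by (intro mult_right_mono) auto
      then have "C * (1 + d) - d\<^sup>2 / 2 < 0" using d C by (simp add: power2_eq_square algebra_simps)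
      moreover have "0 \<le> l * norm x" using l by simp
      ultimately show ?thesis using le g_pos[of t] by linarith
    qed
  qed
  have cont_v: "continuous_on (UNIV \<times> {s0..s1}) v" and cont_u: "continuous_on (UNIV \<times> {s0..s1}) u"
    using v_uc u_uc uniformly_continuous_imp_continuous by auto
  have "continuous_on K \<Phi>"
    unfolding \<Phi>_def case_prod_unfold g_def
    using e s2 by (intro continuous_intros continuous_on_compose2[OF cont_v] continuous_on_compose2[OF cont_u])
      (auto simp: K_def)
  moreover have "compact K" unfolding K_def by (intro compact_Times compact_cball compact_Icc)
  moreover have \<Phi>b: "\<Phi> ((xb, tb), (xb, tb)) \<ge> 2 * \<sigma>" using l_xb g_tb by (simp add: \<Phi>_def \<sigma>_def)
  moreover have inK: "((xb, tb), (xb, tb)) \<in> K" using outside[of tb tb xb xb] s2 \<Phi>b \<sigma> by force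
  ultimately obtain w where w: "w \<in> K" "\<And>w'. w' \<in> K \<Longrightarrow> \<Phi> w' \<le> \<Phi> w"
    using continuous_attains_sup[of K \<Phi>] by blast
  obtain x t y s where w_eq: "w = ((x, t), (y, s))" by (metis surj_pair)
  have \<Phi>w: "\<Phi> ((x, t), (y, s)) \<ge> 2 * \<sigma>" using w(2)[OF inK] \<Phi>b w_eq by simp
  have ts: "t \<in> {s0..s2}" "s \<in> {s0..s1}" "t \<in> {s0..s1}" using w(1) s2 by (auto simp: w_eq K_def)
  have max: "\<Phi> ((x', t'), (y', s')) \<le> \<Phi> ((x, t), (y, s))" if "t' \<in> {s0..s2}" "s' \<in> {s0..s1}" for x' t' y' s'
  proof (cases "((x', t'), (y', s')) \<in> K")
    case False
    then show ?thesis using outside[OF that, of x' y'] \<Phi>w \<sigma> by linarith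
  qed (use w in \<open>simp add: w_eq\<close>)
  define d where "d = norm (x - y)"
  have pen0: "0 \<le> l * sqrt (1 + x \<bullet> x)" using l by simp
  have pen_le: "(d\<^sup>2 + (t - s)\<^sup>2) / (2 * e) < v (x, t) - u (y, s)"
    using \<Phi>w \<sigma> g_pos[of t] pen0 by (simp add: \<Phi>_def d_def power2_norm_eq_inner)
  have "(d\<^sup>2 + (t - s)\<^sup>2) / (2 * e) \<ge> 0" using e by simp
  then have D: "v (x, t) - u (y, s) \<ge> 2 * \<sigma>"
    using \<Phi>w g_pos[of t] pen0 by (simp add: \<Phi>_def d_def power2_norm_eq_inner)
  have "(d\<^sup>2 + (t - s)\<^sup>2) / (2 * e) < C * (1 + d)" using pen_le growth[OF ts(3,2), of x y] by (simp add: d_def)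
  then have "d\<^sup>2 + (t - s)\<^sup>2 < (2 * e * C) * (1 + d)" using e by (simp add: field_simps)
  also have "\<dots> \<le> \<theta> * (1 + d)" using e by (intro mult_right_mono) (auto simp: d_def)
  finally have quad: "d\<^sup>2 + (t - s)\<^sup>2 < \<theta> * (1 + d)" .
  have d\<rho>: "d < \<rho>"
  proof (rule ccontr)
    assume "\<not> d < \<rho>"
    then have "\<rho> * (1 + d) \<le> d * (1 + \<rho>)" by (simp add: algebra_simps)
    then have "\<theta> * (\<rho> * (1 + d)) \<le> \<theta> * (d * (1 + \<rho>))" using \<theta> by (intro mult_left_mono) auto
    also have "\<dots> = d * (\<theta> * (1 + \<rho>))" by simp
    also have "\<dots> \<le> d * \<rho>\<^sup>2" using \<theta> by (intro mult_left_mono) (auto simp: d_def)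
    finally have "\<rho> * (\<theta> * (1 + d)) \<le> \<rho> * (d * \<rho>)" by (simp add: power2_eq_square algebra_simps)
    then have "\<theta> * (1 + d) \<le> d * \<rho>" using \<rho> by simp
    also have "\<dots> \<le> d * d" using \<open>\<not> d < \<rho>\<close> by (intro mult_left_mono) (auto simp: d_def)
    finally show False using quad zero_le_power2[of "t - s"] unfolding power2_eq_square[of d] by linarith
  qed
  have "(t - s)\<^sup>2 < \<theta> * (1 + d)" using quad zero_le_power2[of d] by linarith
  also have "\<dots> \<le> \<theta> * (1 + \<rho>)" using d\<rho> \<theta> by (intro mult_left_mono) auto
  also have "\<dots> < \<rho>\<^sup>2" by (rule \<theta>)
  finally have "\<bar>t - s\<bar>\<^sup>2 < \<rho>\<^sup>2" by simp
  then have ts\<rho>: "\<bar>t - s\<bar> < \<rho>" using \<rho> by (intro power2_less_imp_less[of "\<bar>t - s\<bar>" \<rho>]) auto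
  have near: "dist (x, t) (y, s) < 2 * \<rho>"
  proof -
    have "dist (x, t) (y, s) \<le> dist x y + dist t s" by (simp add: dist_Pair_Pair sqrt_sum_squares_le_sum)
    then show ?thesis using d\<rho> ts\<rho> by (simp add: d_def dist_norm)
  qed
  \<comment> \<open>At the initial time \<open>v \<le> u\<close>, and the two points are close, so
    the gap would be below \<open>\<sigma>\<close> instead of at least
    \<open>2 * \<sigma>\<close>.\<close>
  have "t \<noteq> s0"
  proof
    assume "t = s0"
    then have "dist (u (x, s0)) (u (y, s)) < \<sigma>" using near \<rho> ts by (intro \<rho>2) auto
    then show False using init[of x] D \<open>t = s0\<close> \<sigma> by (simp add: dist_real_def)
  qed
  moreover have "s \<noteq> s0"
  proof
    assume "s = s0"
    then have "dist (v (x, t)) (v (y, s0)) < \<sigma>" using near \<rho> ts by (intro \<rho>1) auto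
    then show False using init[of y] D \<open>s = s0\<close> \<sigma> by (simp add: dist_real_def)
  qed
  moreover have "t \<noteq> s2"
  proof
    assume "t = s2"
    moreover have "0 \<le> l * norm x" using l by simp
    ultimately show False using \<Phi>_le[OF ts(3,2), of x y] \<Phi>w \<sigma> pen[of "norm (x - y)"] g_s2 by auto
  qed
  ultimately have t_in: "s0 < t" "t < s2" and s_in: "s0 < s" "s < s1" using ts ts\<rho> \<rho> by auto
  define p where "p = (1 / e) *\<^sub>R (x - y)"
  define q where "q = (l / sqrt (1 + x \<bullet> x)) *\<^sub>R x"
  \<comment> \<open>The quadratic penalty contributes \<open>p\<close> and
    \<open>(t - s) / e\<close> to both tests; only the subsolution test carries the extra slope
    \<open>q\<close> and the derivative of \<open>g\<close>.\<close>
  have "(t - s) / e + \<sigma> * N * exp (N * (t - tb)) \<le> c * H (p + q)"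
  proof -
    define r where "r = min (t - s0) (s2 - t)"
    have "e \<noteq> 0" using e by simp
    note T = C1_test_penalty[OF this, of y s l \<sigma> N tb]
    show ?thesis unfolding p_def q_def
    proof (rule sub[OF T, of t r x, unfolded prod.case])
      show "t \<in> {s0<..<s1}" "0 < r" using t_in s2 by (auto simp: r_def)
      fix x' t' assume "t' \<in> ball t r"
      then have "t' \<in> {s0..s2}" by (auto simp: r_def dist_real_def)
      from max[OF this ts(2), of x' y]
      show "v (x', t') - (((x' - y) \<bullet> (x' - y) + (t' - s)\<^sup>2) / (2 * e) + l * sqrt (1 + x' \<bullet> x') + \<sigma> * exp (N * (t' - tb)))
        \<le> v (x, t) - (((x - y) \<bullet> (x - y) + (t - s)\<^sup>2) / (2 * e) + l * sqrt (1 + x \<bullet> x) + \<sigma> * exp (N * (t - tb)))"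
        by (simp add: \<Phi>_def g_def)
    qed
  qed
  moreover have "c * H p \<le> (t - s) / e"
  proof -
    define r where "r = min (s - s0) (s1 - s)"
    have "- e \<noteq> 0" using e by simp
    note T = C1_test_penalty[OF this, of x t 0 0 0 0]
    have "c * H ((1 / - e) *\<^sub>R (y - x) + (0 / sqrt (1 + y \<bullet> y)) *\<^sub>R y) \<le> (s - t) / - e + 0 * 0 * exp (0 * (s - 0))"
    proof (rule super[OF T, of s r y, unfolded prod.case])
      show "s \<in> {s0<..<s1}" "0 < r" using s_in by (auto simp: r_def)
      fix y' s' assume "s' \<in> ball s r"
      then have "s' \<in> {s0..s1}" by (auto simp: r_def dist_real_def)
      from max[OF ts(1) this, of x y']
      show "u (y, s) - (((y - x) \<bullet> (y - x) + (s - t)\<^sup>2) / (2 * - e) + 0 * sqrt (1 + y \<bullet> y) + 0 * exp (0 * (s - 0)))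
        \<le> u (y', s') - (((y' - x) \<bullet> (y' - x) + (s' - t)\<^sup>2) / (2 * - e) + 0 * sqrt (1 + y' \<bullet> y') + 0 * exp (0 * (s' - 0)))"
      proof -
        have "(z - x) \<bullet> (z - x) = (x - z) \<bullet> (x - z)" for z :: 'a
          by (simp add: power2_norm_eq_inner[symmetric] norm_minus_commute)
        moreover have "(r - t)\<^sup>2 = (t - r)\<^sup>2" for r by (rule power2_commute)
        moreover have "a / (2 * - e) = - (a / (2 * e))" for a by simp
        ultimately show ?thesis
          using \<open>\<Phi> ((x, t), (y', s')) \<le> \<Phi> ((x, t), (y, s))\<close> unfolding \<Phi>_def prod.case by simp
      qed
    qed
    moreover have "(1 / - e) *\<^sub>R (y - x) = p" by (simp add: p_def scaleR_diff_right)
    moreover have "(s - t) / - e = (t - s) / e" using e by (simp add: field_simps)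
    ultimately show ?thesis by simp
  qed
  moreover have "c * (H (p + q) - H p) < k"
  proof -
    have "norm x / sqrt (1 + x \<bullet> x) \<le> 1" using sq1[of x] by (subst divide_le_eq_1_pos) linarith+
    then have "l * (norm x / sqrt (1 + x \<bullet> x)) \<le> l * 1" using l by (intro mult_left_mono) auto
    moreover have "norm q = l * (norm x / sqrt (1 + x \<bullet> x))"
      using l sq1(1)[of x] by (simp add: q_def)
    ultimately have "norm q \<le> l" by simp
    then have "dist (p + q) p < \<delta>H" using l by (simp add: dist_norm)
    then have "dist (H (p + q)) (H p) < k / (\<bar>c\<bar> + 1)" by (rule \<delta>H)
    then have "\<bar>c\<bar> * \<bar>H (p + q) - H p\<bar> \<le> \<bar>c\<bar> * (k / (\<bar>c\<bar> + 1))"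
      by (intro mult_left_mono) (auto simp: dist_real_def)
    also have "\<dots> < k" using k by (simp add: field_simps)
    finally show ?thesis using abs_ge_self[of "c * (H (p + q) - H p)"] by (simp only: abs_mult)
  qed
  \<comment> \<open>Subtracting the two tests bounds the derivative of \<open>g\<close>, which is at
    least \<open>k\<close>, by \<open>c * (H (p + q) - H p) < k\<close>.\<close>
  ultimately show False using k_le[of t] t_in by (simp add: algebra_simps)
qed

end

section \<open>From one phase to the whole time interval\<close>

lemma uniformly_continuous_restrict:
  fixes f :: "'a::metric_space \<Rightarrow> 'b::metric_space"
  assumes "uniformly_continuous_on S f" "R \<subseteq> S"
  shows "uniformly_continuous_on R f"
  unfolding uniformly_continuous_on_def
proof (intro allI impI)
  fix e :: real assume "e > 0"
  then obtain d where "d > 0" "\<forall>x\<in>S. \<forall>x'\<in>S. dist x' x < d \<longrightarrow> dist (f x') (f x) < e"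
    using assms(1) unfolding uniformly_continuous_on_def by blast
  then show "\<exists>d>0. \<forall>x\<in>R. \<forall>x'\<in>R. dist x' x < d \<longrightarrow> dist (f x') (f x) < e"
    using assms(2) by (intro exI[of _ d]) auto
qed

lemma phase_ex:
  fixes t \<tau> :: real
  assumes "\<tau> > 0" "0 < t" "t \<le> real n * \<tau>"
  obtains j where "j < n" "real j * \<tau> < t" "t \<le> real (Suc j) * \<tau>"
proof (rule that[of "nat (\<lceil>t / \<tau>\<rceil> - 1)"])
  define k where "k = \<lceil>t / \<tau>\<rceil>"
  have k: "of_int k - 1 < t / \<tau>" "t / \<tau> \<le> of_int k" using ceiling_correct[of "t / \<tau>"] by (auto simp: k_def)
  have "t / \<tau> > 0" using assms by simp
  then have "k \<ge> 1" using k by linarith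
  have "t / \<tau> \<le> real n" using assms by (simp add: field_simps)
  then have "k \<le> int n" by (simp add: k_def ceiling_le_iff)
  then show "nat (\<lceil>t / \<tau>\<rceil> - 1) < n" using \<open>k \<ge> 1\<close> unfolding k_def[symmetric] by linarith
  have "real (nat (k - 1)) = of_int k - 1" "real (Suc (nat (k - 1))) = of_int k" using \<open>k \<ge> 1\<close> by auto
  then show "real (nat (\<lceil>t / \<tau>\<rceil> - 1)) * \<tau> < t" "t \<le> real (Suc (nat (\<lceil>t / \<tau>\<rceil> - 1))) * \<tau>"
    using k assms unfolding k_def[symmetric] by (simp_all add: field_simps)
qed

text \<open>Where \<open>F\<close> is a fixed multiple of \<open>H\<close>, the choices
  \<open>b = 0\<close> and \<open>G (t, p) = c * H p\<close> recover the classical definition;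
  \<open>r\<close> shrinks the neighbourhood into the phase.\<close>

lemma visc_sub_phase:
  fixes v :: "'a::euclidean_space \<times> real \<Rightarrow> real"
  assumes v: "visc_sub T F v" and s: "0 \<le> s0" "s1 \<le> T"
    and F: "AE t in lborel. t \<in> {s0<..<s1} \<longrightarrow> (\<forall>p. F t p = c * H p)" and H: "continuous_on UNIV H"
    and \<phi>: "C1_test \<phi> D\<phi> \<phi>t" and t0: "t0 \<in> {s0<..<s1}" and \<delta>: "\<delta> > 0"
    and max: "\<And>x t. x \<in> ball x0 \<delta> \<Longrightarrow> t \<in> ball t0 \<delta> \<Longrightarrow> v (x, t) - \<phi> (x, t) \<le> v (x0, t0) - \<phi> (x0, t0)"
  shows "\<phi>t (x0, t0) \<le> c * H (D\<phi> (x0, t0))"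
proof -
  define r where "r = min \<delta> (min (t0 - s0) (s1 - t0))"
  have r: "r > 0" "r \<le> \<delta>" "ball t0 r \<subseteq> {s0<..<s1}" using t0 \<delta> by (auto simp: r_def dist_real_def)
  define G where "G = (\<lambda>(t::real, p). c * H p)"
  have "\<phi>t (x0, t0) \<le> G (t0, D\<phi> (x0, t0))"
  proof (rule v[unfolded visc_sub_def, rule_format], intro conjI ballI)
    show "C1_test \<phi> D\<phi> \<phi>t" by fact
    show "set_integrable lborel {0..T} (\<lambda>_. 0::real)" by (simp add: set_integrable_def)
    show "t0 \<in> {0<..T}" "0 < r" using t0 s r by auto
    fix x t assume "x \<in> ball x0 r" "t \<in> {0<..T} \<inter> ball t0 r"
    then show "v (x, t) - \<phi> (x, t) - (LBINT s:{0..t}. 0) \<le> v (x0, t0) - \<phi> (x0, t0) - (LBINT s:{0..t0}. 0)"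
      using max[of x t] r by simp
  next
    show "continuous_on (({0<..T} \<inter> ball t0 r) \<times> ball (D\<phi> (x0, t0)) r) G"
      unfolding G_def case_prod_unfold by (intro continuous_intros continuous_on_compose2[OF H]) auto
    show "AE t in lborel. t \<in> {0<..T} \<inter> ball t0 r \<longrightarrow> (\<forall>p\<in>ball (D\<phi> (x0, t0)) r. F t p - 0 \<le> G (t, p))"
      using F by eventually_elim (use r in \<open>auto simp: G_def\<close>)
  qed
  then show ?thesis by (simp add: G_def)
qed

lemma visc_super_phase:
  fixes v :: "'a::euclidean_space \<times> real \<Rightarrow> real"
  assumes v: "visc_super T F v" and s: "0 \<le> s0" "s1 \<le> T"
    and F: "AE t in lborel. t \<in> {s0<..<s1} \<longrightarrow> (\<forall>p. F t p = c * H p)" and H: "continuous_on UNIV H"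
    and \<phi>: "C1_test \<phi> D\<phi> \<phi>t" and t0: "t0 \<in> {s0<..<s1}" and \<delta>: "\<delta> > 0"
    and min: "\<And>x t. x \<in> ball x0 \<delta> \<Longrightarrow> t \<in> ball t0 \<delta> \<Longrightarrow> v (x0, t0) - \<phi> (x0, t0) \<le> v (x, t) - \<phi> (x, t)"
  shows "c * H (D\<phi> (x0, t0)) \<le> \<phi>t (x0, t0)"
proof -
  define r where "r = min \<delta> (min (t0 - s0) (s1 - t0))"
  have r: "r > 0" "r \<le> \<delta>" "ball t0 r \<subseteq> {s0<..<s1}" using t0 \<delta> by (auto simp: r_def dist_real_def)
  define G where "G = (\<lambda>(t::real, p). c * H p)"
  have "\<phi>t (x0, t0) \<ge> G (t0, D\<phi> (x0, t0))"
  proof (rule v[unfolded visc_super_def, rule_format], intro conjI ballI)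
    show "C1_test \<phi> D\<phi> \<phi>t" by fact
    show "set_integrable lborel {0..T} (\<lambda>_. 0::real)" by (simp add: set_integrable_def)
    show "t0 \<in> {0<..T}" "0 < r" using t0 s r by auto
    fix x t assume "x \<in> ball x0 r" "t \<in> {0<..T} \<inter> ball t0 r"
    then show "v (x, t) - \<phi> (x, t) - (LBINT s:{0..t}. 0) \<ge> v (x0, t0) - \<phi> (x0, t0) - (LBINT s:{0..t0}. 0)"
      using min[of x t] r by simp
  next
    show "continuous_on (({0<..T} \<inter> ball t0 r) \<times> ball (D\<phi> (x0, t0)) r) G"
      unfolding G_def case_prod_unfold by (intro continuous_intros continuous_on_compose2[OF H]) auto
    show "AE t in lborel. t \<in> {0<..T} \<inter> ball t0 r \<longrightarrow> (\<forall>p\<in>ball (D\<phi> (x0, t0)) r. F t p - 0 \<ge> G (t, p))"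
      using F by eventually_elim (use r in \<open>auto simp: G_def\<close>)
  qed
  then show ?thesis by (simp add: G_def)
qed

context hamiltonian
begin

text \<open>Interior comparison omits the final time, which is recovered by continuity: the value
  there is the initial datum of the next phase.\<close>

lemma visc_comparison_phase:
  fixes v u :: "'a \<times> real \<Rightarrow> real"
  assumes v: "visc_sub T F v" "uniformly_continuous_on (UNIV \<times> {0..T}) v"
    and u: "visc_super T F u" "uniformly_continuous_on (UNIV \<times> {0..T}) u"
    and s: "0 \<le> s0" "s0 < s1" "s1 \<le> T"
    and F: "AE t in lborel. t \<in> {s0<..<s1} \<longrightarrow> (\<forall>p. F t p = c * H p)"
    and init: "\<And>x. v (x, s0) \<le> u (x, s0)"
    and t: "t \<in> {s0..s1}"
  shows "v (x, t) \<le> u (x, t)"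
proof -
  have vc: "uniformly_continuous_on (UNIV \<times> {s0..s1}) v" and uc: "uniformly_continuous_on (UNIV \<times> {s0..s1}) u"
    using s by (auto intro: uniformly_continuous_restrict[OF v(2)] uniformly_continuous_restrict[OF u(2)])
  have int: "v (x, t) \<le> u (x, t)" if "t \<in> {s0<..<s1}" for t
  proof (rule comparison_interior[OF vc uc _ _ init that])
    show "\<phi>t (x0, t0) \<le> c * H (D\<phi> (x0, t0))"
      if "C1_test \<phi> D\<phi> \<phi>t" "t0 \<in> {s0<..<s1}" "\<delta> > 0"
        "\<And>x t. x \<in> ball x0 \<delta> \<Longrightarrow> t \<in> ball t0 \<delta> \<Longrightarrow> v (x, t) - \<phi> (x, t) \<le> v (x0, t0) - \<phi> (x0, t0)"
      for \<phi> D\<phi> \<phi>t x0 t0 \<delta>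
      using visc_sub_phase[OF v(1) s(1,3) F H_continuous that] .
    show "c * H (D\<phi> (x0, t0)) \<le> \<phi>t (x0, t0)"
      if "C1_test \<phi> D\<phi> \<phi>t" "t0 \<in> {s0<..<s1}" "\<delta> > 0"
        "\<And>x t. x \<in> ball x0 \<delta> \<Longrightarrow> t \<in> ball t0 \<delta> \<Longrightarrow> u (x0, t0) - \<phi> (x0, t0) \<le> u (x, t) - \<phi> (x, t)"
      for \<phi> D\<phi> \<phi>t x0 t0 \<delta>
      using visc_super_phase[OF u(1) s(1,3) F H_continuous that] .
  qed
  have cl: "closure {s0<..<s1} = {s0..s1}" using s by simp
  have "continuous_on {s0..s1} (\<lambda>t. v (x, t) - u (x, t))"
    by (intro continuous_intros continuous_on_compose2[OF uniformly_continuous_imp_continuous[OF vc]]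
        continuous_on_compose2[OF uniformly_continuous_imp_continuous[OF uc]]) auto
  then have cont: "continuous_on (closure {s0<..<s1}) (\<lambda>t. v (x, t) - u (x, t))" unfolding cl .
  have "v (x, t) - u (x, t) \<le> 0"
  proof (rule continuous_le_on_closure[OF cont])
    show "t \<in> closure {s0<..<s1}" unfolding cl by (rule t)
    show "v (x, r) - u (x, r) \<le> 0" if "r \<in> {s0<..<s1}" for r using int[OF that] by simp
  qed
  then show ?thesis by simp
qed

text \<open>Agreement up to the end of one phase is the initial condition for comparison, in both
  directions, on the next.\<close>

lemma visc_sol_unique:
  fixes v u :: "'a \<times> real \<Rightarrow> real"
  assumes \<tau>: "\<tau> > 0" and T: "T = real n * \<tau>"
    and F: "\<And>j. j < n \<Longrightarrow> AE t in lborel. t \<in> {real j * \<tau><..<real (Suc j) * \<tau>} \<longrightarrow> (\<forall>p. F t p = c j * H p)"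
    and v: "visc_sol T F f v" and u: "visc_sol T F f u" and t: "t \<in> {0..T}"
  shows "v (x, t) = u (x, t)"
proof -
  have "\<forall>x. \<forall>t\<in>{0..real j * \<tau>}. v (x, t) = u (x, t)" if "j \<le> n" for j
    using that
  proof (induction j)
    case 0
    then show ?case using u v by (simp add: visc_sol_def)
  next
    case (Suc j)
    then have IH: "v (x, t) = u (x, t)" if "t \<in> {0..real j * \<tau>}" for x t using that by simp
    have s: "0 \<le> real j * \<tau>" "real j * \<tau> < real (Suc j) * \<tau>" "real (Suc j) * \<tau> \<le> T"
      unfolding T using Suc.prems \<tau> by (auto intro!: mult_right_mono)
    have Fj: "AE t in lborel. t \<in> {real j * \<tau><..<real (Suc j) * \<tau>} \<longrightarrow> (\<forall>p. F t p = c j * H p)"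
      using Suc.prems by (intro F) auto
    show ?case
    proof (intro allI ballI)
      fix x t assume t: "t \<in> {0..real (Suc j) * \<tau>}"
      show "v (x, t) = u (x, t)"
      proof (cases "t \<le> real j * \<tau>")
        case False
        then have tj: "t \<in> {real j * \<tau>..real (Suc j) * \<tau>}" using t by auto
        have init: "v (y, real j * \<tau>) = u (y, real j * \<tau>)" for y using s by (intro IH) auto
        have vs: "visc_sub T F v" "uniformly_continuous_on (UNIV \<times> {0..T}) v" "visc_super T F v"
          and us: "visc_sub T F u" "uniformly_continuous_on (UNIV \<times> {0..T}) u" "visc_super T F u"
          using v u unfolding visc_sol_def by blast+
        show ?thesis
        proof (rule antisym)
          show "v (x, t) \<le> u (x, t)"
            by (rule visc_comparison_phase[OF vs(1,2) us(3,2) s Fj _ tj]) (simp add: init)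
          show "u (x, t) \<le> v (x, t)"
            by (rule visc_comparison_phase[OF us(1,2) vs(3,2) s Fj _ tj]) (simp add: init)
        qed
      qed (use IH t in auto)
    qed
  qed
  from this[of n] show ?thesis using t T by auto
qed

section \<open>The explicit solution along a piecewise linear path\<close>

primrec hopf_steps :: "real \<Rightarrow> (nat \<Rightarrow> real) \<Rightarrow> ('a \<Rightarrow> real) \<Rightarrow> nat \<Rightarrow> 'a \<Rightarrow> real" where
  "hopf_steps \<tau> c f 0 = f"
| "hopf_steps \<tau> c f (Suc j) = hopf H (hopf_steps \<tau> c f j) (c j * \<tau>)"

definition hopf_sol :: "real \<Rightarrow> (nat \<Rightarrow> real) \<Rightarrow> ('a \<Rightarrow> real) \<Rightarrow> 'a \<times> real \<Rightarrow> real" where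
  "hopf_sol \<tau> c f = (\<lambda>(x, t). let j = nat \<lfloor>t / \<tau>\<rfloor> in hopf H (hopf_steps \<tau> c f j) (c j * (t - real j * \<tau>)) x)"

lemma hopf_steps_supported: "supported f \<Longrightarrow> supported (hopf_steps \<tau> c f j)"
  by (induction j) (auto intro: hopf_supported)

text \<open>At the right end the floor already selects the next phase; the path increment there is
  \<open>0\<close>, and \<open>hopf_0\<close> returns the common value. Phases are glued at these
  closed ends.\<close>

lemma hopf_sol_phase:
  assumes f: "supported f" and \<tau>: "\<tau> > 0" and t: "t \<in> {real j * \<tau>..real (Suc j) * \<tau>}"
  shows "hopf_sol \<tau> c f (x, t) = hopf H (hopf_steps \<tau> c f j) (c j * (t - real j * \<tau>)) x"
proof (cases "t = real (Suc j) * \<tau>")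
  case True
  then have "t / \<tau> = real (Suc j)" using \<tau> by simp
  then have "nat \<lfloor>t / \<tau>\<rfloor> = Suc j" by (metis floor_of_nat nat_int)
  then show ?thesis using True by (simp add: hopf_sol_def hopf_0 hopf_steps_supported[OF f] hopf_supported algebra_simps)
next
  case False
  then have "real j \<le> t / \<tau>" "t / \<tau> < real j + 1" using \<tau> t by (auto simp: field_simps)
  then have "\<lfloor>t / \<tau>\<rfloor> = int j" by (intro floor_unique) auto
  then show ?thesis by (simp add: hopf_sol_def)
qed

lemma hopf_sol_0: "supported f \<Longrightarrow> \<tau> > 0 \<Longrightarrow> hopf_sol \<tau> c f (x, 0) = f x"
  by (simp add: hopf_sol_def hopf_0)

lemma hopf_sol_uniformly_continuous:
  assumes f: "supported f" and \<tau>: "\<tau> > 0" and n: "n > 0"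
  shows "uniformly_continuous_on (UNIV \<times> {0..real n * \<tau>}) (hopf_sol \<tau> c f)"
proof -
  define M where "M = (\<Sum>j<n. \<bar>c j\<bar>)"
  have M: "M \<ge> 0" by (simp add: M_def sum_nonneg)
  have time: "M-lipschitz_on {0..real n * \<tau>} (\<lambda>t. hopf_sol \<tau> c f (x, t))" for x
  proof (rule lipschitz_on_closed_Union[where I = "{..<n}" and U = "\<lambda>j. {real j * \<tau>..real (Suc j) * \<tau>}"])
    fix j assume j: "j \<in> {..<n}"
    have "\<bar>c j\<bar> \<le> M" unfolding M_def using j by (intro member_le_sum) auto
    show "M-lipschitz_on {real j * \<tau>..real (Suc j) * \<tau>} (\<lambda>t. hopf_sol \<tau> c f (x, t))"
    proof (rule lipschitz_onI[OF _ M])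
      fix t s assume ts: "t \<in> {real j * \<tau>..real (Suc j) * \<tau>}" "s \<in> {real j * \<tau>..real (Suc j) * \<tau>}"
      have "\<bar>hopf_sol \<tau> c f (x, t) - hopf_sol \<tau> c f (x, s)\<bar> \<le> \<bar>c j * (t - real j * \<tau>) - c j * (s - real j * \<tau>)\<bar>"
        unfolding hopf_sol_phase[OF f \<tau> ts(1)] hopf_sol_phase[OF f \<tau> ts(2)]
        by (rule hopf_lipschitz_time[OF hopf_steps_supported[OF f]])
      also have "\<dots> = \<bar>c j\<bar> * \<bar>t - s\<bar>" by (simp add: right_diff_distrib[symmetric] abs_mult)
      also have "\<dots> \<le> M * \<bar>t - s\<bar>" using \<open>\<bar>c j\<bar> \<le> M\<close> by (intro mult_right_mono) auto
      finally show "dist (hopf_sol \<tau> c f (x, t)) (hopf_sol \<tau> c f (x, s)) \<le> M * dist t s" by (simp add: dist_real_def)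
    qed
  next
    show "{0..real n * \<tau>} \<subseteq> (\<Union>j\<in>{..<n}. {real j * \<tau>..real (Suc j) * \<tau>})"
    proof
      fix t assume t: "t \<in> {0..real n * \<tau>}"
      show "t \<in> (\<Union>j\<in>{..<n}. {real j * \<tau>..real (Suc j) * \<tau>})"
      proof (cases "t = 0")
        case True
        then show ?thesis using n \<tau> by (auto intro!: bexI[of _ 0])
      next
        case False
        with t \<tau> obtain j where "j < n" "real j * \<tau> < t" "t \<le> real (Suc j) * \<tau>"
          by (auto elim: phase_ex[of \<tau> t n])
        then show ?thesis by (intro UN_I[of j]) auto
      qed
    qed
  qed (use M in auto)
  have space: "\<bar>hopf_sol \<tau> c f (x, t) - hopf_sol \<tau> c f (y, t)\<bar> \<le> norm (x - y)" for x y t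
    unfolding hopf_sol_def prod.case Let_def
    by (intro supported_lipschitz hopf_supported hopf_steps_supported f)
  have "(1 + M)-lipschitz_on (UNIV \<times> {0..real n * \<tau>}) (hopf_sol \<tau> c f)"
  proof (rule lipschitz_onI)
    fix z w :: "'a \<times> real" assume zw: "z \<in> UNIV \<times> {0..real n * \<tau>}" "w \<in> UNIV \<times> {0..real n * \<tau>}"
    obtain x t y s where eq: "z = (x, t)" "w = (y, s)" by (metis surj_pair)
    have "dist (hopf_sol \<tau> c f (x, t)) (hopf_sol \<tau> c f (y, s)) \<le>
      dist (hopf_sol \<tau> c f (x, t)) (hopf_sol \<tau> c f (y, t)) + dist (hopf_sol \<tau> c f (y, t)) (hopf_sol \<tau> c f (y, s))"
      by (rule dist_triangle)
    also have "\<dots> \<le> dist x y + M * dist t s"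
      using space[of x t y] lipschitz_onD[OF time[of y]] zw eq by (intro add_mono) (auto simp: dist_norm)
    also have "\<dots> \<le> dist z w + M * dist z w"
      using M dist_fst_le[of z w] dist_snd_le[of z w] by (intro add_mono mult_left_mono) (auto simp: eq)
    finally show "dist (hopf_sol \<tau> c f z) (hopf_sol \<tau> c f w) \<le> (1 + M) * dist z w"
      by (simp add: eq algebra_simps)
  qed (use M in simp)
  then show ?thesis by (rule lipschitz_on_uniformly_continuous)
qed

text \<open>Every \<open>t0 > 0\<close> is assigned to a half-open phase that contains its right
  end, so breakpoints need no separate argument.\<close>

lemma hopf_sol_visc_sol:
  assumes f: "supported f" and \<tau>: "\<tau> > 0" and n: "n > 0" and T: "T = real n * \<tau>"
    and F: "\<And>j. j < n \<Longrightarrow> AE t in lborel. t \<in> {real j * \<tau><..<real (Suc j) * \<tau>} \<longrightarrow> (\<forall>p. F t p = c j * H p)"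
  shows "visc_sol T F f (hopf_sol \<tau> c f)"
proof -
  have ph: "hopf_sol \<tau> c f (x, t) = hopf H (hopf_steps \<tau> c f j) (c j * (t - real j * \<tau>)) x"
    if "t0 \<le> real (Suc j) * \<tau>" "t \<in> {real j * \<tau>..t0}" for j x t t0
    using that by (intro hopf_sol_phase[OF f \<tau>]) auto
  have Fj: "AE t in lborel. t \<in> {real j * \<tau><..<t0} \<longrightarrow> (\<forall>p. F t p = c j * H p)"
    if "j < n" "t0 \<le> real (Suc j) * \<tau>" for j t0
    using F[OF that(1)] by eventually_elim (use that(2) in auto)
  have phase: "\<exists>j<n. 0 \<le> real j * \<tau> \<and> real j * \<tau> < t0 \<and> t0 \<le> real (Suc j) * \<tau>" if "t0 \<in> {0<..T}" for t0
    using phase_ex[of \<tau> t0 n] that \<tau> T by (metis greaterThanAtMost_iff mult_nonneg_nonneg of_nat_0_le_iff less_imp_le)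
  have "visc_sub T F (hopf_sol \<tau> c f)"
    unfolding visc_sub_def
  proof (intro allI impI, elim conjE)
    fix \<phi> D\<phi> \<phi>t b G x0 t0 \<delta>
    assume *: "C1_test \<phi> D\<phi> \<phi>t" "set_integrable lborel {0..T} b" "t0 \<in> {0<..T}" "\<delta> > 0"
      "\<forall>x\<in>ball x0 \<delta>. \<forall>t\<in>{0<..T} \<inter> ball t0 \<delta>.
         hopf_sol \<tau> c f (x, t) - \<phi> (x, t) - (LBINT s:{0..t}. b s) \<le> hopf_sol \<tau> c f (x0, t0) - \<phi> (x0, t0) - (LBINT s:{0..t0}. b s)"
      "continuous_on (({0<..T} \<inter> ball t0 \<delta>) \<times> ball (D\<phi> (x0, t0)) \<delta>) G"
      "AE t in lborel. t \<in> {0<..T} \<inter> ball t0 \<delta> \<longrightarrow> (\<forall>p\<in>ball (D\<phi> (x0, t0)) \<delta>. F t p - b t \<le> G (t, p))"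
    obtain j where j: "j < n" "0 \<le> real j * \<tau>" "real j * \<tau> < t0" "t0 \<le> real (Suc j) * \<tau>"
      using phase[OF *(3)] by blast
    show "\<phi>t (x0, t0) \<le> G (t0, D\<phi> (x0, t0))"
      using *(3) *(5)
      by (intro hopf_visc_sub_at[OF hopf_steps_supported[OF f] j(2,3) _ ph[OF j(4)] *(1,2,4) _ *(6,7) Fj[OF j(1,4)]]) auto
  qed
  moreover have "visc_super T F (hopf_sol \<tau> c f)"
    unfolding visc_super_def
  proof (intro allI impI, elim conjE)
    fix \<phi> D\<phi> \<phi>t b G x0 t0 \<delta>
    assume *: "C1_test \<phi> D\<phi> \<phi>t" "set_integrable lborel {0..T} b" "t0 \<in> {0<..T}" "\<delta> > 0"
      "\<forall>x\<in>ball x0 \<delta>. \<forall>t\<in>{0<..T} \<inter> ball t0 \<delta>.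
         hopf_sol \<tau> c f (x0, t0) - \<phi> (x0, t0) - (LBINT s:{0..t0}. b s) \<le> hopf_sol \<tau> c f (x, t) - \<phi> (x, t) - (LBINT s:{0..t}. b s)"
      "continuous_on (({0<..T} \<inter> ball t0 \<delta>) \<times> ball (D\<phi> (x0, t0)) \<delta>) G"
      "AE t in lborel. t \<in> {0<..T} \<inter> ball t0 \<delta> \<longrightarrow> (\<forall>p\<in>ball (D\<phi> (x0, t0)) \<delta>. G (t, p) \<le> F t p - b t)"
    obtain j where j: "j < n" "0 \<le> real j * \<tau>" "real j * \<tau> < t0" "t0 \<le> real (Suc j) * \<tau>"
      using phase[OF *(3)] by blast
    show "G (t0, D\<phi> (x0, t0)) \<le> \<phi>t (x0, t0)"
      using *(3) *(5)
      by (intro hopf_visc_super_at[OF hopf_steps_supported[OF f] j(2,3) _ ph[OF j(4)] *(1,2,4) _ *(6,7) Fj[OF j(1,4)]]) auto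
  qed
  ultimately show ?thesis
    unfolding visc_sol_def T using hopf_sol_0[OF f \<tau>] hopf_sol_uniformly_continuous[OF f \<tau> n] by auto
qed

text \<open>The Hopf solution shows that the choice in \<open>HJ_sol\<close> is made among
  solutions, and uniqueness identifies the chosen one on \<open>[0,T]\<close>.\<close>

lemma HJ_sol_eq_hopf_sol:
  assumes f: "supported f" and \<tau>: "\<tau> > 0" and n: "n > 0" and T: "T = real n * \<tau>"
    and W: "\<And>j. j < n \<Longrightarrow> AE t in lborel. t \<in> {real j * \<tau><..<real (Suc j) * \<tau>} \<longrightarrow> weak_deriv T W t = c j"
    and t: "t \<in> {0..T}"
  shows "HJ_sol T f H W (x, t) = hopf_sol \<tau> c f (x, t)"
proof -
  define F where "F = (\<lambda>t p. H p * weak_deriv T W t)"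
  have F: "AE t in lborel. t \<in> {real j * \<tau><..<real (Suc j) * \<tau>} \<longrightarrow> (\<forall>p. F t p = c j * H p)" if "j < n" for j
    using W[OF that] by eventually_elim (auto simp: F_def)
  have sol: "visc_sol T F f (hopf_sol \<tau> c f)" by (rule hopf_sol_visc_sol[OF f \<tau> n T F])
  then have "visc_sol T F f (HJ_sol T f H W)"
    using someI[of "visc_sol T F f"] by (simp add: HJ_sol_def F_def)
  then show ?thesis using visc_sol_unique[OF \<tau> T F _ sol t] by blast
qed

end

section \<open>Weak derivatives and zigzag paths\<close>

text \<open>The positive and negative parts of \<open>d\<close> are densities of two measures with
  equal finite values on half-lines, hence of equal measures, and so they agree almost everywhere.
  At each point one of the parts vanishes, hence both do.\<close>

lemma AE_zero_if_tail_integrals_zero: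
  fixes d :: "real \<Rightarrow> real"
  assumes d: "integrable lborel d" and zero: "\<And>x. (LBINT s:{x<..}. d s) = 0"
  shows "AE t in lborel. d t = 0"
proof -
  define p where "p t = max 0 (d t)" for t
  define m where "m t = max 0 (- d t)" for t
  have [measurable]: "d \<in> borel_measurable borel" using d by (simp add: borel_measurable_integrable)
  have int: "integrable lborel p" "integrable lborel m"
    unfolding p_def m_def using d by (auto intro: integrable_max)
  have nn: "(\<integral>\<^sup>+ t. ennreal (f t) * indicator {x<..} t \<partial>lborel) = ennreal (LBINT s:{x<..}. f s)"
    if "integrable lborel f" "\<And>t. 0 \<le> f t" for f :: "real \<Rightarrow> real" and x
  proof -
    have "integrable lborel (\<lambda>t. indicator {x<..} t *\<^sub>R f t)"
      using that(1) by (intro integrable_mult_indicator) auto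
    then have "(\<integral>\<^sup>+ t. ennreal (indicator {x<..} t *\<^sub>R f t) \<partial>lborel) = ennreal (LBINT s:{x<..}. f s)"
      using that(2) unfolding set_lebesgue_integral_def by (intro nn_integral_eq_integral) auto
    moreover have "ennreal (indicator {x<..} t *\<^sub>R f t) = ennreal (f t) * indicator {x<..} t" for t
      by (auto simp: indicator_def)
    ultimately show ?thesis by simp
  qed
  have eq: "(LBINT s:{x<..}. p s) = (LBINT s:{x<..}. m s)" for x
  proof -
    have si: "set_integrable lborel {x<..} p" "set_integrable lborel {x<..} m"
      using integrable_mult_indicator[OF _ int(1), of "{x<..}"] integrable_mult_indicator[OF _ int(2), of "{x<..}"]
      unfolding set_integrable_def by simp_all
    have "(LBINT s:{x<..}. p s) - (LBINT s:{x<..}. m s) = (LBINT s:{x<..}. p s - m s)"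
      by (rule set_integral_diff(2)[OF si, symmetric])
    also have "(\<lambda>s. p s - m s) = d" by (auto simp: p_def m_def fun_eq_iff)
    finally show ?thesis using zero[of x] by simp
  qed
  have "density lborel p = density lborel m"
  proof (rule measure_eqI_lessThan)
    have mp: "p \<in> borel_measurable lborel" "m \<in> borel_measurable lborel" unfolding p_def m_def by measurable
    fix x
    have e: "emeasure (density lborel p) {x<..} = ennreal (LBINT s:{x<..}. p s)"
      "emeasure (density lborel m) {x<..} = ennreal (LBINT s:{x<..}. m s)"
      using mp nn[OF int(1), of x] nn[OF int(2), of x] by (simp_all add: emeasure_density p_def m_def)
    show "emeasure (density lborel p) {x<..} < \<infinity>" unfolding e by simp
    show "emeasure (density lborel p) {x<..} = emeasure (density lborel m) {x<..}" unfolding e eq by simp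
  qed auto
  then have "AE t in lborel. ennreal (p t) = ennreal (m t)"
    by (intro sigma_finite_measure.density_unique[OF sigma_finite_lborel]) (auto simp: p_def m_def)
  then show ?thesis by eventually_elim (auto simp: p_def m_def max_def split: if_splits)
qed

lemma has_weak_deriv_unique:
  assumes T: "T \<ge> 0" and w: "has_weak_deriv T W w" and w': "has_weak_deriv T W w'"
  shows "AE t in lborel. t \<in> {0..T} \<longrightarrow> w t = w' t"
proof -
  define d where "d t = indicator {0..T} t *\<^sub>R (w t - w' t)" for t
  have int: "set_integrable lborel {0..T} w" "set_integrable lborel {0..T} w'"
    using w w' unfolding has_weak_deriv_def by blast+
  have intd: "integrable lborel d"
    using set_integral_diff(1)[OF int] by (simp only: set_integrable_def d_def[abs_def])
  have upto: "(LBINT s:{0..t}. d s) = 0" if "t \<in> {0..T}" for t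
  proof -
    have "(LBINT s:{0..t}. d s) = (LBINT s:{0..t}. w s - w' s)"
      using that by (intro set_lebesgue_integral_cong) (auto simp: d_def)
    also have "\<dots> = (LBINT s:{0..t}. w s) - (LBINT s:{0..t}. w' s)"
      using that by (intro set_integral_diff(2) set_integrable_subset[OF int(1)] set_integrable_subset[OF int(2)]) auto
    also have "\<dots> = 0"
    proof -
      have "W t = W 0 + (LBINT s:{0..t}. w s)" "W t = W 0 + (LBINT s:{0..t}. w' s)"
        using w w' that unfolding has_weak_deriv_def by blast+
      then show ?thesis by linarith
    qed
    finally show ?thesis .
  qed
  have tail: "(LBINT s:{x<..}. d s) = 0" for x
  proof -
    \<comment> \<open>\<open>x\<close> clamped to \<open>[0,T]\<close>: as \<open>d\<close> vanishes
      outside, the tail beyond \<open>x\<close> is the tail beyond \<open>y\<close>, except possibly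
      for the null set consisting of the point \<open>0\<close>.\<close>
    define y where "y = min (max x 0) T"
    have si: "set_integrable lborel A d" if "A \<in> sets borel" for A
      using intd that unfolding set_integrable_def by (intro integrable_mult_indicator) auto
    have "(LBINT s:{0..T}. d s) = (LBINT s:{0..y} \<union> {y<..T}. d s)"
      using T by (intro arg_cong[where f="\<lambda>A. LBINT s:A. d s"]) (auto simp: y_def)
    also have "\<dots> = (LBINT s:{0..y}. d s) + (LBINT s:{y<..T}. d s)"
      by (intro set_integral_Un si) auto
    finally have "(LBINT s:{y<..T}. d s) = 0" using upto[of T] upto[of y] T by (simp add: y_def)
    moreover have "(LBINT s:{x<..}. d s) = (LBINT s:{y<..T}. d s)"
    proof -
      have "AE s in lborel. s \<noteq> 0" by (rule AE_lborel_singleton)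
      then have "AE s in lborel. indicator {x<..} s *\<^sub>R d s = indicator {y<..T} s *\<^sub>R d s"
        by eventually_elim (auto simp: d_def y_def indicator_def)
      then show ?thesis unfolding set_lebesgue_integral_def
        using intd by (intro integral_cong_AE) auto
    qed
    ultimately show ?thesis by simp
  qed
  from AE_zero_if_tail_integrals_zero[OF intd tail] show ?thesis
    by eventually_elim (auto simp: d_def)
qed

lemma weak_deriv_AE:
  assumes "T \<ge> 0" "has_weak_deriv T W w"
  shows "has_weak_deriv T W (weak_deriv T W)" "AE t in lborel. t \<in> {0..T} \<longrightarrow> weak_deriv T W t = w t"
proof -
  show *: "has_weak_deriv T W (weak_deriv T W)" 
    using someI[of "has_weak_deriv T W", OF assms(2)] by (simp add: weak_deriv_def)
  show "AE t in lborel. t \<in> {0..T} \<longrightarrow> weak_deriv T W t = w t" by (rule has_weak_deriv_unique[OF assms(1) * assms(2)])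
qed

lemma LBINT_singleton: "(LBINT t:{a..a}. f t) = (0::real)" for a :: real
proof -
  have "AE t in lborel. t \<noteq> a" by (rule AE_lborel_singleton)
  then have "AE t in lborel. indicator {a..a} t *\<^sub>R f t = 0" by eventually_elim auto
  then show ?thesis unfolding set_lebesgue_integral_def by (rule integral_eq_zero_AE)
qed

lemma W11_norm_le:
  assumes T: "T \<ge> 0" and w: "has_weak_deriv T W w" and le: "\<And>t. t \<in> {0..T} \<Longrightarrow> \<bar>w t\<bar> \<le> C"
  shows "snd (W11_space T) W \<le> C * T"
proof -
  have int: "set_integrable lborel {0..T} (\<lambda>t. \<bar>weak_deriv T W t\<bar>)"
    using weak_deriv_AE(1)[OF T w] unfolding has_weak_deriv_def by (blast intro: set_integrable_abs)
  have "AE t in lborel. t \<in> {0<..<T} \<longrightarrow> \<bar>weak_deriv T W t\<bar> \<le> C"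
    using weak_deriv_AE(2)[OF T w] by eventually_elim (use le in auto)
  from set_integral_increment_le[OF int _ T _ this] 
  have "(LBINT t:{0..T}. \<bar>weak_deriv T W t\<bar>) - (LBINT t:{0..0}. \<bar>weak_deriv T W t\<bar>) \<le> C * (T - 0)" by simp
  then show ?thesis by (simp only: W11_space_def snd_conv LBINT_singleton diff_zero)
qed

text \<open>The two trivial decompositions give \<open>K \<le> B * min 1 (t * s)\<close>, and
  \<open>t powr (-\<alpha>) * min 1 (t * s) \<le> s powr \<alpha>\<close>, with the switch at
  \<open>t = 1 / s\<close>.\<close>

lemma path_norm_le:
  assumes T: "T \<ge> 0" and \<alpha>: "0 < \<alpha>" "\<alpha> < 1" and s: "s > 0"
    and W: "W \<in> fst (C0_space T)" "\<And>t. t \<in> {0..T} \<Longrightarrow> \<bar>W t\<bar> \<le> B"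
    and w: "has_weak_deriv T W w" and le: "snd (W11_space T) W \<le> s * B"
  shows "path_norm T \<alpha> W \<le> ennreal (B * s powr \<alpha>)"
proof -
  have ne: "{0..T} \<noteq> {}" using T by auto
  have B: "B \<ge> 0" using W(2)[of 0] T by simp
  have C0_nonneg: "0 \<le> snd (C0_space T) y" if "y \<in> fst (C0_space T)" for y
  proof -
    have "compact (y ` {0..T})" using that by (intro compact_continuous_image) (auto simp: C0_space_def)
    then show ?thesis using ne by (auto simp: C0_space_def intro!: sup_norm_nonneg compact_imp_bounded)
  qed
  have W11_nonneg: "0 \<le> snd (W11_space T) y" for y
    by (auto simp: W11_space_def set_lebesgue_integral_def intro!: Bochner_Integration.integral_nonneg)
  have zero: "has_weak_deriv T 0 (\<lambda>_. 0)"
    by (auto simp: has_weak_deriv_def set_integrable_def set_lebesgue_integral_def)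
  have zero_in: "0 \<in> fst (C0_space T)" "0 \<in> fst (W11_space T)"
    using zero by (auto simp: C0_space_def W11_space_def zero_fun_def)
  have "snd (W11_space T) 0 \<le> 0 * T" by (rule W11_norm_le[OF T zero]) simp
  then have zero_W: "snd (W11_space T) 0 \<le> 0" by simp
  have zero_C: "snd (C0_space T) 0 \<le> 0" unfolding C0_space_def snd_conv by (rule sup_norm_le[OF ne]) simp
  have W11: "W \<in> fst (W11_space T)" using W(1) w by (auto simp: W11_space_def C0_space_def)
  have W_C: "snd (C0_space T) W \<le> B" unfolding C0_space_def snd_conv by (rule sup_norm_le[OF ne W(2)])
  have "t powr (-\<alpha>) * K_functional t W (C0_space T) (W11_space T) \<le> B * s powr \<alpha>" if t: "t > 0" for t
  proof (cases "t * s \<ge> 1")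
    case True
    have "K_functional t W (C0_space T) (W11_space T) \<le> snd (C0_space T) W + t * snd (W11_space T) 0"
      using t by (intro K_functional_le W zero_in C0_nonneg W11_nonneg) auto
    also have "\<dots> \<le> B + t * 0" using W_C zero_W t by (intro add_mono mult_left_mono) auto
    finally have "t powr (-\<alpha>) * K_functional t W (C0_space T) (W11_space T) \<le> t powr (-\<alpha>) * B"
      by (intro mult_left_mono) auto
    also have "\<dots> \<le> B * s powr \<alpha>"
    proof -
      have "1 \<le> (t * s) powr \<alpha>" using True \<alpha> by (intro ge_one_powr_ge_zero) auto
      then have "t powr (-\<alpha>) \<le> s powr \<alpha>" using t s by (simp add: powr_mult powr_minus field_simps)
      then show ?thesis using B by (simp add: mult.commute mult_left_mono)
    qed
    finally show ?thesis .
  next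
    case False
    have "K_functional t W (C0_space T) (W11_space T) \<le> snd (C0_space T) 0 + t * snd (W11_space T) W"
      using t W11 by (intro K_functional_le zero_in C0_nonneg W11_nonneg) auto
    also have "\<dots> \<le> 0 + t * (s * B)" using le zero_C t by (intro add_mono mult_left_mono) auto
    finally have "t powr (-\<alpha>) * K_functional t W (C0_space T) (W11_space T) \<le> t powr (-\<alpha>) * (t * (s * B))"
      by (intro mult_left_mono) auto
    also have "\<dots> = B * ((t * s) powr (1 - \<alpha>) * s powr \<alpha>)"
      using t s by (simp add: powr_mult powr_diff powr_minus field_simps)
    also have "\<dots> \<le> B * (1 * s powr \<alpha>)"
      using False t s \<alpha> B by (intro mult_left_mono mult_right_mono powr_le1) auto
    finally show ?thesis by simp
  qed
  then show ?thesis unfolding path_norm_def interp_norm_def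
    by (auto intro!: SUP_least ennreal_leI)
qed

section \<open>Zigzag paths\<close>

definition zigzag_slope :: "real \<Rightarrow> (nat \<Rightarrow> real) \<Rightarrow> nat \<Rightarrow> real" where
  "zigzag_slope \<tau> b j = (if even j then b (j div 2) else - b (j div 2)) / \<tau>"

text \<open>Tooth \<open>k\<close> consists of phase \<open>2 * k\<close> (up) and phase
  \<open>2 * k + 1\<close> (down). The integral form makes the weak derivative known by
  construction; the value \<open>0\<close> outside \<open>[0,T]\<close> is the convention of the
  path spaces.\<close>

definition zigzag :: "real \<Rightarrow> real \<Rightarrow> (nat \<Rightarrow> real) \<Rightarrow> real \<Rightarrow> real" where
  "zigzag T \<tau> b t = (if t \<in> {0..T} then LBINT s:{0..t}. zigzag_slope \<tau> b (nat \<lfloor>s / \<tau>\<rfloor>) else 0)"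

context
  fixes T \<tau> B :: real and N :: nat and b :: "nat \<Rightarrow> real"
  assumes \<tau>: "\<tau> > 0" and N: "N > 0" and T: "T = real (2 * N) * \<tau>" and b: "\<And>k. 0 \<le> b k" "\<And>k. b k \<le> B"
begin

lemma zigzag_horizon_pos: "T > 0"
  using \<tau> N T by simp

lemma abs_zigzag_slope: "\<bar>zigzag_slope \<tau> b j\<bar> \<le> B / \<tau>"
  using \<tau> b by (auto simp: zigzag_slope_def intro!: divide_right_mono)

lemma zigzag_slope_integrable: "set_integrable lborel {0..T} (\<lambda>s. zigzag_slope \<tau> b (nat \<lfloor>s / \<tau>\<rfloor>))"
proof (rule set_integrable_bound)
  show "set_integrable lborel {0..T} (\<lambda>_. B / \<tau>)"
    unfolding set_integrable_def real_scaleR_def using zigzag_horizon_pos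
    by (intro integrable_mult_left integrable_real_indicator) auto
  show "set_borel_measurable lborel {0..T} (\<lambda>s. zigzag_slope \<tau> b (nat \<lfloor>s / \<tau>\<rfloor>))"
    unfolding set_borel_measurable_def by measurable
  show "AE s in lborel. s \<in> {0..T} \<longrightarrow> norm (zigzag_slope \<tau> b (nat \<lfloor>s / \<tau>\<rfloor>)) \<le> norm (B / \<tau>)"
    using abs_zigzag_slope order_trans[OF abs_zigzag_slope abs_ge_self] by (intro AE_I2) auto
qed

lemma zigzag_0: "zigzag T \<tau> b 0 = 0"
  by (simp only: zigzag_def LBINT_singleton if_cancel)

lemma zigzag_has_weak_deriv: "has_weak_deriv T (zigzag T \<tau> b) (\<lambda>s. zigzag_slope \<tau> b (nat \<lfloor>s / \<tau>\<rfloor>))"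
  using zigzag_slope_integrable zigzag_0 by (auto simp: has_weak_deriv_def) (auto simp: zigzag_def)

lemma zigzag_continuous: "continuous_on {0..T} (zigzag T \<tau> b)"
proof -
  have Bt: "B / \<tau> \<ge> 0" using b(1)[of 0] b(2)[of 0] \<tau> by simp
  have *: "\<bar>zigzag T \<tau> b t - zigzag T \<tau> b s\<bar> \<le> B / \<tau> * (t - s)" if "0 \<le> s" "s \<le> t" "t \<le> T" for s t
  proof -
    have "zigzag T \<tau> b t - zigzag T \<tau> b s \<le> B / \<tau> * (t - s)"
      using that set_integral_increment_le[OF zigzag_slope_integrable that, of "B / \<tau>"] abs_zigzag_slope
      by (simp add: zigzag_def abs_le_iff)
    moreover have "(- (B / \<tau>)) * (t - s) \<le> zigzag T \<tau> b t - zigzag T \<tau> b s"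
      using that set_integral_increment_ge[OF zigzag_slope_integrable that, of "- (B / \<tau>)"] abs_zigzag_slope
      by (simp add: zigzag_def abs_le_iff minus_le_iff)
    ultimately show ?thesis by (simp add: abs_le_iff)
  qed
  have "(B / \<tau>)-lipschitz_on {0..T} (zigzag T \<tau> b)"
  proof (rule lipschitz_onI[OF _ Bt])
    fix t s assume "t \<in> {0..T}" "s \<in> {0..T}"
    then show "dist (zigzag T \<tau> b t) (zigzag T \<tau> b s) \<le> B / \<tau> * dist t s"
      using *[of s t] *[of t s] by (cases "s \<le> t") (auto simp: dist_real_def abs_minus_commute)
  qed
  then show ?thesis by (rule lipschitz_on_continuous_on)
qed

lemma phase_index:
  assumes "s \<in> {real j * \<tau><..<real (Suc j) * \<tau>}"
  shows "nat \<lfloor>s / \<tau>\<rfloor> = j"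
proof -
  have "real j \<le> s / \<tau>" "s / \<tau> < real j + 1" using \<tau> assms by (auto simp: field_simps)
  then have "\<lfloor>s / \<tau>\<rfloor> = int j" by (intro floor_unique) auto
  then show ?thesis by simp
qed

lemma zigzag_phase:
  assumes j: "j < 2 * N" and t: "t \<in> {real j * \<tau>..real (Suc j) * \<tau>}"
  shows "zigzag T \<tau> b t = zigzag T \<tau> b (real j * \<tau>) + zigzag_slope \<tau> b j * (t - real j * \<tau>)"
proof -
  have le: "real (Suc j) * \<tau> \<le> T" unfolding T using j \<tau> by (intro mult_right_mono) auto
  have s: "0 \<le> real j * \<tau>" "real j * \<tau> \<le> t" "t \<le> T" using t le \<tau> by auto
  have eq: "AE s in lborel. s \<in> {real j * \<tau><..<t} \<longrightarrow> zigzag_slope \<tau> b (nat \<lfloor>s / \<tau>\<rfloor>) = zigzag_slope \<tau> b j"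
  proof (intro AE_I2 impI)
    fix s assume "s \<in> {real j * \<tau><..<t}"
    then have "s \<in> {real j * \<tau><..<real (Suc j) * \<tau>}" using t by auto
    then show "zigzag_slope \<tau> b (nat \<lfloor>s / \<tau>\<rfloor>) = zigzag_slope \<tau> b j" using phase_index by metis
  qed
  have "AE s in lborel. s \<in> {real j * \<tau><..<t} \<longrightarrow> zigzag_slope \<tau> b (nat \<lfloor>s / \<tau>\<rfloor>) \<le> zigzag_slope \<tau> b j"
    "AE s in lborel. s \<in> {real j * \<tau><..<t} \<longrightarrow> zigzag_slope \<tau> b j \<le> zigzag_slope \<tau> b (nat \<lfloor>s / \<tau>\<rfloor>)"
    using eq by (eventually_elim; simp)+
  from set_integral_increment_le[OF zigzag_slope_integrable s this(1)]
    set_integral_increment_ge[OF zigzag_slope_integrable s this(2)]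
  have "zigzag T \<tau> b t - zigzag T \<tau> b (real j * \<tau>) \<le> zigzag_slope \<tau> b j * (t - real j * \<tau>)"
    "zigzag_slope \<tau> b j * (t - real j * \<tau>) \<le> zigzag T \<tau> b t - zigzag T \<tau> b (real j * \<tau>)"
    using s by (simp_all add: zigzag_def)
  then show ?thesis by linarith
qed

lemma zigzag_even: "k \<le> N \<Longrightarrow> zigzag T \<tau> b (real (2 * k) * \<tau>) = 0"
proof (induction k)
  case (Suc k)
  have "zigzag T \<tau> b (real (2 * k + 1) * \<tau>) = b k"
    using zigzag_phase[of "2 * k" "real (2 * k + 1) * \<tau>"] Suc \<tau> by (simp add: zigzag_slope_def algebra_simps)
  then show ?case
    using zigzag_phase[of "2 * k + 1" "real (2 * Suc k) * \<tau>"] Suc \<tau> by (simp add: zigzag_slope_def algebra_simps)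
qed (use zigzag_0 in simp)

lemma abs_zigzag_le:
  assumes t: "t \<in> {0..T}"
  shows "\<bar>zigzag T \<tau> b t\<bar> \<le> B"
proof (cases "t = 0")
  case True
  then show ?thesis using zigzag_0 b[of 0] by simp
next
  case False
  then obtain j where j: "j < 2 * N" "real j * \<tau> < t" "t \<le> real (Suc j) * \<tau>"
    using phase_ex[of \<tau> t "2 * N"] t T \<tau> by auto
  \<comment> \<open>Elapsed fraction of the phase: the path is \<open>\<theta> * b k\<close> on the
    way up and \<open>(1 - \<theta>) * b k\<close> on the way down.\<close>
  define \<theta> where "\<theta> = (t - real j * \<tau>) / \<tau>"
  have \<theta>: "0 \<le> \<theta>" "\<theta> \<le> 1" using j \<tau> by (auto simp: \<theta>_def field_simps)
  have ph: "zigzag T \<tau> b t = zigzag T \<tau> b (real j * \<tau>) + zigzag_slope \<tau> b j * \<tau> * \<theta>"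
    using zigzag_phase[of j t] j \<tau> by (simp add: \<theta>_def)
  have *: "\<bar>\<theta> * b k\<bar> \<le> B" if "0 \<le> \<theta>" "\<theta> \<le> 1" for \<theta> k
    using that b[of k] mult_left_le_one_le[of "b k" \<theta>] by simp
  show ?thesis
  proof (cases "even j")
    case True
    then obtain k where k: "j = 2 * k" by blast
    then have "zigzag T \<tau> b t = \<theta> * b k" using ph zigzag_even[of k] j \<tau> by (simp add: zigzag_slope_def)
    then show ?thesis using *[OF \<theta>] by simp
  next
    case False
    then obtain k where k: "j = 2 * k + 1" by (metis oddE)
    have "zigzag T \<tau> b (real j * \<tau>) = b k"
      using zigzag_phase[of "2 * k" "real j * \<tau>"] zigzag_even[of k] j \<tau> by (simp add: zigzag_slope_def k algebra_simps)
    then have "zigzag T \<tau> b t = (1 - \<theta>) * b k" using ph \<tau> by (simp add: zigzag_slope_def k algebra_simps)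
    then show ?thesis using *[of "1 - \<theta>"] \<theta> by simp
  qed
qed

lemma zigzag_in_C0: "zigzag T \<tau> b \<in> fst (C0_space T)"
  using zigzag_continuous zigzag_0 by (auto simp: C0_space_def) (auto simp: zigzag_def)

lemma zigzag_in_W11: "zigzag T \<tau> b \<in> fst (W11_space T)"
  using zigzag_has_weak_deriv zigzag_0 by (auto simp: W11_space_def) (auto simp: zigzag_def)

text \<open>A slope of at most \<open>B / \<tau>\<close> over the time
  \<open>T = 2 * N * \<tau>\<close> gives variation at most \<open>2 * N * B\<close>, so the ratio
  \<open>s\<close> of \<open>path_norm_le\<close> is \<open>2 * N\<close>.\<close>

lemma zigzag_path_norm:
  assumes "0 < \<alpha>" "\<alpha> < 1"
  shows "path_norm T \<alpha> (zigzag T \<tau> b) \<le> ennreal (B * real (2 * N) powr \<alpha>)"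
proof (rule path_norm_le[OF _ assms])
  have "snd (W11_space T) (zigzag T \<tau> b) \<le> B / \<tau> * T"
    using zigzag_horizon_pos by (intro W11_norm_le[OF _ zigzag_has_weak_deriv] abs_zigzag_slope) auto
  then show "snd (W11_space T) (zigzag T \<tau> b) \<le> real (2 * N) * B" using \<tau> by (simp add: T mult.commute)
qed (use zigzag_horizon_pos N zigzag_in_C0 abs_zigzag_le zigzag_has_weak_deriv in auto)

lemma weak_deriv_zigzag:
  assumes "j < 2 * N"
  shows "AE t in lborel. t \<in> {real j * \<tau><..<real (Suc j) * \<tau>} \<longrightarrow> weak_deriv T (zigzag T \<tau> b) t = zigzag_slope \<tau> b j"
proof -
  have le: "real (Suc j) * \<tau> \<le> T" unfolding T using assms \<tau> by (intro mult_right_mono) auto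
  have s: "0 \<le> real j * \<tau>" using \<tau> by simp
  show ?thesis
    using weak_deriv_AE(2)[OF less_imp_le[OF zigzag_horizon_pos] zigzag_has_weak_deriv]
  proof eventually_elim
    case (elim t)
    show ?case
    proof
      assume t: "t \<in> {real j * \<tau><..<real (Suc j) * \<tau>}"
      then have "t \<in> {0..T}" using le s by auto
      with elim phase_index[OF t] show "weak_deriv T (zigzag T \<tau> b) t = zigzag_slope \<tau> b j" by simp
    qed
  qed
qed

end

section \<open>Up-down oscillations\<close>

text \<open>With \<open>s = x + y\<close>, both summands satisfy
  \<open>z * s powr (\<beta> - 1) \<le> z powr \<beta>\<close>, because the exponent
  \<open>\<beta> - 1\<close> is negative; the two inequalities add up.\<close>

lemma powr_add_le:
  fixes x y \<beta> :: real
  assumes "0 < \<beta>" "\<beta> < 1" "0 \<le> x" "0 \<le> y"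
  shows "(x + y) powr \<beta> \<le> x powr \<beta> + y powr \<beta>"
proof (cases "x + y = 0")
  case False
  define s where "s = x + y"
  have s: "s > 0" using False assms by (simp add: s_def)
  have *: "z * s powr (\<beta> - 1) \<le> z powr \<beta>" if "0 \<le> z" "z \<le> s" for z
  proof (cases "z = 0")
    case False
    then have "z * s powr (\<beta> - 1) \<le> z * z powr (\<beta> - 1)"
      using that assms by (intro mult_left_mono powr_mono2') auto
    also have "\<dots> = z powr \<beta>" using that False by (simp add: powr_mult_base)
    finally show ?thesis .
  qed simp
  have "s powr \<beta> = s * s powr (\<beta> - 1)" using s by (simp add: powr_mult_base)
  also have "\<dots> = x * s powr (\<beta> - 1) + y * s powr (\<beta> - 1)" by (simp add: s_def distrib_right)
  also have "\<dots> \<le> x powr \<beta> + y powr \<beta>" using assms by (intro add_mono *) (auto simp: s_def)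
  finally show ?thesis by (simp add: s_def)
qed (use assms in auto)

text \<open>Subadditivity makes the power Hoelder continuous of exponent \<beta> on the whole space,
  whence the choice \<open>e powr (1 / \<beta>)\<close>.\<close>

lemma hamiltonian_H_power:
  assumes "0 < \<beta>" "\<beta> < 1"
  shows "hamiltonian (H_power \<beta> :: 'a::euclidean_space \<Rightarrow> real)"
proof
  fix p :: 'a
  show "0 \<le> H_power \<beta> p" by (simp add: H_power_def)
  show "norm p \<le> 1 \<Longrightarrow> H_power \<beta> p \<le> 1" using assms by (auto simp: H_power_def intro: powr_le1)
next
  show "uniformly_continuous_on UNIV (H_power \<beta> :: 'a \<Rightarrow> real)"
    unfolding uniformly_continuous_on_def
  proof (intro allI impI)
    fix e :: real assume e: "e > 0"
    have *: "H_power \<beta> q - H_power \<beta> p < e" if "dist q p < e powr (1 / \<beta>)" for p q :: 'a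
    proof -
      have "norm q powr \<beta> \<le> (norm p + dist q p) powr \<beta>"
        using assms norm_triangle_sub[of q p] by (intro powr_mono2) (auto simp: dist_norm)
      also have "\<dots> \<le> norm p powr \<beta> + dist q p powr \<beta>" using assms by (intro powr_add_le) auto
      also have "dist q p powr \<beta> < (e powr (1 / \<beta>)) powr \<beta>" using assms that by (intro powr_less_mono2) auto
      also have "(e powr (1 / \<beta>)) powr \<beta> = e" using assms e by (simp add: powr_powr)
      finally show ?thesis by (simp add: H_power_def)
    qed
    show "\<exists>d>0. \<forall>x\<in>UNIV. \<forall>x'\<in>UNIV. dist x' x < d \<longrightarrow> dist (H_power \<beta> (x'::'a)) (H_power \<beta> x) < e"
      using e * by (intro exI[of _ "e powr (1 / \<beta>)"]) (auto simp: dist_real_def abs_less_iff dist_commute)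
  qed
qed

section \<open>One tooth applied to \<open>max |x| h\<close>\<close>

definition hat :: "real \<Rightarrow> 'a::euclidean_space \<Rightarrow> real" where
  "hat h x = max (norm x) h"

lemma unit_direction:
  fixes x :: "'a::euclidean_space"
  obtains e where "norm e = 1" "e \<bullet> x = norm x"
proof (cases "x = 0")
  case True
  obtain e :: 'a where "norm e = 1" by (metis norm_Basis nonempty_Basis ex_in_conv)
  then show ?thesis using True that[of e] by simp
next
  case False
  show ?thesis
  proof (rule that[of "(1 / norm x) *\<^sub>R x"])
    show "(1 / norm x) *\<^sub>R x \<bullet> x = norm x"
      using False by (simp add: power2_norm_eq_inner[symmetric] power2_eq_square)
  qed (use False in simp)
qed

lemma inner_le_scaled_norm: "norm p \<le> r \<Longrightarrow> p \<bullet> x \<le> r * norm (x :: 'a::euclidean_space)"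
  using norm_cauchy_schwarz[of p x] mult_right_mono[of "norm p" r "norm x"] by simp

lemma supported_hat_0: "supported (hat 0)"
  unfolding supported_def
proof
  fix x :: 'a
  obtain e where e: "norm e = 1" "e \<bullet> x = norm x" using unit_direction by blast
  have "e \<bullet> z \<le> norm z" for z using inner_le_scaled_norm[of e 1 z] e by simp
  then show "\<exists>p. norm p \<le> 1 \<and> (\<forall>z. hat 0 x + p \<bullet> (z - x) \<le> hat 0 z)"
    using e by (intro exI[of _ e]) (auto simp: hat_def inner_diff_right)
qed

text \<open>The left side is a convex combination of \<open>norm x\<close> and \<open>h\<close>; it
  is the radial profile of the minorants of slope \<open>r\<close>.\<close>

lemma convex_combination_le_hat: "0 \<le> r \<Longrightarrow> r \<le> 1 \<Longrightarrow> r * norm x + h * (1 - r) \<le> hat h x"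
proof -
  assume r: "0 \<le> r" "r \<le> 1"
  have "r * norm x + (1 - r) * h \<le> r * hat h x + (1 - r) * hat h x"
    using r by (intro add_mono mult_left_mono) (auto simp: hat_def)
  then show ?thesis by (simp add: algebra_simps)
qed

context hamiltonian
begin

lemma hopf_ge_initial: "supported f \<Longrightarrow> y \<ge> 0 \<Longrightarrow> f x \<le> hopf H f y x"
proof -
  assume f: "supported f" and y: "y \<ge> 0"
  obtain p where "hopf H f 0 x + p \<bullet> (x - x) + (y - 0) * H p \<le> hopf H f y x"
    using hopf_support[OF f] by blast
  moreover have "0 \<le> y * H p" using y H_nonneg by simp
  ultimately show ?thesis by (simp add: hopf_0[OF f])
qed

lemma hopf_le_initial: "supported f \<Longrightarrow> hopf H f y x \<le> f x + max y 0"
proof -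
  assume f: "supported f"
  obtain p where p: "norm p \<le> 1" "hopf H f y x \<le> f x + p \<bullet> (x - x) + y * H p"
    using hopf_le[OF f] by blast
  have "y * H p \<le> max y 0 * H p" using H_nonneg by (intro mult_right_mono) auto
  also have "\<dots> \<le> max y 0" using abs_H_le[OF p(1), of "max y 0"] by linarith
  finally show ?thesis using p(2) by simp
qed

end

text \<open>\<open>r0\<close> is a maximiser of \<open>h * (1 - r) + b * r powr \<beta>\<close>,
  with maximum \<open>h'\<close>. By \<open>tangent\<close>, each \<open>r\<close> in
  \<open>[r0, 1]\<close> is an optimal slope of the ascending step at some radius
  \<open>\<rho>\<close>, so that there the gain \<open>b * r powr \<beta>\<close> on the way up
  matches the loss at slope \<open>r\<close> on the way down.\<close>

locale double_phase =
  fixes \<beta> h b r0 h' :: real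
  assumes \<beta>: "0 < \<beta>" "\<beta> < 1" and h: "0 \<le> h" and b: "0 \<le> b" and r0: "0 < r0" "r0 \<le> 1"
    and h': "h' = h * (1 - r0) + b * r0 powr \<beta>"
    and peak: "\<And>r. 0 \<le> r \<Longrightarrow> r \<le> 1 \<Longrightarrow> h * (1 - r) + b * r powr \<beta> \<le> h'"
    and tangent: "\<And>r. r0 \<le> r \<Longrightarrow> r \<le> 1 \<Longrightarrow> \<exists>\<rho>\<ge>0. \<forall>s. 0 \<le> s \<and> s \<le> 1 \<longrightarrow>
      s * \<rho> + h * (1 - s) + b * s powr \<beta> \<le> r * \<rho> + h * (1 - r) + b * r powr \<beta>"
begin

lemma h_le: "h \<le> h'"
  using peak[of 0] by simp

context
  fixes up :: "'a::euclidean_space \<Rightarrow> real"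
  assumes sup: "supported (hat h :: 'a \<Rightarrow> real)" and up_def: "up = hopf (H_power \<beta>) (hat h) b"
begin

interpretation hamiltonian "H_power \<beta> :: 'a \<Rightarrow> real"
  using \<beta> by (rule hamiltonian_H_power)

lemma up_supported: "supported up"
  unfolding up_def by (rule hopf_supported[OF sup])

lemma up_le: "\<exists>s. 0 \<le> s \<and> s \<le> 1 \<and> up x \<le> s * norm x + h * (1 - s) + b * s powr \<beta>"
proof -
  obtain p where p: "norm p \<le> 1" "\<And>z. up x \<le> hat h z + p \<bullet> (x - z) + b * H_power \<beta> p"
    using hopf_le[OF sup, of b x] unfolding up_def by blast
  \<comment> \<open>The point of the sphere of radius \<open>h\<close> in direction
    \<open>p\<close>, where the minorant of slope \<open>p\<close> touches \<open>hat h\<close>. For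
    \<open>p = 0\<close> division by zero gives \<open>z = 0\<close>, which serves as well.\<close>
  define z where "z = (h / norm p) *\<^sub>R p"
  have "norm z \<le> h" using h by (simp add: z_def)
  moreover have "p \<bullet> z = norm p * h"
    by (simp add: z_def power2_norm_eq_inner[symmetric] power2_eq_square)
  moreover have "p \<bullet> x \<le> norm p * norm x" by (rule norm_cauchy_schwarz)
  ultimately have "up x \<le> norm p * norm x + h * (1 - norm p) + b * norm p powr \<beta>"
    using p(2)[of z] by (simp add: hat_def inner_diff_right H_power_def algebra_simps)
  then show ?thesis using p(1) by (intro exI[of _ "norm p"]) auto
qed

text \<open>The minorant of unit slope in the direction of \<open>x\<close> gains exactly
  \<open>b\<close>, since \<open>H\<close> is \<open>1\<close> on unit vectors; it will lose the
  same amount on the way down.\<close>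

lemma up_ge_norm: "\<exists>e. norm e = 1 \<and> e \<bullet> x = norm x \<and> (\<forall>z. e \<bullet> z + b \<le> up z)"
proof -
  obtain e where e: "norm e = 1" "e \<bullet> x = norm x" using unit_direction by blast
  have "e \<bullet> z + 0 \<le> hat h z" for z using inner_le_scaled_norm[of e 1 z] e by (simp add: hat_def)
  from hopf_upper[OF sup this] have "e \<bullet> z + b \<le> up z" for z using e by (simp add: up_def H_power_def)
  then show ?thesis using e by blast
qed

text \<open>The minorant of slope \<open>r0\<close> in the direction of \<open>x\<close> alone
  already gives the value \<open>r0 * norm x + h'\<close>.\<close>

lemma up_ge_h': "h' \<le> up x"
proof -
  obtain e where e: "norm e = 1" "e \<bullet> x = norm x" using unit_direction by blast
  have n: "norm (r0 *\<^sub>R e) \<le> r0" using e r0 by simp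
  have "(r0 *\<^sub>R e) \<bullet> z + h * (1 - r0) \<le> hat h z" for z
    using inner_le_scaled_norm[OF n, of z] convex_combination_le_hat[of r0 z h] r0 by linarith
  from hopf_upper[OF sup this, of x b] have "r0 * norm x + h * (1 - r0) + b * r0 powr \<beta> \<le> up x"
    using e r0 by (simp add: up_def H_power_def)
  moreover have "0 \<le> r0 * norm x" using r0 by simp
  ultimately show ?thesis unfolding h' by linarith
qed

text \<open>Lower bound: \<open>up\<close> has the minorant \<open>e \<bullet> z + b\<close>, which
  is lowered by \<open>b\<close>, and the constant \<open>h'\<close>, which is not lowered because
  its slope is \<open>0\<close>. Upper bound: an optimal slope \<open>r \<ge> r0\<close> is tested
  at a radius where it was optimal on the way up, a slope \<open>r < r0\<close> at the
  origin.\<close>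

lemma down_eq: "hopf (H_power \<beta>) up (- b) x = hat h' x"
proof (rule antisym)
  obtain p where p: "norm p \<le> 1" "\<And>z. hopf (H_power \<beta>) up (- b) x \<le> up z + p \<bullet> (x - z) + (- b) * H_power \<beta> p"
    using hopf_le[OF up_supported, of "- b" x] by blast
  define r where "r = norm p"
  have r: "0 \<le> r" "r \<le> 1" using p by (auto simp: r_def)
  have px: "p \<bullet> x \<le> r * norm x" unfolding r_def by (rule norm_cauchy_schwarz)
  show "hopf (H_power \<beta>) up (- b) x \<le> hat h' x"
  proof (cases "r0 \<le> r")
    case True
    then obtain \<rho> where \<rho>: "\<rho> \<ge> 0" "\<And>s. 0 \<le> s \<Longrightarrow> s \<le> 1 \<Longrightarrow>
      s * \<rho> + h * (1 - s) + b * s powr \<beta> \<le> r * \<rho> + h * (1 - r) + b * r powr \<beta>"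
      using tangent r by blast
    \<comment> \<open>At radius \<open>\<rho>\<close> slope \<open>r\<close> is optimal on the way
      up, so \<open>b * r powr \<beta>\<close> cancels and a function below \<open>hat h\<close>
      remains.\<close>
    define z where "z = (\<rho> / r) *\<^sub>R p"
    have r_pos: "r > 0" using True r0 by linarith
    have nz: "norm z = \<rho>" using \<rho> r_pos by (simp add: z_def r_def)
    have pz: "p \<bullet> z = r * \<rho>"
      using r_pos by (simp add: z_def r_def power2_norm_eq_inner[symmetric] power2_eq_square)
    obtain s where "0 \<le> s" "s \<le> 1" "up z \<le> s * norm z + h * (1 - s) + b * s powr \<beta>" using up_le by blast
    then have "up z \<le> r * \<rho> + h * (1 - r) + b * r powr \<beta>" using \<rho>(2)[of s] nz by simp
    then have "hopf (H_power \<beta>) up (- b) x \<le> r * norm x + h * (1 - r)"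
      using p(2)[of z] px pz by (simp add: inner_diff_right H_power_def r_def)
    also have "\<dots> \<le> hat h x" using r by (intro convex_combination_le_hat)
    also have "\<dots> \<le> hat h' x" using h_le by (auto simp: hat_def)
    finally show ?thesis .
  next
    case False
    obtain s where s: "0 \<le> s" "s \<le> 1" "up 0 \<le> s * norm (0::'a) + h * (1 - s) + b * s powr \<beta>" using up_le by blast
    have "up 0 \<le> h'" using s(3) peak[OF s(1,2)] by simp
    then have 1: "hopf (H_power \<beta>) up (- b) x \<le> h' + r * norm x - b * r powr \<beta>"
      using p(2)[of 0] px by (simp add: H_power_def r_def)
    define \<theta> where "\<theta> = r / r0"
    have \<theta>: "0 \<le> \<theta>" "\<theta> \<le> 1" "r = \<theta> * r0" using r r0 False by (auto simp: \<theta>_def)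
    \<comment> \<open>Hence the loss \<open>b * r powr \<beta>\<close> is at least
      \<open>\<theta>\<close> times the loss at \<open>r0\<close>, and the bound becomes a convex
      combination of the profile of slope \<open>r0\<close> and the constant
      \<open>h'\<close>.\<close>
    have "\<theta> \<le> \<theta> powr \<beta>"
    proof (cases "\<theta> = 0")
      case False
      then have "\<theta> powr 1 \<le> \<theta> powr \<beta>" using \<theta> \<beta> by (intro powr_mono') auto
      then show ?thesis using \<theta> by simp
    qed simp
    then have "\<theta> * (b * r0 powr \<beta>) \<le> \<theta> powr \<beta> * (b * r0 powr \<beta>)" using b by (intro mult_right_mono) auto
    also have "\<dots> = b * r powr \<beta>" using \<theta> r0 by (simp add: powr_mult)
    finally have 2: "\<theta> * (b * r0 powr \<beta>) \<le> b * r powr \<beta>" .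
    have "\<theta> * (r0 * norm x + h * (1 - r0)) + (1 - \<theta>) * h' \<le> \<theta> * hat h' x + (1 - \<theta>) * hat h' x"
    proof (intro add_mono mult_left_mono)
      have "r0 * norm x + h * (1 - r0) \<le> hat h x" using r0 by (intro convex_combination_le_hat) auto
      also have "\<dots> \<le> hat h' x" using h_le by (auto simp: hat_def)
      finally show "r0 * norm x + h * (1 - r0) \<le> hat h' x" .
    qed (use \<theta> in \<open>auto simp: hat_def\<close>)
    also have "\<dots> = hat h' x" by (simp add: algebra_simps)
    finally have "\<theta> * (r0 * norm x + h * (1 - r0)) + (1 - \<theta>) * h' \<le> hat h' x" .
    moreover have "\<theta> * (r0 * norm x + h * (1 - r0)) + (1 - \<theta>) * h' = h' + r * norm x - \<theta> * (b * r0 powr \<beta>)"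
      unfolding \<theta>(3) h' by (simp add: algebra_simps)
    ultimately show ?thesis using 1 2 by linarith
  qed
next
  obtain e where e: "norm e = 1" "e \<bullet> x = norm x" "\<And>z. e \<bullet> z + b \<le> up z" using up_ge_norm by blast
  have "norm x \<le> hopf (H_power \<beta>) up (- b) x"
    using hopf_upper[OF up_supported e(3), of x "- b"] e by (simp add: H_power_def)
  moreover have "h' \<le> hopf (H_power \<beta>) up (- b) x"
    using hopf_upper[OF up_supported, of 0 h' x "- b"] up_ge_h' by (simp add: H_power_def)
  ultimately show "hat h' x \<le> hopf (H_power \<beta>) up (- b) x" by (simp add: hat_def)
qed

lemma up_phase_bounds:
  assumes "0 \<le> y" "y \<le> b"
  shows "hat h (x :: 'a) \<le> hopf (H_power \<beta>) (hat h) y x" "hopf (H_power \<beta>) (hat h) y x \<le> hat h x + b"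
  using hopf_ge_initial[OF sup assms(1), of x] hopf_le_initial[OF sup, of y x] assms by auto

lemma down_phase_bounds:
  assumes "0 \<le> y" "y \<le> b"
  shows "hat h x \<le> hopf (H_power \<beta>) up (- y) x" "hopf (H_power \<beta>) up (- y) x \<le> hat h x + b"
proof -
  obtain e where e: "norm e = 1" "e \<bullet> x = norm x" "\<And>z. e \<bullet> z + b \<le> up z" using up_ge_norm by blast
  have "norm x \<le> hopf (H_power \<beta>) up (- y) x"
    using hopf_upper[OF up_supported e(3), of x "- y"] e assms by (simp add: H_power_def)
  moreover have "h' \<le> hopf (H_power \<beta>) up (- y) x"
    using hopf_upper[OF up_supported, of 0 h' x "- y"] up_ge_h' by (simp add: H_power_def)
  ultimately show "hat h x \<le> hopf (H_power \<beta>) up (- y) x" using h_le by (simp add: hat_def)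
  have "hopf (H_power \<beta>) up (- y) x \<le> up x" using hopf_le_initial[OF up_supported, of "- y" x] assms by simp
  also have "\<dots> \<le> hat h x + b" unfolding up_def using up_phase_bounds(2)[of b x] b by simp
  finally show "hopf (H_power \<beta>) up (- y) x \<le> hat h x + b" .
qed

text \<open>Read off at \<open>x = 0\<close> at the end of the tooth. It bounds the rise of the
  target curve within one tooth by the height of the tooth.\<close>

lemma h'_le: "h' \<le> h + b"
  using down_eq[of 0] down_phase_bounds(2)[of b 0] b h h_le by (simp add: hat_def)

end

end

text \<open>The amplitude is chosen such that \<open>b r\<^sup>\<beta> - h r\<close> is maximal at \<open>r\<^sub>0\<close> with value \<open>h' - h\<close>.\<close>

lemma double_phase_amplitude:
  fixes \<kappa> \<beta> :: real and k :: nat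
  assumes \<beta>: "0 < \<beta>" "\<beta> < 1" and \<kappa>: "\<kappa> > 0"
  defines "h \<equiv> \<kappa> * real k powr (1 - \<beta>)" and "h' \<equiv> \<kappa> * real (Suc k) powr (1 - \<beta>)"
  shows "\<exists>b r0. double_phase \<beta> h b r0 h' \<and> b \<le> \<kappa> * \<beta> powr (- \<beta>)"
proof (cases "k = 0")
  case True
  then have h0: "h = 0" "h' = \<kappa>" by (simp_all add: h_def h'_def)
  have "double_phase \<beta> h \<kappa> 1 h'"
  proof
    show "\<exists>\<rho>\<ge>0. \<forall>s. 0 \<le> s \<and> s \<le> 1 \<longrightarrow> s * \<rho> + h * (1 - s) + \<kappa> * s powr \<beta> \<le> r * \<rho> + h * (1 - r) + \<kappa> * r powr \<beta>"
      if "1 \<le> r" "r \<le> 1" for r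
      using that \<beta> \<kappa> h0 by (intro exI[of _ 0]) (auto intro!: mult_left_le powr_le1)
    show "h * (1 - r) + \<kappa> * r powr \<beta> \<le> h'" if "0 \<le> r" "r \<le> 1" for r
      using that \<beta> \<kappa> h0 by (auto intro!: mult_left_le powr_le1)
  qed (use \<beta> \<kappa> h0 in auto)
  moreover have "1 \<le> \<beta> powr (- \<beta>)"
  proof -
    have "\<beta> powr \<beta> \<le> 1" using \<beta> by (intro powr_le1) auto
    moreover have "\<beta> powr \<beta> > 0" using \<beta> by simp
    ultimately show ?thesis by (simp add: powr_minus one_le_inverse_iff)
  qed
  then have "\<kappa> \<le> \<kappa> * \<beta> powr (- \<beta>)" using \<kappa> by (simp add: mult_le_cancel_left1)
  ultimately show ?thesis by blast
next
  case False
  then have k: "real k > 0" by simp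
  have h: "h > 0" using k \<kappa> by (simp add: h_def)
  \<comment> \<open>Stationarity of \<open>b * r powr \<beta> - h * r\<close> at \<open>r0\<close>
    reads \<open>h * r0 = \<beta> * g\<close> with \<open>g = b * r0 powr \<beta>\<close>, and the
    value there is \<open>(1 - \<beta>) * g\<close>. Prescribing \<open>h' - h\<close> thus
    determines \<open>g\<close>, then \<open>r0\<close>, then \<open>b\<close>.\<close>
  define g where "g = (h' - h) / (1 - \<beta>)"
  have hh: "h' = h + (1 - \<beta>) * g" using \<beta> by (simp add: g_def)
  have g_pos: "g > 0"
  proof -
    have "real k powr (1 - \<beta>) < real (Suc k) powr (1 - \<beta>)" using \<beta> by (intro powr_less_mono2) auto
    then show ?thesis using \<kappa> \<beta> by (simp add: g_def h_def h'_def)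
  qed
  have g_le: "g \<le> h / k"
  proof -
    \<comment> \<open>The tangent at \<open>1\<close>, that is Bernoulli's inequality. The resulting
      \<open>g \<le> h / k\<close> yields both \<open>r0 \<le> 1\<close> and the bound on
      \<open>b\<close>.\<close>
    have "(1 + 1 / k) powr (1 - \<beta>) \<le> (1 - \<beta>) * 1 powr (1 - \<beta> - 1) * (1 + 1 / k) + (1 - (1 - \<beta>)) * 1 powr (1 - \<beta>)"
      using \<beta> by (intro powr_le_tangent) auto
    then have "(1 + 1 / k) powr (1 - \<beta>) \<le> 1 + (1 - \<beta>) / k" by (simp add: algebra_simps)
    then have "h * (1 + 1 / k) powr (1 - \<beta>) \<le> h * (1 + (1 - \<beta>) / k)" using h by (intro mult_left_mono) auto
    moreover have "h * (1 + 1 / k) powr (1 - \<beta>) = h'"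
    proof -
      have "real k powr (1 - \<beta>) * (1 + 1 / k) powr (1 - \<beta>) = (real k * (1 + 1 / k)) powr (1 - \<beta>)"
        by (simp add: powr_mult)
      also have "real k * (1 + 1 / k) = real (Suc k)" using k by (simp add: field_simps)
      finally show ?thesis by (simp add: h_def h'_def)
    qed
    ultimately have "(1 - \<beta>) * g \<le> (1 - \<beta>) * (h / k)" unfolding hh by (simp add: algebra_simps)
    then show ?thesis by (rule mult_left_le_imp_le) (use \<beta> in simp)
  qed
  define r0 where "r0 = \<beta> * g / h"
  have r0: "0 < r0" "r0 \<le> 1"
  proof -
    show "0 < r0" using \<beta> g_pos h by (simp add: r0_def)
    have "h / k \<le> h" using k h False by (simp add: field_simps)
    then have "g \<le> h" using g_le by linarith
    then have "\<beta> * g \<le> 1 * h" using \<beta> g_pos by (intro mult_mono) auto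
    then show "r0 \<le> 1" using h by (simp add: r0_def)
  qed
  define b where "b = g * r0 powr (- \<beta>)"
  have b: "b > 0" using g_pos r0 by (simp add: b_def)
  have b1: "b * r0 powr \<beta> = g" using r0 by (simp add: b_def powr_minus)
  have b2: "h * r0 = \<beta> * g" using h by (simp add: r0_def)
  have b3: "b * \<beta> * r0 powr (\<beta> - 1) = h"
  proof -
    have "b * \<beta> * r0 powr (\<beta> - 1) * r0 = \<beta> * (b * r0 powr \<beta>)" using r0 by (simp add: powr_diff)
    also have "\<dots> = h * r0" using b1 b2 by simp
    finally show ?thesis using r0 by simp
  qed
  have tan: "b * s powr \<beta> \<le> b * \<beta> * r powr (\<beta> - 1) * s + (1 - \<beta>) * (b * r powr \<beta>)" if "0 \<le> s" "0 < r" for s r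
    using mult_left_mono[OF powr_le_tangent[OF \<beta> that], of b] b by (simp add: algebra_simps)
  have "double_phase \<beta> h b r0 h'"
  proof
    show "h' = h * (1 - r0) + b * r0 powr \<beta>" unfolding hh b1 right_diff_distrib b2 by (simp add: algebra_simps)
    show "h * (1 - r) + b * r powr \<beta> \<le> h'" if "0 \<le> r" "r \<le> 1" for r
      using tan[OF that(1) r0(1)] unfolding b3 b1 hh by (simp add: algebra_simps)
    fix r assume r: "r0 \<le> r" "r \<le> 1"
    \<comment> \<open>The radius at which the derivative in \<open>s\<close> vanishes at
      \<open>s = r\<close>; it is nonnegative because \<open>r \<ge> r0\<close>.\<close>
    define \<rho> where "\<rho> = h - b * \<beta> * r powr (\<beta> - 1)"
    have "r powr (\<beta> - 1) \<le> r0 powr (\<beta> - 1)" using r r0 \<beta> by (intro powr_mono2') auto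
    then have "b * \<beta> * r powr (\<beta> - 1) \<le> b * \<beta> * r0 powr (\<beta> - 1)" using b \<beta> by (intro mult_left_mono) auto
    then have "\<rho> \<ge> 0" unfolding \<rho>_def b3 by simp
    moreover have "s * \<rho> + h * (1 - s) + b * s powr \<beta> \<le> r * \<rho> + h * (1 - r) + b * r powr \<beta>" if "0 \<le> s" for s
    proof -
      have "r * (b * \<beta> * r powr (\<beta> - 1)) = \<beta> * (b * r powr \<beta>)" using r r0 by (simp add: powr_diff)
      moreover have "r * \<rho> + h * (1 - r) = h - r * (b * \<beta> * r powr (\<beta> - 1))"
        "s * \<rho> + h * (1 - s) = h - b * \<beta> * r powr (\<beta> - 1) * s"
        "(1 - \<beta>) * (b * r powr \<beta>) = b * r powr \<beta> - \<beta> * (b * r powr \<beta>)"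
        by (simp_all add: \<rho>_def algebra_simps)
      moreover have "r > 0" using r r0 by linarith
      ultimately show ?thesis using tan[OF that, of r] by linarith
    qed
    ultimately show "\<exists>\<rho>\<ge>0. \<forall>s. 0 \<le> s \<and> s \<le> 1 \<longrightarrow>
      s * \<rho> + h * (1 - s) + b * s powr \<beta> \<le> r * \<rho> + h * (1 - r) + b * r powr \<beta>" by blast
  qed (use \<beta> h b r0 in auto)
  moreover have "b \<le> \<kappa> * \<beta> powr (- \<beta>)"
  proof -
    \<comment> \<open>\<open>r0\<close> is eliminated. With \<open>g \<le> h / k\<close> the
      dependence on \<open>k\<close> then cancels against
      \<open>h = \<kappa> * k powr (1 - \<beta>)\<close>.\<close>
    have "b = g powr (1 - \<beta>) * h powr \<beta> * \<beta> powr (- \<beta>)"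
    proof -
      have "r0 powr (- \<beta>) = \<beta> powr (- \<beta>) * g powr (- \<beta>) * h powr \<beta>"
        using \<beta> g_pos h by (simp add: r0_def powr_divide powr_mult powr_minus field_simps)
      moreover have "g * g powr (- \<beta>) = g powr (1 - \<beta>)" using g_pos by (simp add: powr_diff powr_minus field_simps)
      ultimately show ?thesis by (simp add: b_def)
    qed
    also have "\<dots> \<le> (h / k) powr (1 - \<beta>) * h powr \<beta> * \<beta> powr (- \<beta>)"
      using g_pos g_le \<beta> by (intro mult_right_mono powr_mono2) auto
    also have "(h / k) powr (1 - \<beta>) * h powr \<beta> = \<kappa>"
    proof -
      have "(h / k) powr (1 - \<beta>) * h powr \<beta> = h / real k powr (1 - \<beta>)"
        using h k by (simp add: powr_divide powr_add[symmetric])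
      then show ?thesis using k by (simp add: h_def)
    qed
    finally show ?thesis .
  qed
  ultimately show ?thesis by blast
qed

section \<open>The two sequences of paths\<close>

lemma hat_0_eq_norm: "hat 0 = norm"
  by (auto simp: hat_def)

text \<open>During tooth \<open>k\<close> the solution lies between \<open>hat (h k)\<close> and
  \<open>hat (h k) + b k\<close>. So does the target profile, as
  \<open>M * t powr (1 - \<beta>)\<close> lies between \<open>h k\<close> and
  \<open>h (Suc k) \<le> h k + b k\<close>; hence the error is at most one height, uniformly in
  space and time.\<close>

lemma zigzag_solution:
  fixes \<beta> T M :: real and N :: nat
  assumes \<beta>: "0 < \<beta>" "\<beta> < 1" and T: "T > 0" and M: "M > 0" and N: "N > 0"
  defines "B \<equiv> M * (T / real N) powr (1 - \<beta>) * \<beta> powr (- \<beta>)"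
  obtains W where "W \<in> fst (W11_space T)" "\<And>t. t \<in> {0..T} \<Longrightarrow> \<bar>W t\<bar> \<le> B"
    "\<And>\<alpha>. 0 < \<alpha> \<Longrightarrow> \<alpha> < 1 \<Longrightarrow> path_norm T \<alpha> W \<le> ennreal (B * real (2 * N) powr \<alpha>)"
    "\<And>(x :: 'a::euclidean_space) t. t \<in> {0..T} \<Longrightarrow>
       \<bar>HJ_sol T norm (H_power \<beta>) W (x, t) - max (norm x) (M * t powr (1 - \<beta>))\<bar> \<le> B"
proof -
  interpret hamiltonian "H_power \<beta> :: 'a \<Rightarrow> real" using \<beta> by (rule hamiltonian_H_power)
  define \<tau> where "\<tau> = T / real (2 * N)"
  have \<tau>: "\<tau> > 0" "T = real (2 * N) * \<tau>" using T N by (auto simp: \<tau>_def)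
  \<comment> \<open>With this factor \<open>h k\<close> is the value of
    \<open>M * t powr (1 - \<beta>)\<close> at \<open>t = k * T / N\<close>, when \<open>k\<close>
    teeth are completed.\<close>
  define \<kappa> where "\<kappa> = M * (T / real N) powr (1 - \<beta>)"
  have \<kappa>: "\<kappa> > 0" using M T N by (simp add: \<kappa>_def)
  define h where "h k = \<kappa> * real k powr (1 - \<beta>)" for k
  have "\<exists>b r0. double_phase \<beta> (h k) b r0 (h (Suc k)) \<and> b \<le> B" for k
    using double_phase_amplitude[OF \<beta> \<kappa>, of k] unfolding h_def B_def \<kappa>_def .
  then obtain b r0 where dp: "\<And>k. double_phase \<beta> (h k) (b k) (r0 k) (h (Suc k))" and bB: "\<And>k. b k \<le> B"
    by metis
  have b0: "0 \<le> b k" for k using dp[of k] by (simp add: double_phase_def)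
  define c where "c = zigzag_slope \<tau> b"
  have c: "c (2 * k) = b k / \<tau>" "c (2 * k + 1) = - b k / \<tau>" for k by (simp_all add: c_def zigzag_slope_def)
  note path = \<tau>(1) N \<tau>(2) b0 bB
  define S where "S = hopf_steps \<tau> c (hat 0 :: 'a \<Rightarrow> real)"
  have S_sup: "supported (S j)" for j unfolding S_def by (rule hopf_steps_supported[OF supported_hat_0])
  have S_odd: "S (2 * k + 1) = hopf (H_power \<beta>) (S (2 * k)) (b k)" for k
    using \<tau> by (simp add: S_def c)
  have S_even: "S (2 * k) = hat (h k)" for k
  proof (induction k)
    case 0
    then show ?case by (simp add: S_def h_def)
  next
    case (Suc k)
    have sup: "supported (hat (h k) :: 'a \<Rightarrow> real)" using S_sup[of "2 * k"] Suc by simp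
    have "S (2 * Suc k) = hopf (H_power \<beta>) (S (2 * k + 1)) (- b k)"
      using \<tau> c(2)[of k] by (simp add: S_def)
    also have "\<dots> = hat (h (Suc k))"
      using double_phase.down_eq[OF dp sup refl] unfolding S_odd Suc by blast
    finally show ?case .
  qed
  have sup: "supported (hat (h k) :: 'a \<Rightarrow> real)" for k using S_sup[of "2 * k"] S_even by simp
  show thesis
  proof (rule that[of "zigzag T \<tau> b"])
    show "zigzag T \<tau> b \<in> fst (W11_space T)" by (rule zigzag_in_W11[OF path])
    show "\<bar>zigzag T \<tau> b t\<bar> \<le> B" if "t \<in> {0..T}" for t by (rule abs_zigzag_le[OF path that])
    show "path_norm T \<alpha> (zigzag T \<tau> b) \<le> ennreal (B * real (2 * N) powr \<alpha>)" if "0 < \<alpha>" "\<alpha> < 1" for \<alpha>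
      by (rule zigzag_path_norm[OF path that])
    fix x :: 'a and t assume t: "t \<in> {0..T}"
    have n: "2 * N > 0" using N by simp
    have "HJ_sol T (hat 0) (H_power \<beta>) (zigzag T \<tau> b) (x, t) = hopf_sol \<tau> c (hat 0) (x, t)"
      unfolding c_def by (rule HJ_sol_eq_hopf_sol[OF supported_hat_0 \<tau>(1) n \<tau>(2) weak_deriv_zigzag[OF path] t])
    then have sol: "HJ_sol T norm (H_power \<beta>) (zigzag T \<tau> b) (x, t) = hopf_sol \<tau> c (hat 0) (x, t)"
      by (simp add: hat_0_eq_norm)
    obtain j where j: "j < 2 * N" "t \<in> {real j * \<tau>..real (Suc j) * \<tau>}"
    proof (cases "t = 0")
      case True
      then show ?thesis using that[of 0] n \<tau> by simp
    next
      case False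
      then have "0 < t" "t \<le> real (2 * N) * \<tau>" using t \<tau>(2) by auto
      then obtain i where "i < 2 * N" "real i * \<tau> < t" "t \<le> real (Suc i) * \<tau>"
        using phase_ex[OF \<tau>(1)] by blast
      then show ?thesis by (intro that[of i]) simp_all
    qed
    define k where "k = j div 2"
    define y where "y = \<bar>c j\<bar> * (t - real j * \<tau>)"
    have hk: "hat (h k) x \<le> hopf_sol \<tau> c (hat 0) (x, t) \<and> hopf_sol \<tau> c (hat 0) (x, t) \<le> hat (h k) x + b k"
    proof -
      have u: "hopf_sol \<tau> c (hat 0) (x, t) = hopf (H_power \<beta>) (S j) (c j * (t - real j * \<tau>)) x"
        unfolding S_def by (rule hopf_sol_phase[OF supported_hat_0 \<tau>(1) j(2)])
      have \<theta>: "0 \<le> b k / \<tau> * (t - real j * \<tau>)" "b k / \<tau> * (t - real j * \<tau>) \<le> b k"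
      proof -
        show "0 \<le> b k / \<tau> * (t - real j * \<tau>)" using j(2) b0[of k] \<tau> by simp
        have "b k / \<tau> * (t - real j * \<tau>) \<le> b k / \<tau> * \<tau>"
          using j(2) b0[of k] \<tau> by (intro mult_left_mono) (auto simp: algebra_simps)
        then show "b k / \<tau> * (t - real j * \<tau>) \<le> b k" using \<tau> by simp
      qed
      show ?thesis
      proof (cases "even j")
        case True
        then have jk: "j = 2 * k" by (simp add: k_def)
        have "c j = b k / \<tau>" "S j = hat (h k)" unfolding jk by (rule c S_even)+
        then show ?thesis unfolding u
          using double_phase.up_phase_bounds[OF dp sup refl \<theta>, of x] by simp
      next
        case False
        then have jk: "j = 2 * k + 1" by (simp add: k_def)
        have "c j = - b k / \<tau>" "S j = hopf (H_power \<beta>) (hat (h k)) (b k)"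
          unfolding jk S_odd S_even by (rule c refl)+
        then show ?thesis unfolding u
          using double_phase.down_phase_bounds[OF dp sup refl \<theta>, of x] by simp
      qed
    qed
    have t_bounds: "real k * (T / N) \<le> t" "t \<le> real (Suc k) * (T / N)"
    proof -
      have eq: "real i * (T / N) = real (2 * i) * \<tau>" for i using N by (simp add: \<tau>_def)
      have "real (2 * k) * \<tau> \<le> real j * \<tau>" "real (Suc j) * \<tau> \<le> real (2 * Suc k) * \<tau>"
        using \<tau> by (intro mult_right_mono; simp add: k_def; linarith)+
      then show "real k * (T / N) \<le> t" "t \<le> real (Suc k) * (T / N)"
        using j(2) unfolding eq by auto
    qed
    have h_eq: "h i = M * (real i * (T / N)) powr (1 - \<beta>)" for i
      unfolding h_def \<kappa>_def by (subst powr_mult) (use T in simp_all)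
    have "h k \<le> M * t powr (1 - \<beta>)" "M * t powr (1 - \<beta>) \<le> h (Suc k)"
      unfolding h_eq using t_bounds t T M \<beta> by (auto intro!: mult_left_mono powr_mono2)
    moreover have "h (Suc k) \<le> h k + b k" by (rule double_phase.h'_le[OF dp sup refl])
    ultimately have "hat (h k) x \<le> max (norm x) (M * t powr (1 - \<beta>))"
      "max (norm x) (M * t powr (1 - \<beta>)) \<le> hat (h k) x + b k"
      using b0[of k] by (auto simp: hat_def)
    then show "\<bar>HJ_sol T norm (H_power \<beta>) (zigzag T \<tau> b) (x, t) - max (norm x) (M * t powr (1 - \<beta>))\<bar> \<le> B"
      unfolding sol using conjunct1[OF hk] conjunct2[OF hk] bB[of k] by linarith
  qed
qed

theorem theorem1p7:
  fixes T \<alpha> \<beta> :: real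
  assumes "T > 0" and "0 < \<alpha>" "\<alpha> < 1" and "0 < \<beta>" "\<beta> < 1"
  shows "((H_power \<beta> :: real ^ 'd \<Rightarrow> real) \<in> Ham_space \<alpha> \<longleftrightarrow> \<alpha> + \<beta> > 1) \<and>
    (\<alpha> + \<beta> < 1 \<longrightarrow>
      (\<exists>W :: nat \<Rightarrow> real \<Rightarrow> real.
        (\<forall>n. W n \<in> fst (W11_space T)) \<and>
        uniform_limit {0..T} W (\<lambda>_. 0) sequentially \<and>
        (SUP n. path_norm T \<alpha> (W n)) < \<infinity> \<and>
        (\<forall>(x :: real ^ 'd) t. t \<in> {0<..T} \<longrightarrow>
          filterlim (\<lambda>n. HJ_sol T norm (H_power \<beta>) (W n) (x, t)) at_top sequentially))) \<and>
    (\<forall>c0>0.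
      (\<exists>W :: nat \<Rightarrow> real \<Rightarrow> real.
        (\<forall>n. W n \<in> fst (W11_space T)) \<and>
        uniform_limit {0..T} W (\<lambda>_. 0) sequentially \<and>
        (SUP n. path_norm T \<alpha> (W n)) < \<infinity> \<and>
        (\<lambda>n. SUP (x, t)\<in>(UNIV :: (real ^ 'd) set) \<times> {0..T}.
           ennreal \<bar>HJ_sol T norm (H_power (1 - \<alpha>)) (W n) (x, t) - max (norm x) (c0 * t powr \<alpha>)\<bar>)
          \<longlonglongrightarrow> 0))"
proof -
  \<comment> \<open>Common core of both constructions, with \<open>Suc n\<close> teeth. The
    condition on \<open>C\<close> fixes the height bound as \<open>C * N powr (-\<alpha>)\<close>,
    which tends to \<open>0\<close> and, multiplied by \<open>(2 * N) powr \<alpha>\<close>, stays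
    equal to \<open>C * 2 powr \<alpha>\<close>.\<close>
  have seq: "\<exists>W :: nat \<Rightarrow> real \<Rightarrow> real. (\<forall>n. W n \<in> fst (W11_space T)) \<and>
      uniform_limit {0..T} W (\<lambda>_. 0) sequentially \<and> (SUP n. path_norm T \<alpha> (W n)) < \<infinity> \<and>
      (\<forall>n. \<forall>x :: real ^ 'd. \<forall>t\<in>{0..T}. \<bar>HJ_sol T norm (H_power \<gamma>) (W n) (x, t) - max (norm x) (M n * t powr (1 - \<gamma>))\<bar>
        \<le> C * real (Suc n) powr (- \<alpha>))"
    if \<gamma>: "0 < \<gamma>" "\<gamma> < 1" and M: "\<And>n. M n > 0"
      and C: "\<And>n. M n * (T / real (Suc n)) powr (1 - \<gamma>) * \<gamma> powr (- \<gamma>) = C * real (Suc n) powr (- \<alpha>)"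
    for \<gamma> C :: real and M :: "nat \<Rightarrow> real"
  proof -
    have "\<exists>W. W \<in> fst (W11_space T) \<and> (\<forall>t\<in>{0..T}. \<bar>W t\<bar> \<le> C * real (Suc n) powr (- \<alpha>)) \<and>
      path_norm T \<alpha> W \<le> ennreal (C * real (Suc n) powr (- \<alpha>) * real (2 * Suc n) powr \<alpha>) \<and>
      (\<forall>x :: real ^ 'd. \<forall>t\<in>{0..T}. \<bar>HJ_sol T norm (H_power \<gamma>) W (x, t) - max (norm x) (M n * t powr (1 - \<gamma>))\<bar>
        \<le> C * real (Suc n) powr (- \<alpha>))" for n
      by (rule zigzag_solution[OF \<gamma> assms(1) M[of n] zero_less_Suc[of n], unfolded C, where ?'a = "real ^ 'd"])
        (use assms(2,3) in blast)
    then obtain W where W: "\<And>n. W n \<in> fst (W11_space T)"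
      "\<And>n t. t \<in> {0..T} \<Longrightarrow> \<bar>W n t\<bar> \<le> C * real (Suc n) powr (- \<alpha>)"
      "\<And>n. path_norm T \<alpha> (W n) \<le> ennreal (C * real (Suc n) powr (- \<alpha>) * real (2 * Suc n) powr \<alpha>)"
      "\<And>n (x :: real ^ 'd) t. t \<in> {0..T} \<Longrightarrow> \<bar>HJ_sol T norm (H_power \<gamma>) (W n) (x, t) - max (norm x) (M n * t powr (1 - \<gamma>))\<bar>
        \<le> C * real (Suc n) powr (- \<alpha>)"
      by metis
    have "uniform_limit {0..T} W (\<lambda>_. 0) sequentially"
    proof (rule uniform_limitI)
      fix e :: real assume "e > 0"
      have "(\<lambda>n. C * real (Suc n) powr (- \<alpha>)) \<longlonglongrightarrow> 0" using assms(2) by real_asymp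
      then have "\<forall>\<^sub>F n in sequentially. C * real (Suc n) powr (- \<alpha>) < e" using \<open>e > 0\<close> by (rule order_tendstoD)
      then show "\<forall>\<^sub>F n in sequentially. \<forall>t\<in>{0..T}. dist (W n t) 0 < e"
      proof eventually_elim
        case (elim n)
        show ?case
        proof
          fix t assume "t \<in> {0..T}"
          from W(2)[OF this, of n] elim show "dist (W n t) 0 < e" by (simp del: of_nat_Suc)
        qed
      qed
    qed
    moreover have "(SUP n. path_norm T \<alpha> (W n)) \<le> ennreal (C * 2 powr \<alpha>)"
    proof (rule SUP_least)
      fix n
      have "C * real (Suc n) powr (- \<alpha>) * real (2 * Suc n) powr \<alpha> = C * 2 powr \<alpha>"
        unfolding of_nat_mult by (subst powr_mult) (simp_all add: powr_minus field_simps)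
      then show "path_norm T \<alpha> (W n) \<le> ennreal (C * 2 powr \<alpha>)" using W(3)[of n] by (simp only:)
    qed
    then have "(SUP n. path_norm T \<alpha> (W n)) < \<infinity>" by (rule le_less_trans) simp
    ultimately show ?thesis using W(1,4) by blast
  qed
  have "(H_power \<beta> :: real ^ 'd \<Rightarrow> real) \<in> Ham_space \<alpha> \<longleftrightarrow> \<alpha> + \<beta> > 1"
    using H_power_in_Ham_space[OF assms(4,5,2,3)] H_power_notin_Ham_space[OF assms(4,5), of \<alpha>] by (meson not_le)
  moreover have "\<exists>W :: nat \<Rightarrow> real \<Rightarrow> real.
        (\<forall>n. W n \<in> fst (W11_space T)) \<and>
        uniform_limit {0..T} W (\<lambda>_. 0) sequentially \<and>
        (SUP n. path_norm T \<alpha> (W n)) < \<infinity> \<and>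
        (\<forall>(x :: real ^ 'd) t. t \<in> {0<..T} \<longrightarrow>
          filterlim (\<lambda>n. HJ_sol T norm (H_power \<beta>) (W n) (x, t)) at_top sequentially)" if ab: "\<alpha> + \<beta> < 1"
  proof -
    \<comment> \<open>The growth for which the heights are of order
      \<open>N powr (-\<alpha>)\<close>; it diverges because
      \<open>\<alpha> + \<beta> < 1\<close>.\<close>
    define M where "M n = real (Suc n) powr (1 - \<beta> - \<alpha>)" for n
    define C where "C = T powr (1 - \<beta>) * \<beta> powr (- \<beta>)"
    have "M n * (T / real (Suc n)) powr (1 - \<beta>) * \<beta> powr (- \<beta>) = C * real (Suc n) powr (- \<alpha>)" for n
    proof -
      have "(T / real (Suc n)) powr (1 - \<beta>) = T powr (1 - \<beta>) * real (Suc n) powr (\<beta> - 1)"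
        using assms(1) by (simp add: powr_divide powr_minus_divide[symmetric] del: of_nat_Suc)
          (metis divide_inverse minus_diff_eq powr_minus)
      moreover have "M n * real (Suc n) powr (\<beta> - 1) = real (Suc n) powr (- \<alpha>)"
        unfolding M_def powr_add[symmetric] by simp
      ultimately show ?thesis by (simp add: C_def mult_ac del: of_nat_Suc)
    qed
    moreover have M_pos: "M n > 0" for n by (simp add: M_def)
    ultimately obtain W where W: "\<And>n. W n \<in> fst (W11_space T)"
      "uniform_limit {0..T} W (\<lambda>_. 0) sequentially" "(SUP n. path_norm T \<alpha> (W n)) < \<infinity>"
      "\<And>n (x :: real ^ 'd) t. t \<in> {0..T} \<Longrightarrow> \<bar>HJ_sol T norm (H_power \<beta>) (W n) (x, t) - max (norm x) (M n * t powr (1 - \<beta>))\<bar>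
        \<le> C * real (Suc n) powr (- \<alpha>)"
      using seq[OF assms(4,5), of M C] by blast
    have "filterlim (\<lambda>n. HJ_sol T norm (H_power \<beta>) (W n) (x, t)) at_top sequentially"
      if t: "t \<in> {0<..T}" for x :: "real ^ 'd" and t
    proof (rule filterlim_at_top_mono)
      have "t powr (1 - \<beta>) > 0" using t by simp
      moreover have "0 < 1 - \<beta> - \<alpha>" using ab by simp
      ultimately show "filterlim (\<lambda>n. M n * t powr (1 - \<beta>) - C) at_top sequentially"
        unfolding M_def by real_asymp
      show "\<forall>\<^sub>F n in sequentially. M n * t powr (1 - \<beta>) - C \<le> HJ_sol T norm (H_power \<beta>) (W n) (x, t)"
      proof (intro always_eventually allI)
        fix n
        have "real (Suc n) powr (- \<alpha>) \<le> 1" using assms(2) by (simp add: powr_le_one_le powr_minus_divide ge_one_powr_ge_zero del: of_nat_Suc)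
        then have "C * real (Suc n) powr (- \<alpha>) \<le> C" by (simp add: C_def mult_left_le)
        moreover have "\<bar>HJ_sol T norm (H_power \<beta>) (W n) (x, t) - max (norm x) (M n * t powr (1 - \<beta>))\<bar> \<le> C * real (Suc n) powr (- \<alpha>)"
          using t by (intro W(4)) auto
        ultimately show "M n * t powr (1 - \<beta>) - C \<le> HJ_sol T norm (H_power \<beta>) (W n) (x, t)"
          using max.cobounded2[of "M n * t powr (1 - \<beta>)" "norm x"] by linarith
      qed
    qed
    with W(1-3) show ?thesis by blast
  qed
  moreover have "\<exists>W :: nat \<Rightarrow> real \<Rightarrow> real.
        (\<forall>n. W n \<in> fst (W11_space T)) \<and>
        uniform_limit {0..T} W (\<lambda>_. 0) sequentially \<and>
        (SUP n. path_norm T \<alpha> (W n)) < \<infinity> \<and>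
        (\<lambda>n. SUP (x, t)\<in>(UNIV :: (real ^ 'd) set) \<times> {0..T}.
           ennreal \<bar>HJ_sol T norm (H_power (1 - \<alpha>)) (W n) (x, t) - max (norm x) (c0 * t powr \<alpha>)\<bar>)
          \<longlonglongrightarrow> 0" if c0: "c0 > 0" for c0
  proof -
    \<comment> \<open>For the exponent \<open>1 - \<alpha>\<close> the height bound scales like
      \<open>c0 * N powr (-\<alpha>)\<close> already with the fixed factor \<open>c0\<close>, so the
      target curve does not depend on \<open>n\<close>.\<close>
    define C where "C = c0 * T powr \<alpha> * (1 - \<alpha>) powr (- (1 - \<alpha>))"
    have C: "c0 * (T / real (Suc n)) powr (1 - (1 - \<alpha>)) * (1 - \<alpha>) powr (- (1 - \<alpha>)) = C * real (Suc n) powr (- \<alpha>)" for n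
      using assms(1) by (simp add: C_def powr_divide powr_minus field_simps del: of_nat_Suc)
    have "0 < 1 - \<alpha>" "1 - \<alpha> < 1" using assms by auto
    moreover have "1 - (1 - \<alpha>) = \<alpha>" by simp
    ultimately obtain W where W: "\<And>n. W n \<in> fst (W11_space T)"
      "uniform_limit {0..T} W (\<lambda>_. 0) sequentially" "(SUP n. path_norm T \<alpha> (W n)) < \<infinity>"
      "\<And>n (x :: real ^ 'd) t. t \<in> {0..T} \<Longrightarrow> \<bar>HJ_sol T norm (H_power (1 - \<alpha>)) (W n) (x, t) - max (norm x) (c0 * t powr \<alpha>)\<bar>
        \<le> C * real (Suc n) powr (- \<alpha>)"
      using seq[OF _ _ c0 C] by metis
    have "(\<lambda>n. SUP (x, t)\<in>(UNIV :: (real ^ 'd) set) \<times> {0..T}.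
           ennreal \<bar>HJ_sol T norm (H_power (1 - \<alpha>)) (W n) (x, t) - max (norm x) (c0 * t powr \<alpha>)\<bar>) \<longlonglongrightarrow> 0"
    proof (rule tendsto_sandwich[OF _ _ tendsto_const])
      have "(\<lambda>n. C * real (Suc n) powr (- \<alpha>)) \<longlonglongrightarrow> 0" using assms(2) by real_asymp
      then have "(\<lambda>n. ennreal (C * real (Suc n) powr (- \<alpha>))) \<longlonglongrightarrow> ennreal 0" by (rule tendsto_ennrealI)
      then show "(\<lambda>n. ennreal (C * real (Suc n) powr (- \<alpha>))) \<longlonglongrightarrow> 0" by simp
      show "\<forall>\<^sub>F n in sequentially. (SUP (x, t)\<in>(UNIV :: (real ^ 'd) set) \<times> {0..T}.
           ennreal \<bar>HJ_sol T norm (H_power (1 - \<alpha>)) (W n) (x, t) - max (norm x) (c0 * t powr \<alpha>)\<bar>)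
          \<le> ennreal (C * real (Suc n) powr (- \<alpha>))"
        using W(4) by (intro always_eventually allI SUP_least) (auto intro!: ennreal_leI simp del: of_nat_Suc)
    qed simp
    with W(1-3) show ?thesis by blast
  qed
  ultimately show ?thesis by blast
qed

end
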